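(* Let $N\ge2$, $1<p<N$, $p<q<p^*=\frac{Np}{N-p}$, and let $j:\mathbb{R}\times[0,\infty)\to\mathbb{R}$ be of class $C^1$ and satisfy the structural assumptions (J1)--(J7) listed in the context. Then the problem $$\int_{\mathbb{R}^N} j_t(u,|Du|)\frac{Du}{|Du|}\cdot Dv+\int_{\mathbb{R}^N} j_s(u,|Du|)v+\int_{\mathbb{R}^N}|u|^{p-2}uv=\int_{\mathbb{R}^N}|u|^{q-2}uv\qquad\text{for every } v\in C^\infty_c(\mathbb{R}^N)$$ admits a nontrivial radial positive solution $u\in W^{1,p}(\mathbb{R}^N)$.
   Context: Radial means $u(gx)=u(x)$ for a.e. $x\in\mathbb{R}^N$ and every $g$ in the orthogonal group $\mathscr O(N)$. $j_s,j_t$ denote the derivatives of $j(s,t)$ in $s$ and $t$; $j_t(u,|Du|)\frac{Du}{|Du|}$ is taken to be $0$ where $|Du|=0$. Assumptions on $j$ (for all $s\in\mathbb{R}$, $t\in[0,\infty)$ unless restricted): (J1) for every $s$, $t\mapsto j(s,t)$ is strictly convex and increasing; (J2) there are a constant $\alpha_0>0$ and a positive increasing $\alpha\in C(\mathbb{R})$ with $\alpha_0t^p\le j(s,t)\le\alpha(|s|)t^p$; (J3) there is a positive increasing $\beta\in C(\mathbb{R})$ with $|j_s(s,t)|\le\beta(|s|)t^p$; (J4) there is a positive increasing $\gamma\in C(\mathbb{R})$ with $|j_t(s,t)|\le\gamma(|s|)t^{p-1}$; (J5) there is $R>0$ with $j_s(s,t)s\ge0$ for all $|s|\ge R$; (J6)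 there are $R'>0$, $\delta>0$ with $q\,j(s,t)-j_s(s,t)s-(1+\delta)j_t(s,t)t\ge0$ for all $|s|\ge R'$; (J7) $\lim_{|s|\to\infty}\alpha(|s|)/|s|^{q-p}=0$. *)

theory Defs
  imports "HOL-Analysis.Analysis"
begin

definition strictly_convex_on :: "'a::real_vector set \<Rightarrow> ('a \<Rightarrow> real) \<Rightarrow> bool" where
  "strictly_convex_on S f \<longleftrightarrow> convex S \<and>
     (\<forall>x\<in>S. \<forall>y\<in>S. x \<noteq> y \<longrightarrow>
        (\<forall>l. 0 < l \<and> l < 1 \<longrightarrow>
           f ((1 - l) *\<^sub>R x + l *\<^sub>R y) < (1 - l) * f x + l * f y))"

text \<open>The derivative in \<open>t\<close> is one-sided at the boundary \<open>t = 0\<close>; the values of \<open>j\<close>, \<open>js\<close>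
  and \<open>jt\<close> for \<open>t < 0\<close> play no role.\<close>

definition C1_half_plane ::
  "(real \<Rightarrow> real \<Rightarrow> real) \<Rightarrow> (real \<Rightarrow> real \<Rightarrow> real) \<Rightarrow> (real \<Rightarrow> real \<Rightarrow> real) \<Rightarrow> bool" where
  "C1_half_plane j js jt \<longleftrightarrow>
     (\<forall>s. \<forall>t\<ge>0. ((\<lambda>s. j s t) has_real_derivative js s t) (at s)) \<and>
     (\<forall>s. \<forall>t\<ge>0. ((\<lambda>t. j s t) has_real_derivative jt s t) (at t within {0..})) \<and>
     continuous_on (UNIV \<times> {0..}) (\<lambda>(s, t). js s t) \<and>
     continuous_on (UNIV \<times> {0..}) (\<lambda>(s, t). jt s t)"

primrec times_differentiable :: "nat \<Rightarrow> ('a::euclidean_space \<Rightarrow> real) \<Rightarrow> bool" where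
  "times_differentiable 0 f \<longleftrightarrow> continuous_on UNIV f"
| "times_differentiable (Suc k) f \<longleftrightarrow>
     (\<forall>x. f differentiable (at x)) \<and>
     (\<forall>b\<in>Basis. times_differentiable k (\<lambda>x. frechet_derivative f (at x) b))"

definition test_function :: "('a::euclidean_space \<Rightarrow> real) \<Rightarrow> bool" where
  "test_function v \<longleftrightarrow>
     (\<forall>k. times_differentiable k v) \<and> compact (closure {x. v x \<noteq> 0})"

definition gradient :: "('a::euclidean_space \<Rightarrow> real) \<Rightarrow> 'a \<Rightarrow> 'a" where
  "gradient v x = (\<Sum>b\<in>Basis. frechet_derivative v (at x) b *\<^sub>R b)"

definition locally_integrable ::
  "('a::euclidean_space \<Rightarrow> 'b::{banach, second_countable_topology}) \<Rightarrow> bool" where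
  "locally_integrable f \<longleftrightarrow> (\<forall>K. compact K \<longrightarrow> set_integrable lebesgue K f)"

definition in_Lp :: "real \<Rightarrow> ('a::euclidean_space \<Rightarrow> 'b::euclidean_space) \<Rightarrow> bool" where
  "in_Lp p f \<longleftrightarrow>
     f \<in> borel_measurable lebesgue \<and> integrable lebesgue (\<lambda>x. norm (f x) powr p)"

text \<open>A weak gradient is determined only up to null sets, hence a relation.\<close>

definition has_weak_gradient ::
  "('a::euclidean_space \<Rightarrow> real) \<Rightarrow> ('a \<Rightarrow> 'a) \<Rightarrow> bool" where
  "has_weak_gradient u Du \<longleftrightarrow> locally_integrable u \<and> locally_integrable Du \<and>
     (\<forall>v. test_function v \<longrightarrow> (\<forall>b\<in>Basis.
        (\<integral>x. u x * (gradient v x \<bullet> b) \<partial>lebesgue) = - (\<integral>x. (Du x \<bullet> b) * v x \<partial>lebesgue)))"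

definition W1p :: "real \<Rightarrow> ('a::euclidean_space \<Rightarrow> real) set" where
  "W1p p = {u. in_Lp p u \<and> (\<exists>Du. has_weak_gradient u Du \<and> in_Lp p Du)}"

definition radial :: "('a::euclidean_space \<Rightarrow> real) \<Rightarrow> bool" where
  "radial u \<longleftrightarrow>
     (\<forall>g. orthogonal_transformation g \<longrightarrow> (AE x in lebesgue. u (g x) = u x))"

text \<open>The unit vector \<open>Du / |Du|\<close> is written \<open>sgn (Du x)\<close>, which is \<open>0\<close> where \<open>Du\<close> vanishes.
  Integrability of every term is required explicitly because the Bochner integral of a
  non-integrable function is \<open>0\<close> by convention.\<close>

definition solves_quasilinear ::
  "real \<Rightarrow> real \<Rightarrow> (real \<Rightarrow> real \<Rightarrow> real) \<Rightarrow> (real \<Rightarrow> real \<Rightarrow> real) \<Rightarrow>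
   ('a::euclidean_space \<Rightarrow> real) \<Rightarrow> ('a \<Rightarrow> 'a) \<Rightarrow> bool" where
  "solves_quasilinear p q js jt u Du \<longleftrightarrow> (\<forall>v. test_function v \<longrightarrow>
     integrable lebesgue (\<lambda>x. (jt (u x) (norm (Du x)) *\<^sub>R sgn (Du x)) \<bullet> gradient v x) \<and>
     integrable lebesgue (\<lambda>x. js (u x) (norm (Du x)) * v x) \<and>
     integrable lebesgue (\<lambda>x. \<bar>u x\<bar> powr (p - 2) * u x * v x) \<and>
     integrable lebesgue (\<lambda>x. \<bar>u x\<bar> powr (q - 2) * u x * v x) \<and>
     (\<integral>x. (jt (u x) (norm (Du x)) *\<^sub>R sgn (Du x)) \<bullet> gradient v x \<partial>lebesgue)
       + (\<integral>x. js (u x) (norm (Du x)) * v x \<partial>lebesgue)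
       + (\<integral>x. \<bar>u x\<bar> powr (p - 2) * u x * v x \<partial>lebesgue)
     = (\<integral>x. \<bar>u x\<bar> powr (q - 2) * u x * v x \<partial>lebesgue))"

end

theory Submission
  imports Defs
begin

text \<open>For radial \<open>u\<close> the equation is the Euler equation of
  \<open>\<integral> r\<^sup>N\<^sup>-\<^sup>1 (j(u, |u'|) + |u|\<^sup>p / p - |u|\<^sup>q / q) dr\<close>, a functional that is not differentiable on the
  Sobolev space. It is therefore discretised on a grid of width \<open>h\<close>, where it becomes a smooth function
  of finitely many variables with mountain pass geometry on the cone of nonnegative grid functions.
  With the weights \<open>i\<^sup>N\<^sup>-\<^sup>1\<close> in place of \<open>(i h)\<^sup>N\<^sup>-\<^sup>1\<close> the energy is decreasing in \<open>h\<close>, and its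
  derivative in \<open>h\<close> is controlled by \<open>\<integral> j\<^sub>t(u, |u'|) |u'|\<close>. Struwe's monotonicity trick in the parameter
  \<open>h\<close> thus gives, for some \<open>h\<close> in \<open>[h\<^sub>0, 2 h\<^sub>0]\<close>, a constrained critical point with a gradient bound
  independent of \<open>h\<^sub>0\<close>; this replaces a Pohozaev identity, and no Palais-Smale condition is needed.

  The gradient bound yields decay, the sign condition on \<open>j\<^sub>s\<close> a sup bound, and a discrete Gronwall
  argument a bound of the flux by \<open>r\<^sup>N\<close>. By compactness a subsequence converges, as \<open>h\<close> tends to \<open>0\<close>, to
  a solution of the radial equation which is at least \<open>1\<close> somewhere. A zero of it would propagate by
  local uniqueness, so it is positive. On the whole space the flux is a Lipschitz vector field, and
  the equation holds pointwise away from the origin.\<close>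

section \<open>Mountain passes for a monotone family of functionals\<close>

text \<open>The parameter h is a dilation in disguise: keeping the node values and stretching the
  mesh rescales the function, and only the gradient term feels it. The derivative in h thus plays
  the part of the dilation derivative behind Pohozaev's identity. The levels are at most of order h0
  to the power -N, their rates of order h0 to the power -N-1; as h stays within a factor 2 of h0,
  the volume factors turn both into constants free of the mesh.

  The obstacle is j_s: it grows like the p-th power of the slope, as fast as the energy density, and
  has a sign only for large u. On the grid it is controlled by the flux only where the jump of u
  across one cell is small, and only then do the complementarity conditions become equations. Hence
  the inner cut-off at node \<open>n0\<close>: away from the origin the gradient bound makes the
  jumps small if the mesh is fine compared with the cut-off radius, and both tend to 0 together.
  Limits are taken along nodes tending to a given radius, and the limit slope is recovered from the
  limit flux by strict monotonicity of j_t.\<close>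

lemma antitone_left_difference_quotient:
  fixes e :: "real \<Rightarrow> real"
  assumes ab: "a < b" and anti: "\<And>x y. a \<le> x \<Longrightarrow> x \<le> y \<Longrightarrow> y \<le> b \<Longrightarrow> e y \<le> e x"
    and K: "e a - e b < K * (b - a)" "0 \<le> K"
  obtains h where "a < h" "h \<le> b"
    "\<And>\<delta>. \<delta> > 0 \<Longrightarrow> \<exists>h'. a \<le> h' \<and> h - \<delta> < h' \<and> h' < h \<and> e h' - e h \<le> K * (h - h')"
proof (rule ccontr)
  assume nt: "\<not> thesis"
  note witness = that
  have neg: "\<exists>\<delta>>0. \<forall>h'. a \<le> h' \<and> h - \<delta> < h' \<and> h' < h \<longrightarrow> e h' - e h > K * (h - h')"
    if "a < h" "h \<le> b" for h
  proof (rule ccontr)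
    assume "\<not> ?thesis"
    then have "thesis" using that by (intro witness[of h]) (simp_all add: not_less, meson not_le)
    then show False using nt by simp
  qed
  \<comment> \<open>An elementary substitute for differentiability of monotone functions. Under the
    negation, every h in (a, b] has only larger values of \<open>g\<close> just to its left, so the
    infimum of the set where \<open>g\<close> is at least \<open>g b\<close> can only be a; then
    \<open>g b \<le> g a\<close> contradicts the strict bound on \<open>e a - e b\<close>.\<close>
  define g where "g = (\<lambda>x. e x + K * x)"
  define S where "S = {x\<in>{a..b}. g b \<le> g x}"
  define s where "s = Inf S"
  have bS: "b \<in> S" using ab by (auto simp: S_def)
  have bdd: "bdd_below S" by (auto simp: S_def bdd_below_def)
  have sb: "a \<le> s" "s \<le> b" using bS bdd unfolding s_def
    by (auto intro!: cInf_greatest cInf_lower simp: S_def)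
  \<comment> \<open>\<open>e\<close> may jump, but only downwards as its argument grows, so
    \<open>g x \<le> g s + K * (x - s)\<close> for x to the right of s. This one-sided bound
    replaces continuity in the passage to the infimum.\<close>
  have "g b \<le> g s + \<epsilon>" if "\<epsilon> > 0" for \<epsilon>
  proof -
    have pos: "\<epsilon> / (K + 1) > 0" using that K by simp
    obtain x where x: "x \<in> S" "x < s + \<epsilon> / (K + 1)"
      using cInf_lessD[of S "s + \<epsilon> / (K+1)"] bS pos unfolding s_def by auto
    have sx: "s \<le> x" using x(1) bdd unfolding s_def by (rule cInf_lower)
    have "g x \<le> g s + K * (x - s)"
      using anti[of s x] sx sb x(1) by (auto simp: g_def S_def algebra_simps)
    also have "K * (x - s) \<le> (K + 1) * (\<epsilon> / (K + 1))"
      using x(2) sx K pos by (intro mult_mono) auto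
    finally show ?thesis using x(1) K by (auto simp: S_def)
  qed
  then have sS: "g b \<le> g s" by (rule field_le_epsilon)
  show False
  proof (cases "s = a")
    case True
    then show ?thesis using sS K by (simp add: g_def algebra_simps)
  next
    case False
    then obtain \<delta> where \<delta>: "\<delta> > 0"
      "\<And>h'. a \<le> h' \<Longrightarrow> s - \<delta> < h' \<Longrightarrow> h' < s \<Longrightarrow> e h' - e s > K * (s - h')"
      using neg[of s] sb by auto
    define h' where "h' = max a (s - \<delta> / 2)"
    have h': "a \<le> h'" "s - \<delta> < h'" "h' < s" using False sb \<delta> by (auto simp: h'_def)
    have "g s < g h'" using \<delta>(2)[OF h'] by (simp add: g_def algebra_simps)
    then have "h' \<in> S" using sS h' sb by (auto simp: S_def)
    then have "s \<le> h'" unfolding s_def using bdd by (rule cInf_lower)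
    then show ?thesis using h' by simp
  qed
qed

text \<open>A deformation without a flow: \<open>G\<close> is uniformly continuous on the compact
  set, so the slope stays above \<eta>/2 during a step whose length s is common to all points of K
  with initial slope at least \<eta>.\<close>

lemma uniform_descent_step:
  fixes \<phi> :: "'a::metric_space \<Rightarrow> real"
  assumes K: "compact K" and G: "continuous_on ({0..1} \<times> K) (\<lambda>(\<sigma>, x). G \<sigma> x)"
    and der: "\<And>x \<sigma>. x \<in> K \<Longrightarrow> 0 \<le> \<sigma> \<Longrightarrow> \<sigma> \<le> 1 \<Longrightarrow>
        ((\<lambda>\<sigma>. \<phi> (\<Psi> \<sigma> x)) has_real_derivative - G \<sigma> x) (at \<sigma> within {0..1})"
    and \<Psi>0: "\<And>x. \<Psi> 0 x = x" and \<eta>: "\<eta> > 0"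
  obtains s where "0 < s" "s \<le> 1"
    "\<And>x \<sigma>. x \<in> K \<Longrightarrow> G 0 x \<ge> \<eta> \<Longrightarrow> 0 \<le> \<sigma> \<Longrightarrow> \<sigma> \<le> s \<Longrightarrow> \<phi> (\<Psi> \<sigma> x) \<le> \<phi> x - \<sigma> * \<eta> / 2"
proof -
  have "compact ({0..1::real} \<times> K)" using K by (intro compact_Times) auto
  from compact_uniformly_continuous[OF G this]
  obtain d where d: "d > 0" "\<And>z z'. z \<in> {0..1} \<times> K \<Longrightarrow> z' \<in> {0..1} \<times> K \<Longrightarrow> dist z' z < d \<Longrightarrow>
      dist ((\<lambda>(\<sigma>, x). G \<sigma> x) z') ((\<lambda>(\<sigma>, x). G \<sigma> x) z) < \<eta>/2"
    unfolding uniformly_continuous_on_def using \<eta> by (metis half_gt_zero)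
  define s where "s = min 1 (d/2)"
  have s: "0 < s" "s \<le> 1" "s < d" using d by (auto simp: s_def)
  have "\<phi> (\<Psi> \<sigma> x) \<le> \<phi> x - \<sigma> * \<eta> / 2" if x: "x \<in> K" "G 0 x \<ge> \<eta>" "0 \<le> \<sigma>" "\<sigma> \<le> s" for x \<sigma>
  proof (cases "\<sigma> = 0")
    case True
    then show ?thesis using \<Psi>0 by simp
  next
    case False
    then have "0 < \<sigma>" using x by simp
    have "\<exists>\<xi>\<in>{0<..<\<sigma>}. \<phi> (\<Psi> \<sigma> x) - \<phi> (\<Psi> 0 x) = (\<lambda>d. d * - G \<xi> x) (\<sigma> - 0)"
    proof (rule mvt_simple[OF \<open>0 < \<sigma>\<close>])
      fix \<xi> assume "0 \<le> \<xi>" "\<xi> \<le> \<sigma>"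
      then have "((\<lambda>\<sigma>. \<phi> (\<Psi> \<sigma> x)) has_real_derivative - G \<xi> x) (at \<xi> within {0..\<sigma>})"
        by (intro DERIV_subset[OF der]) (use x s in auto)
      then show "((\<lambda>\<sigma>. \<phi> (\<Psi> \<sigma> x)) has_derivative (\<lambda>d. d * - G \<xi> x)) (at \<xi> within {0..\<sigma>})"
        by (rule has_derivative_eq_rhs[OF has_field_derivative_imp_has_derivative]) auto
    qed
    then obtain \<xi> where \<xi>: "0 < \<xi>" "\<xi> < \<sigma>" "\<phi> (\<Psi> \<sigma> x) - \<phi> x = - \<sigma> * G \<xi> x"
      using \<Psi>0 by auto
    have "dist (G \<xi> x) (G 0 x) < \<eta>/2"
      using d(2)[of "(0,x)" "(\<xi>,x)"] x \<xi> s by (simp add: dist_Pair_Pair)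
    then have "G \<xi> x \<ge> \<eta>/2" using x(2) by (auto simp: dist_real_def abs_real_def split: if_splits)
    then have "\<sigma> * G \<xi> x \<ge> \<sigma> * (\<eta>/2)" using \<open>0 < \<sigma>\<close> by simp
    then show ?thesis using \<xi>(3) by simp
  qed
  then show ?thesis using that s by blast
qed

text \<open>At a suitable h the min-max level has difference quotients at most K = C / (b - a) for
  certain h' tending to h from the left. Almost optimal paths for such an h' exceed the level of h
  by at most (K + 1)(h - h'). Either a high point of such a path is almost critical, or one
  deformation step pushes the whole path below the min-max level of h. The difference quotients in
  the parameter are bounded at those high points, which in the limit becomes the bound on
  \<open>H\<close>.\<close>

theorem struwe_mountain_pass:
  fixes E H :: "real \<Rightarrow> 'a::metric_space \<Rightarrow> real" and G' :: "real \<Rightarrow> real \<Rightarrow> 'a \<Rightarrow> real"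
    and \<gamma>0 :: "real \<Rightarrow> 'a" and S :: "'a set" and \<Psi> :: "real \<Rightarrow> real \<Rightarrow> 'a \<Rightarrow> 'a"
  assumes ab: "a < b" and \<rho>: "0 < \<rho>"
    and x01: "x0 \<in> S" "x1 \<in> S" "\<And>h. a \<le> h \<Longrightarrow> h \<le> b \<Longrightarrow> E h x0 \<le> 0" "\<And>h. a \<le> h \<Longrightarrow> h \<le> b \<Longrightarrow> E h x1 \<le> 0"
    and contE: "\<And>h. a \<le> h \<Longrightarrow> h \<le> b \<Longrightarrow> continuous_on S (E h)"
    and derE: "\<And>h x. a \<le> h \<Longrightarrow> h \<le> b \<Longrightarrow> x \<in> S \<Longrightarrow> ((\<lambda>h. E h x) has_real_derivative - H h x) (at h)"
    and contH: "continuous_on ({a..b} \<times> S) (\<lambda>(h, x). H h x)"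
    and anti: "\<And>h h' x. a \<le> h \<Longrightarrow> h \<le> h' \<Longrightarrow> h' \<le> b \<Longrightarrow> x \<in> S \<Longrightarrow> E h' x \<le> E h x"
    and compK: "compact {x\<in>S. E a x \<ge> 0}"
    and path: "continuous_on {0..1} \<gamma>0" "\<gamma>0 ` {0..1} \<subseteq> S" "\<gamma>0 0 = x0" "\<gamma>0 1 = x1"
      "\<And>t. 0 \<le> t \<Longrightarrow> t \<le> 1 \<Longrightarrow> E a (\<gamma>0 t) \<le> C"
    and link: "\<And>h (\<gamma> :: real \<Rightarrow> 'a). a \<le> h \<Longrightarrow> h \<le> b \<Longrightarrow> continuous_on {0..1} \<gamma> \<Longrightarrow> \<gamma> ` {0..1} \<subseteq> S \<Longrightarrow> \<gamma> 0 = x0 \<Longrightarrow>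
       \<gamma> 1 = x1 \<Longrightarrow> \<exists>t\<in>{0..1}. E h (\<gamma> t) \<ge> \<rho>"
    and \<Psi>0: "\<And>h x. \<Psi> h 0 x = x"
    and \<Psi>S: "\<And>h \<sigma> x. a \<le> h \<Longrightarrow> h \<le> b \<Longrightarrow> x \<in> S \<Longrightarrow> 0 \<le> \<sigma> \<Longrightarrow> \<sigma> \<le> 1 \<Longrightarrow> \<Psi> h \<sigma> x \<in> S"
    and cont\<Psi>: "\<And>h. a \<le> h \<Longrightarrow> h \<le> b \<Longrightarrow> continuous_on ({0..1} \<times> S) (\<lambda>(\<sigma>, x). \<Psi> h \<sigma> x)"
    and contG: "\<And>h. a \<le> h \<Longrightarrow> h \<le> b \<Longrightarrow> continuous_on ({0..1} \<times> S) (\<lambda>(\<sigma>, x). G' h \<sigma> x)"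
    and derG: "\<And>h x \<sigma>. a \<le> h \<Longrightarrow> h \<le> b \<Longrightarrow> x \<in> S \<Longrightarrow> 0 \<le> \<sigma> \<Longrightarrow> \<sigma> \<le> 1 \<Longrightarrow>
        ((\<lambda>\<sigma>. E h (\<Psi> h \<sigma> x)) has_real_derivative - G' h \<sigma> x) (at \<sigma> within {0..1})"
    and G0: "\<And>h x. a \<le> h \<Longrightarrow> h \<le> b \<Longrightarrow> x \<in> S \<Longrightarrow> G' h 0 x \<ge> 0"
  obtains h x where "a < h" "h \<le> b" "x \<in> S" "E h x \<ge> \<rho>" "E h x \<le> C" "G' h 0 x = 0"
    "H h x \<le> C / (b - a) + 2"
proof -
  define P where "P = {\<gamma>. continuous_on {0..1::real} \<gamma> \<and> \<gamma> ` {0..1} \<subseteq> S \<and> \<gamma> 0 = x0 \<and> \<gamma> 1 = x1}"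
  define mx where "mx = (\<lambda>h \<gamma>. Sup ((\<lambda>t. E h (\<gamma> t)) ` {0..1::real}))"
  define e where "e = (\<lambda>h. Inf (mx h ` P))"
  define K where "K = C / (b - a)"
  have \<gamma>0: "\<gamma>0 \<in> P" using path by (auto simp: P_def)
  have PS: "\<gamma> t \<in> S" if "\<gamma> \<in> P" "0 \<le> t" "t \<le> 1" for \<gamma> t
    using that unfolding P_def by force
  have contE\<gamma>: "continuous_on {0..1} (\<lambda>t. E h (\<gamma> t))" if "\<gamma> \<in> P" "a \<le> h" "h \<le> b" for h \<gamma>
    using that contE[of h] by (auto simp: P_def intro!: continuous_on_compose2[of S "E h"])
  have bdd: "bdd_above ((\<lambda>t. E h (\<gamma> t)) ` {0..1::real})" if "\<gamma> \<in> P" "a \<le> h" "h \<le> b" for h \<gamma>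
    using contE\<gamma>[OF that] by (intro bounded_imp_bdd_above compact_imp_bounded compact_continuous_image) auto
  have mx_ge: "E h (\<gamma> t) \<le> mx h \<gamma>" if "\<gamma> \<in> P" "a \<le> h" "h \<le> b" "0 \<le> t" "t \<le> 1" for h \<gamma> t
    unfolding mx_def using bdd[OF that(1-3)] that(4,5) by (intro cSup_upper) auto
  have mx_le: "mx h \<gamma> \<le> c" if "\<And>t. 0 \<le> t \<Longrightarrow> t \<le> 1 \<Longrightarrow> E h (\<gamma> t) \<le> c" for h \<gamma> c
    unfolding mx_def using that by (intro cSup_least) auto
  have mx_rho: "\<rho> \<le> mx h \<gamma>" if \<gamma>: "\<gamma> \<in> P" "a \<le> h" "h \<le> b" for h \<gamma>
  proof -
    obtain t where "t \<in> {0..1}" "E h (\<gamma> t) \<ge> \<rho>"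
      using link[OF \<gamma>(2,3), of \<gamma>] \<gamma>(1) unfolding P_def by blast
    then show ?thesis using mx_ge[OF \<gamma>, of t] by auto
  qed
  have bddP: "bdd_below (mx h ` P)" if "a \<le> h" "h \<le> b" for h
    using mx_rho that by (meson bdd_belowI2)
  have e_le: "e h \<le> mx h \<gamma>" if "\<gamma> \<in> P" "a \<le> h" "h \<le> b" for h \<gamma>
    unfolding e_def using bddP that by (intro cInf_lower) auto
  have e_ge: "c \<le> e h" if "\<And>\<gamma>. \<gamma> \<in> P \<Longrightarrow> c \<le> mx h \<gamma>" for h c
    unfolding e_def using \<gamma>0 that by (intro cInf_greatest) auto
  have e_rho: "\<rho> \<le> e h" if "a \<le> h" "h \<le> b" for h
    using mx_rho that by (intro e_ge) auto
  have e_anti: "e y \<le> e x" if "a \<le> x" "x \<le> y" "y \<le> b" for x y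
  proof (rule e_ge)
    fix \<gamma> assume \<gamma>: "\<gamma> \<in> P"
    have "mx y \<gamma> \<le> mx x \<gamma>"
    proof (rule mx_le)
      fix t :: real assume t: "0 \<le> t" "t \<le> 1"
      have "E y (\<gamma> t) \<le> E x (\<gamma> t)" using anti[of x y "\<gamma> t"] that PS[OF \<gamma> t] by auto
      also have "\<dots> \<le> mx x \<gamma>" using mx_ge[OF \<gamma>, of x t] that t by auto
      finally show "E y (\<gamma> t) \<le> mx x \<gamma>" .
    qed
    then show "e y \<le> mx x \<gamma>" using e_le[OF \<gamma>, of y] that by auto
  qed
  have eC: "e h \<le> C" if "a \<le> h" "h \<le> b" for h
  proof -
    have "e h \<le> e a" using e_anti[of a h] that by auto
    also have "\<dots> \<le> mx a \<gamma>0" using e_le[OF \<gamma>0, of a] ab by auto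
    also have "\<dots> \<le> C" using path by (intro mx_le) auto
    finally show ?thesis .
  qed
  have Cpos: "0 < C" using eC[of a] e_rho[of a] \<rho> ab by auto
  have "e a - e b < K * (b - a)" using eC[of a] e_rho[of b] \<rho> ab by (auto simp: K_def)
  moreover have K0: "0 \<le> K" using Cpos ab by (simp add: K_def)
  ultimately obtain h where h: "a < h" "h \<le> b"
    and hh: "\<And>\<delta>. \<delta> > 0 \<Longrightarrow> \<exists>h'. a \<le> h' \<and> h - \<delta> < h' \<and> h' < h \<and> e h' - e h \<le> K * (h - h')"
    using antitone_left_difference_quotient[of a b e K] ab e_anti by blast
  define KK where "KK = {x\<in>S. E a x \<ge> 0}"
  have KKS: "KK \<subseteq> S" by (auto simp: KK_def)
  have step: "\<exists>h' x. a \<le> h' \<and> h - \<delta> < h' \<and> h' < h \<and> x \<in> KK \<and> E h x \<ge> e h - (h - h') \<and>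
      E h' x \<le> e h + (K + 1) * (h - h') \<and> G' h 0 x < \<eta>" if pos: "\<delta> > 0" "\<eta> > 0" for \<delta> \<eta>
  proof (rule ccontr)
    assume neg: "\<not> ?thesis"
    obtain s where s: "0 < s" "s \<le> 1" and
      des: "\<And>x \<sigma>. x \<in> KK \<Longrightarrow> G' h 0 x \<ge> \<eta> \<Longrightarrow> 0 \<le> \<sigma> \<Longrightarrow> \<sigma> \<le> s \<Longrightarrow> E h (\<Psi> h \<sigma> x) \<le> E h x - \<sigma> * \<eta> / 2"
    proof (rule uniform_descent_step[of KK "G' h" "E h" "\<Psi> h" \<eta>])
      show "compact KK" using compK by (simp add: KK_def)
      show "continuous_on ({0..1} \<times> KK) (\<lambda>(\<sigma>, x). G' h \<sigma> x)"
        by (rule continuous_on_subset[OF contG]) (use h KKS in auto)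
    qed (use h KKS derG \<Psi>0 pos in auto)
    \<comment> \<open>\<delta> keeps h' close to h, \<rho> keeps both endpoints below the cut-off
      level, and the last bound makes the excess (K + 1) \<tau> of the path at most half of the gain
      s \<eta> / 2.\<close>
    define \<delta>' where "\<delta>' = Min {\<delta>, \<rho>, s * \<eta> / (4 * (K + 1))}"
    have \<delta>': "\<delta>' > 0" "\<delta>' \<le> \<delta>" "\<delta>' \<le> \<rho>" "\<delta>' \<le> s * \<eta> / (4 * (K + 1))"
    proof -
      have "0 < s * \<eta> / (4 * (K + 1))" using pos s K0 by simp
      then show "\<delta>' > 0" using pos \<rho> by (simp add: \<delta>'_def)
    qed (auto simp: \<delta>'_def)
    obtain h' where h': "a \<le> h'" "h - \<delta>' < h'" "h' < h" "e h' - e h \<le> K * (h - h')"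
      using hh[OF \<delta>'(1)] by auto
    define \<tau> where "\<tau> = h - h'"
    have \<tau>: "0 < \<tau>" "\<tau> < \<delta>'" using h' by (auto simp: \<tau>_def)
    obtain \<gamma> where \<gamma>: "\<gamma> \<in> P" "mx h' \<gamma> < e h' + \<tau>"
    proof -
      have "Inf (mx h' ` P) < e h' + \<tau>" using \<tau> by (simp add: e_def)
      then show ?thesis using that cInf_lessD[of "mx h' ` P" "e h' + \<tau>"] \<gamma>0 by auto
    qed
    \<comment> \<open>0 below e h - \<tau> and 1 above e h - \<tau>/2: the step length depends
      continuously on the height, so the endpoints and the low part of the path stay put and the
      deformed path is again admissible.\<close>
    define cut where "cut = (\<lambda>y. max 0 (min 1 ((y - (e h - \<tau>)) / (\<tau>/2))))"
    have cut: "0 \<le> cut y" "cut y \<le> 1" for y by (auto simp: cut_def)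
    define \<Gamma> where "\<Gamma> = (\<lambda>t. \<Psi> h (s * cut (E h (\<gamma> t))) (\<gamma> t))"
    have cut0: "cut y = 0" if "y \<le> e h - \<tau>" for y
    proof -
      have "(y - (e h - \<tau>)) / (\<tau>/2) \<le> 0" using that \<tau> by (intro divide_nonpos_pos) auto
      then show ?thesis by (simp add: cut_def)
    qed
    have scut: "0 \<le> s * cut y" "s * cut y \<le> s" "s * cut y \<le> 1" for y
      using cut[of y] s mult_left_le[of "cut y" s] by (auto simp: order_trans[of "s * cut y" s 1])
    have \<Gamma>P: "\<Gamma> \<in> P"
    proof -
      have c1: "continuous_on {0..1} (\<lambda>t. cut (E h (\<gamma> t)))" unfolding cut_def
        using contE\<gamma>[OF \<gamma>(1), of h] h \<tau> by (auto intro!: continuous_intros)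
      have c2: "continuous_on {0..1} \<Gamma>"
        unfolding \<Gamma>_def
        by (rule continuous_on_compose2[OF cont\<Psi>[of h], of "{0..1}" "\<lambda>t. (s * cut (E h (\<gamma> t)), \<gamma> t)", simplified])
           (use h \<gamma>(1) scut c1 in \<open>auto simp: P_def intro!: continuous_intros\<close>)
      have "\<Gamma> ` {0..1} \<subseteq> S" using PS[OF \<gamma>(1)] \<Psi>S h scut by (auto simp: \<Gamma>_def)
      moreover have "cut (E h x0) = 0" "cut (E h x1) = 0"
        using x01(3,4)[of h] h e_rho[of h] \<tau> \<delta>' by (auto intro!: cut0)
      ultimately show ?thesis using c2 \<gamma>(1) by (auto simp: P_def \<Gamma>_def \<Psi>0)
    qed
    have "E h (\<Gamma> t) \<le> e h - \<tau>/2" if t: "0 \<le> t" "t \<le> 1" for t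
    proof (cases "E h (\<gamma> t) \<le> e h - \<tau>")
      case True
      then have "cut (E h (\<gamma> t)) = 0" by (rule cut0)
      then show ?thesis using True \<tau> by (simp add: \<Gamma>_def \<Psi>0)
    next
      case False
      have \<gamma>S: "\<gamma> t \<in> S" using PS[OF \<gamma>(1) t] .
      have "E h (\<gamma> t) \<ge> 0" using False e_rho[of h] h \<tau> \<delta>' by auto
      then have KKt: "\<gamma> t \<in> KK" using anti[of a h "\<gamma> t"] h \<gamma>S by (auto simp: KK_def)
      have up: "E h' (\<gamma> t) \<le> e h + (K + 1) * \<tau>"
        using mx_ge[OF \<gamma>(1), of h' t] \<gamma>(2) h h' t by (simp add: \<tau>_def algebra_simps)
      have "\<not> G' h 0 (\<gamma> t) < \<eta>"
      proof
        assume "G' h 0 (\<gamma> t) < \<eta>"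
        then have "a \<le> h' \<and> h - \<delta> < h' \<and> h' < h \<and> \<gamma> t \<in> KK \<and> E h (\<gamma> t) \<ge> e h - (h - h') \<and>
          E h' (\<gamma> t) \<le> e h + (K + 1) * (h - h') \<and> G' h 0 (\<gamma> t) < \<eta>"
          using h' \<delta>' KKt False up by (auto simp: \<tau>_def)
        then show False using neg by blast
      qed
      then have d: "E h (\<Gamma> t) \<le> E h (\<gamma> t) - s * cut (E h (\<gamma> t)) * \<eta> / 2"
        unfolding \<Gamma>_def using KKt scut by (intro des) auto
      show ?thesis
      proof (cases "E h (\<gamma> t) \<le> e h - \<tau>/2")
        case True
        have "0 \<le> s * cut (E h (\<gamma> t)) * \<eta> / 2" using scut[of "E h (\<gamma> t)"] \<open>\<eta> > 0\<close> by auto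
        then show ?thesis using True d by linarith
      next
        case False
        then have "(E h (\<gamma> t) - (e h - \<tau>)) / (\<tau>/2) \<ge> 1" using \<tau> by (simp add: field_simps)
        then have "cut (E h (\<gamma> t)) = 1" by (auto simp: cut_def)
        then have "E h (\<Gamma> t) \<le> E h (\<gamma> t) - s * \<eta> / 2" using d by simp
        moreover have "E h (\<gamma> t) \<le> E h' (\<gamma> t)" using anti[of h' h "\<gamma> t"] h' h \<gamma>S by auto
        moreover have "(K + 1) * \<tau> \<le> s * \<eta> / 4"
        proof -
          have "(K + 1) * \<tau> \<le> (K+1) * (s * \<eta> / (4 * (K + 1)))"
            using \<tau> \<delta>' K0 by (intro mult_left_mono) auto
          also have "\<dots> = s * \<eta> / 4" using K0 by (simp add: field_simps)
          finally show ?thesis .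
        qed
        moreover have "\<tau> \<le> (K + 1) * \<tau>" using K0 \<tau> by (simp add: algebra_simps)
        ultimately show ?thesis using up \<tau>(1) by linarith
      qed
    qed
    then have "mx h \<Gamma> \<le> e h - \<tau>/2" by (intro mx_le) auto
    then show False using e_le[OF \<Gamma>P, of h] h \<tau> by auto
  qed
  define Q where "Q = (\<lambda>n h' x. a \<le> h' \<and> h - 1 / Suc n < h' \<and> h' < h \<and> x \<in> KK \<and> E h x \<ge> e h - (h - h') \<and>
      E h' x \<le> e h + (K + 1) * (h - h') \<and> G' h 0 x < 1 / Suc n)"
  have "\<exists>h' x. Q n h' x" for n unfolding Q_def using step[of "1 / Suc n" "1 / Suc n"] by simp
  then obtain hs xs where Q: "\<And>n. Q n (hs n) (xs n)" by metis
  have "seq_compact KK" using compK by (simp add: KK_def compact_imp_seq_compact)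
  then obtain x r where x: "x \<in> KK" "strict_mono (r :: nat \<Rightarrow> nat)" "(xs \<circ> r) \<longlonglongrightarrow> x"
    using Q unfolding seq_compact_def Q_def by metis
  have xS: "x \<in> S" using x KKS by auto
  have xsS: "xs n \<in> S" for n using Q KKS by (auto simp: Q_def)
  have inv0: "(\<lambda>n. 1 / real (Suc (r n))) \<longlonglongrightarrow> 0"
    using LIMSEQ_subseq_LIMSEQ[OF LIMSEQ_Suc[OF lim_1_over_n] x(2)] by (simp add: o_def)
  have hs: "(\<lambda>n. hs (r n)) \<longlonglongrightarrow> h"
  proof (rule tendsto_sandwich[of "\<lambda>n. h - 1 / real (Suc (r n))" _ _ "\<lambda>n. h"])
    show "(\<lambda>n. h - 1 / real (Suc (r n))) \<longlonglongrightarrow> h" using tendsto_diff[OF tendsto_const inv0] by simp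
  qed (use Q in \<open>auto simp: Q_def intro!: eventuallyI less_imp_le\<close>)
  have xr: "(\<lambda>n. xs (r n)) \<longlonglongrightarrow> x" using x(3) by (simp add: o_def)
  have Ex: "(\<lambda>n. E h (xs (r n))) \<longlonglongrightarrow> E h x"
    by (rule continuous_on_tendsto_compose[OF contE xr]) (use h xS xsS in auto)
  have lim1: "(\<lambda>n. e h - (h - hs (r n))) \<longlonglongrightarrow> e h"
    using tendsto_diff[OF tendsto_const[of "e h"] tendsto_diff[OF tendsto_const[of h] hs]] by simp
  have "e h \<le> E h x"
    by (rule LIMSEQ_le[OF lim1 Ex]) (use Q in \<open>auto simp: Q_def\<close>)
  then have r1: "\<rho> \<le> E h x" using e_rho[of h] h by auto
  have lim2: "(\<lambda>n. e h + (K + 1) * (h - hs (r n))) \<longlonglongrightarrow> e h"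
    using tendsto_add[OF tendsto_const[of "e h"] tendsto_mult[OF tendsto_const[of "K+1"] tendsto_diff[OF tendsto_const[of h] hs]]] by simp
  have EE: "E h (xs n) \<le> e h + (K + 1) * (h - hs n)" for n
  proof -
    have "E h (xs n) \<le> E (hs n) (xs n)" using anti[of "hs n" h "xs n"] Q[of n] h xsS[of n] by (auto simp: Q_def)
    then show ?thesis using Q[of n] by (auto simp: Q_def)
  qed
  have "E h x \<le> e h" by (rule LIMSEQ_le[OF Ex lim2]) (use EE in auto)
  then have r2: "E h x \<le> C" using eC[of h] h by auto
  have "(\<lambda>n. (\<lambda>(\<sigma>, x). G' h \<sigma> x) (0, xs (r n))) \<longlonglongrightarrow> (\<lambda>(\<sigma>, x). G' h \<sigma> x) (0, x)"
    by (rule continuous_on_tendsto_compose[OF contG[of h]])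
       (use h xS xsS xr in \<open>auto intro!: tendsto_intros\<close>)
  then have "(\<lambda>n. G' h 0 (xs (r n))) \<longlonglongrightarrow> G' h 0 x" by simp
  then have "G' h 0 x \<le> 0"
    by (rule LIMSEQ_le[OF _ inv0]) (use Q in \<open>auto simp: Q_def intro: less_imp_le\<close>)
  then have r3: "G' h 0 x = 0" using G0[of h x] h xS by auto
  \<comment> \<open>At \<open>xs n\<close> the energy drops by at most (K + 2)(h - hs n) between the
    parameters \<open>hs n\<close> and h; the mean value theorem turns this into a bound on
    \<open>H\<close> at a parameter in between.\<close>
  have "\<exists>\<xi>. hs n < \<xi> \<and> \<xi> < h \<and> H \<xi> (xs n) \<le> K + 2" for n
  proof -
    have hn: "a \<le> hs n" "hs n < h" using Q[of n] by (auto simp: Q_def)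
    obtain \<xi> where \<xi>: "hs n < \<xi>" "\<xi> < h" "E h (xs n) - E (hs n) (xs n) = (h - hs n) * - H \<xi> (xs n)"
      using MVT2[of "hs n" h "\<lambda>h. E h (xs n)" "\<lambda>h. - H h (xs n)"] derE xsS[of n] hn h by auto
    have "(h - hs n) * H \<xi> (xs n) \<le> (h - hs n) * (K + 2)"
      using \<xi>(3) Q[of n] by (simp add: Q_def algebra_simps)
    then show ?thesis using \<xi> hn by auto
  qed
  then obtain \<xi> where \<xi>: "\<And>n. hs n < \<xi> n" "\<And>n. \<xi> n < h" "\<And>n. H (\<xi> n) (xs n) \<le> K + 2" by metis
  have \<xi>ab: "a \<le> \<xi> n" "\<xi> n \<le> b" for n
    using Q[of n] \<xi>(1,2)[of n] h unfolding Q_def by linarith+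
  have "(\<lambda>n. \<xi> (r n)) \<longlonglongrightarrow> h"
    by (rule tendsto_sandwich[OF _ _ hs tendsto_const]) (use \<xi> in \<open>auto intro!: eventuallyI less_imp_le\<close>)
  then have "(\<lambda>n. (\<lambda>(h, x). H h x) (\<xi> (r n), xs (r n))) \<longlonglongrightarrow> (\<lambda>(h, x). H h x) (h, x)"
    using h xS xsS xr \<xi>ab
    by (intro continuous_on_tendsto_compose[OF contH]) (auto intro!: tendsto_intros eventuallyI)
  then have "H h x \<le> K + 2"
    by (intro LIMSEQ_le[OF _ tendsto_const[of "K + 2"]]) (use \<xi> in auto)
  then show ?thesis using that[of h x] h xS r1 r2 r3 by (auto simp: K_def)
qed

section \<open>The integrand\<close>

lemma strictly_convex_on_imp_convex_on:
  assumes "strictly_convex_on S f"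
  shows "convex_on S f"
proof (rule convex_onI)
  fix t :: real and x y assume t: "0 < t" "t < 1" and xy: "x \<in> S" "y \<in> S"
  show "f ((1 - t) *\<^sub>R x + t *\<^sub>R y) \<le> (1 - t) * f x + t * f y"
  proof (cases "x = y")
    case True
    then show ?thesis by (simp add: algebra_simps flip: scaleR_left.add)
  next
    case False
    then show ?thesis using assms t xy unfolding strictly_convex_on_def by (simp add: less_imp_le)
  qed
qed (use assms in \<open>auto simp: strictly_convex_on_def\<close>)

locale quasilinear =
  fixes N :: nat and p q \<alpha>\<^sub>0 R :: real and j js jt :: "real \<Rightarrow> real \<Rightarrow> real" and \<alpha> \<beta> :: "real \<Rightarrow> real"
  assumes N2: "2 \<le> N" and p1: "1 < p" and pN: "p < real N"
    and pq: "p < q" and qcrit: "q < real N * p / (real N - p)"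
    and C1: "C1_half_plane j js jt"
    and j_convex: "\<And>s. strictly_convex_on {0..} (j s)" and j_mono: "\<And>s. mono_on {0..} (j s)"
    and \<alpha>0: "\<alpha>\<^sub>0 > 0" and \<alpha>_mono: "mono \<alpha>" and \<alpha>_pos: "\<And>x. \<alpha> x > 0"
    and j_bounds: "\<And>s t. t \<ge> 0 \<Longrightarrow> \<alpha>\<^sub>0 * t powr p \<le> j s t \<and> j s t \<le> \<alpha> \<bar>s\<bar> * t powr p"
    and \<beta>_mono: "mono \<beta>" and \<beta>_pos: "\<And>x. \<beta> x > 0"
    and js_bound: "\<And>s t. t \<ge> 0 \<Longrightarrow> \<bar>js s t\<bar> \<le> \<beta> \<bar>s\<bar> * t powr p"
    and jt_0 [simp]: "\<And>s. jt s 0 = 0"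
    and R_pos: "R > 0" and js_sign: "\<And>s t. t \<ge> 0 \<Longrightarrow> \<bar>s\<bar> \<ge> R \<Longrightarrow> js s t * s \<ge> 0"
    and \<alpha>_growth: "((\<lambda>s. \<alpha> \<bar>s\<bar> / \<bar>s\<bar> powr (q - p)) \<longlongrightarrow> 0) at_infinity"
begin

section \<open>Coercivity and strict monotonicity of j_t from convexity\<close>

lemma j_0 [simp]: "j s 0 = 0"
  using j_bounds[of 0 s] p1 by simp

lemma js_0 [simp]: "js s 0 = 0"
  using js_bound[of 0 s] p1 by simp

lemma j_nonneg: "t \<ge> 0 \<Longrightarrow> 0 \<le> j s t"
  using j_bounds[of t s] \<alpha>0 by (meson less_imp_le order_trans mult_nonneg_nonneg powr_ge_zero)

lemma j_deriv_s: "t \<ge> 0 \<Longrightarrow> ((\<lambda>s. j s t) has_real_derivative js s t) (at s)"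
  and j_deriv_t: "t \<ge> 0 \<Longrightarrow> (j s has_real_derivative jt s t) (at t within {0..})"
  and js_cont: "continuous_on (UNIV \<times> {0..}) (\<lambda>(s, t). js s t)"
  and jt_cont: "continuous_on (UNIV \<times> {0..}) (\<lambda>(s, t). jt s t)"
  using C1 by (auto simp: C1_half_plane_def)

lemma j_tangent:
  assumes "0 < c" "0 \<le> x"
  shows "j s x - j s c \<ge> jt s c * (x - c)"
  using assms strictly_convex_on_imp_convex_on[OF j_convex[of s]] j_deriv_t[of c s]
  by (intro convex_on_imp_above_tangent[where A = "{0..}"]) auto

text \<open>The tangent to \<open>j s\<close> at t lies below the graph; evaluated at 0, where
  \<open>j s\<close> vanishes, it gives \<open>j s t \<le> jt s t * t\<close>, and the lower bound
  on j carries over to its derivative.\<close>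

lemma jt_lower:
  assumes "0 \<le> t"
  shows "\<alpha>\<^sub>0 * t powr (p - 1) \<le> jt s t"
proof (cases "t = 0")
  case True
  then show ?thesis using p1 by simp
next
  case False
  then have t: "0 < t" using assms by simp
  have "\<alpha>\<^sub>0 * t powr p \<le> jt s t * t" using j_tangent[OF t, of 0 s] j_bounds[of t s] t by simp
  moreover have "t powr p = t powr (p - 1) * t" using t by (simp add: powr_mult_base powr_diff)
  ultimately show ?thesis using t by (metis mult.assoc mult_le_cancel_right_pos)
qed

lemma jt_nonneg: "0 \<le> t \<Longrightarrow> 0 \<le> jt s t"
  using jt_lower[of t s] \<alpha>0 by (meson less_imp_le order_trans mult_nonneg_nonneg powr_ge_zero)

text \<open>The midpoint value lies strictly below the chord but above the tangents at x and at y.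
  The case x = 0 is separate because \<open>j_tangent\<close> needs an interior base point.\<close>

lemma jt_strict_mono:
  assumes "0 \<le> x" "x < y"
  shows "jt s x < jt s y"
proof (cases "x = 0")
  case True
  have "0 < \<alpha>\<^sub>0 * y powr (p - 1)" using assms True \<alpha>0 by simp
  then show ?thesis using jt_lower[of y s] assms True by simp
next
  case False
  then have x: "0 < x" and y: "0 < y" using assms by auto
  have mid: "j s ((x + y) / 2) < (j s x + j s y) / 2"
  proof -
    have "j s ((1 - 1/2) *\<^sub>R x + (1/2) *\<^sub>R y) < (1 - 1/2) * j s x + (1/2) * j s y"
      using j_convex[of s] x y assms(2) unfolding strictly_convex_on_def
      by (metis atLeast_iff half_gt_zero_iff less_imp_le less_irrefl half_bounded_equal zero_less_one field_sum_of_halves less_add_same_cancel1)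
    moreover have "(1 - 1/2) *\<^sub>R x + (1/2) *\<^sub>R y = (x + y) / 2" by simp
    ultimately show ?thesis by (simp only:) simp
  qed
  have eq: "(x + y) / 2 - x = (y - x) / 2" "(x + y) / 2 - y = - ((y - x) / 2)" by (auto simp: field_simps)
  have "jt s x * ((y - x) / 2) < (j s x + j s y) / 2 - j s x"
    using j_tangent[OF x, of "(x + y) / 2" s] mid x y unfolding eq by simp
  moreover have "- (jt s y * ((y - x) / 2)) < (j s x + j s y) / 2 - j s y"
    using j_tangent[OF y, of "(x + y) / 2" s] mid x y unfolding eq by simp
  ultimately have "jt s x * ((y - x) / 2) < jt s y * ((y - x) / 2)" by argo
  then show ?thesis using assms by simp
qed

text \<open>Grid slopes carry a sign, so the integrand is extended evenly in its second variable.
  The extension is C1 on the whole plane because \<open>jt s 0 = 0\<close>; its derivative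
  \<open>Jt\<close> is odd in the slope.\<close>

definition J :: "real \<Rightarrow> real \<Rightarrow> real" where "J s \<tau> = j s \<bar>\<tau>\<bar>"
definition Js :: "real \<Rightarrow> real \<Rightarrow> real" where "Js s \<tau> = js s \<bar>\<tau>\<bar>"
definition Jt :: "real \<Rightarrow> real \<Rightarrow> real" where "Jt s \<tau> = jt s \<bar>\<tau>\<bar> * sgn \<tau>"

lemma J_0 [simp]: "J s 0 = 0" and Js_0 [simp]: "Js s 0 = 0" and Jt_0 [simp]: "Jt s 0 = 0"
  by (simp_all add: J_def Js_def Jt_def)

lemma J_upper: "J s \<tau> \<le> \<alpha> \<bar>s\<bar> * \<bar>\<tau>\<bar> powr p"
  using j_bounds[of "\<bar>\<tau>\<bar>" s] by (simp_all add: J_def)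

lemma J_nonneg: "0 \<le> J s \<tau>" by (simp add: J_def j_nonneg)

lemma J_mono: "\<bar>\<tau>\<bar> \<le> \<bar>\<tau>'\<bar> \<Longrightarrow> J s \<tau> \<le> J s \<tau>'"
  using mono_onD[OF j_mono[of s], of "\<bar>\<tau>\<bar>" "\<bar>\<tau>'\<bar>"] by (simp add: J_def)

lemma Js_bound: "\<bar>Js s \<tau>\<bar> \<le> \<beta> \<bar>s\<bar> * \<bar>\<tau>\<bar> powr p"
  by (simp add: Js_def js_bound)

lemma Js_nonneg: "R \<le> s \<Longrightarrow> 0 \<le> Js s \<tau>"
  using js_sign[of "\<bar>\<tau>\<bar>" s] R_pos by (auto simp: Js_def zero_le_mult_iff)

lemma abs_Jt: "\<bar>Jt s \<tau>\<bar> = jt s \<bar>\<tau>\<bar>"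
  using jt_nonneg[of "\<bar>\<tau>\<bar>" s] by (auto simp: Jt_def sgn_if abs_mult)

lemma Jt_lower: "\<alpha>\<^sub>0 * \<bar>\<tau>\<bar> powr (p - 1) \<le> \<bar>Jt s \<tau>\<bar>"
  by (simp add: abs_Jt jt_lower)

lemma Jt_times: "Jt s \<tau> * \<tau> = \<bar>Jt s \<tau>\<bar> * \<bar>\<tau>\<bar>"
  using jt_nonneg[of "\<bar>\<tau>\<bar>" s] by (auto simp: Jt_def sgn_if abs_mult)

lemma Jt_pos_iff [simp]: "0 < Jt s \<tau> \<longleftrightarrow> 0 < \<tau>" and Jt_neg_iff [simp]: "Jt s \<tau> < 0 \<longleftrightarrow> \<tau> < 0"
  using jt_strict_mono[of 0 "\<bar>\<tau>\<bar>" s] by (auto simp: Jt_def sgn_if zero_less_mult_iff mult_less_0_iff)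

lemma Jt_nonneg_iff [simp]: "0 \<le> Jt s \<tau> \<longleftrightarrow> 0 \<le> \<tau>" and Jt_nonpos_iff [simp]: "Jt s \<tau> \<le> 0 \<longleftrightarrow> \<tau> \<le> 0"
  and Jt_eq_0_iff [simp]: "Jt s \<tau> = 0 \<longleftrightarrow> \<tau> = 0"
  using Jt_pos_iff[of s \<tau>] Jt_neg_iff[of s \<tau>] by linarith+

lemma Jt_lower_times: "\<alpha>\<^sub>0 * \<bar>\<tau>\<bar> powr p \<le> Jt s \<tau> * \<tau>"
proof (cases "\<tau> = 0")
  case False
  have "\<alpha>\<^sub>0 * \<bar>\<tau>\<bar> powr p = \<alpha>\<^sub>0 * \<bar>\<tau>\<bar> powr (p - 1) * \<bar>\<tau>\<bar>"
    using False by (simp add: powr_diff)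
  also have "\<dots> \<le> \<bar>Jt s \<tau>\<bar> * \<bar>\<tau>\<bar>" using Jt_lower by (intro mult_right_mono) auto
  finally show ?thesis by (simp add: Jt_times)
qed (use p1 in simp)

lemma Jt_strict_mono: "x < y \<Longrightarrow> Jt s x < Jt s y"
proof -
  assume xy: "x < y"
  consider "0 \<le> x" | "y \<le> 0" | "x < 0" "0 < y" by linarith
  then show ?thesis
  proof cases
    case 1
    then show ?thesis using jt_strict_mono[of x y s] xy by (auto simp: Jt_def sgn_if split: if_splits)
  next
    case 2
    then show ?thesis using jt_strict_mono[of "-y" "-x" s] xy by (auto simp: Jt_def sgn_if split: if_splits)
  next
    case 3
    then have "Jt s x < 0" "0 < Jt s y" by simp_all
    then show ?thesis by linarith
  qed
qed

lemma Jt_less_iff [simp]: "Jt s x < Jt s y \<longleftrightarrow> x < y"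
  using Jt_strict_mono[of x y s] Jt_strict_mono[of y x s] by (metis linorder_neqE_linordered_idom less_asym)

section \<open>Continuity and differentiability of the extended integrand\<close>

lemma continuous_on_Js: "continuous_on UNIV (\<lambda>(s, \<tau>). Js s \<tau>)"
proof -
  have "continuous_on UNIV (\<lambda>z :: real \<times> real. (\<lambda>(s, t). js s t) (fst z, \<bar>snd z\<bar>))"
    by (rule continuous_on_compose2[OF js_cont]) (auto intro!: continuous_intros)
  then show ?thesis by (simp add: Js_def case_prod_unfold)
qed

lemma continuous_on_Jt: "continuous_on UNIV (\<lambda>(s, \<tau>). Jt s \<tau>)"
proof -
  \<comment> \<open>\<open>sgn\<close> is discontinuous, so \<open>Jt\<close> is written as the
    difference of its parts for positive and for negative slope; \<open>jt s 0 = 0\<close> removes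
    the inactive part.\<close>
  have "continuous_on UNIV (\<lambda>z :: real \<times> real. (\<lambda>(s, t). jt s t) (fst z, max (snd z) 0))"
    by (rule continuous_on_compose2[OF jt_cont]) (auto intro!: continuous_intros)
  moreover have "continuous_on UNIV (\<lambda>z :: real \<times> real. (\<lambda>(s, t). jt s t) (fst z, max (- snd z) 0))"
    by (rule continuous_on_compose2[OF jt_cont]) (auto intro!: continuous_intros)
  ultimately have "continuous_on UNIV (\<lambda>z :: real \<times> real. (\<lambda>(s, t). jt s t) (fst z, max (snd z) 0)
      - (\<lambda>(s, t). jt s t) (fst z, max (- snd z) 0))"
    by (rule continuous_on_diff)
  moreover have "Jt s \<tau> = jt s (max \<tau> 0) - jt s (max (- \<tau>) 0)" for s \<tau>
    by (auto simp: Jt_def sgn_if max_def)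
  ultimately show ?thesis by (simp add: case_prod_unfold)
qed

lemma continuous_on_Js_compose [continuous_intros]:
  "continuous_on S f \<Longrightarrow> continuous_on S g \<Longrightarrow> continuous_on S (\<lambda>x. Js (f x) (g x))"
  using continuous_on_compose2[OF continuous_on_Js, of S "\<lambda>x. (f x, g x)"] by (simp add: continuous_on_Pair)

lemma continuous_on_Jt_compose [continuous_intros]:
  "continuous_on S f \<Longrightarrow> continuous_on S g \<Longrightarrow> continuous_on S (\<lambda>x. Jt (f x) (g x))"
  using continuous_on_compose2[OF continuous_on_Jt, of S "\<lambda>x. (f x, g x)"] by (simp add: continuous_on_Pair)

lemma tendsto_Js [tendsto_intros]:
  assumes "(f \<longlongrightarrow> a) F" "(g \<longlongrightarrow> b) F"
  shows "((\<lambda>x. Js (f x) (g x)) \<longlongrightarrow> Js a b) F"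
  using isCont_tendsto_compose[of "(a, b)" "\<lambda>(s, \<tau>). Js s \<tau>" "\<lambda>x. (f x, g x)" F] continuous_on_Js assms
  by (auto simp: continuous_on_eq_continuous_at tendsto_Pair)

lemma tendsto_Jt [tendsto_intros]:
  assumes "(f \<longlongrightarrow> a) F" "(g \<longlongrightarrow> b) F"
  shows "((\<lambda>x. Jt (f x) (g x)) \<longlongrightarrow> Jt a b) F"
  using isCont_tendsto_compose[of "(a, b)" "\<lambda>(s, \<tau>). Jt s \<tau>" "\<lambda>x. (f x, g x)" F] continuous_on_Jt assms
  by (auto simp: continuous_on_eq_continuous_at tendsto_Pair)

lemma J_deriv_s: "((\<lambda>s. J s \<tau>) has_real_derivative Js s \<tau>) (at s)"
  unfolding J_def Js_def by (rule j_deriv_s) simp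

lemma j_deriv_0: "((\<lambda>\<tau>. J s \<tau>) has_real_derivative 0) (at 0)"
proof -
  have p0: "((\<lambda>\<tau>::real. \<alpha> \<bar>s\<bar> * \<bar>\<tau>\<bar> powr (p - 1)) \<longlongrightarrow> 0) (at 0)"
  proof -
    have "((\<lambda>\<tau>::real. \<alpha> \<bar>s\<bar> * \<bar>\<tau>\<bar> powr (p - 1)) \<longlongrightarrow> \<alpha> \<bar>s\<bar> * \<bar>0\<bar> powr (p - 1)) (at 0)"
      using p1 by (intro tendsto_mult tendsto_const tendsto_powr2 tendsto_rabs tendsto_ident_at) auto
    then show ?thesis using p1 by simp
  qed
  have "((\<lambda>\<tau>. (J s \<tau> - J s 0) / (\<tau> - 0)) \<longlongrightarrow> 0) (at 0)"
  proof (rule Lim_null_comparison[OF _ p0])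
    have "norm ((J s \<tau> - J s 0) / (\<tau> - 0)) \<le> \<alpha> \<bar>s\<bar> * \<bar>\<tau>\<bar> powr (p - 1)" if "\<tau> \<noteq> 0" for \<tau>
    proof -
      have "\<bar>J s \<tau>\<bar> \<le> \<alpha> \<bar>s\<bar> * \<bar>\<tau>\<bar> powr (p - 1) * \<bar>\<tau>\<bar>"
        using J_upper[of s \<tau>] J_nonneg[of s \<tau>] that by (simp add: powr_diff)
      then show ?thesis using that by (simp add: field_simps)
    qed
    then show "\<forall>\<^sub>F \<tau> in at 0. norm ((J s \<tau> - J s 0) / (\<tau> - 0)) \<le> \<alpha> \<bar>s\<bar> * \<bar>\<tau>\<bar> powr (p - 1)"
      by (auto simp: eventually_at_filter intro: eventuallyI)
  qed
  then show ?thesis by (simp add: has_field_derivative_iff)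
qed

lemma J_deriv_t: "((\<lambda>\<tau>. J s \<tau>) has_real_derivative Jt s \<tau>) (at \<tau>)"
proof -
  have jd: "(j s has_real_derivative jt s t) (at t)" if "0 < t" for t
    using j_deriv_t[of t s] that by (simp add: at_within_interior[of t "{0..}"] interior_real_atLeast)
  consider "\<tau> = 0" | "0 < \<tau>" | "\<tau> < 0" by linarith
  then show ?thesis
  proof cases
    case 1
    then show ?thesis using j_deriv_0 by simp
  next
    case 2
    have "((\<lambda>x. J s x) has_real_derivative jt s \<tau>) (at \<tau>)"
      by (rule has_field_derivative_transform_within[OF jd[OF 2] 2]) (auto simp: J_def dist_real_def)
    then show ?thesis using 2 by (simp add: Jt_def)
  next
    case 3
    have "((\<lambda>x. j s (- x)) has_real_derivative jt s (- \<tau>) * (- 1)) (at \<tau>)"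
      by (rule DERIV_chain2[OF jd]) (use 3 in \<open>auto intro!: derivative_eq_intros\<close>)
    then have "((\<lambda>x. J s x) has_real_derivative jt s (- \<tau>) * (- 1)) (at \<tau>)"
      by (rule has_field_derivative_transform_within[where d = "- \<tau>"])
        (use 3 in \<open>auto simp: J_def dist_real_def\<close>)
    then show ?thesis using 3 by (simp add: Jt_def)
  qed
qed

lemma J_has_derivative:
  "((\<lambda>(s, \<tau>). J s \<tau>) has_derivative (\<lambda>(x, y). Js s \<tau> * x + Jt s \<tau> * y)) (at (s, \<tau>))"
proof -
  have "((\<lambda>(s, \<tau>). J s \<tau>) has_derivative
      (\<lambda>(x, y). (\<lambda>x. Js s \<tau> * x) x + blinfun_apply (Jt s \<tau> *\<^sub>R id_blinfun) y)) (at (s, \<tau>) within UNIV \<times> UNIV)"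
  proof (rule has_derivative_partialsI)
    show "((\<lambda>s. J s \<tau>) has_derivative (*) (Js s \<tau>)) (at s)"
      using J_deriv_s[of \<tau> s] by (simp add: has_field_derivative_def)
    show "((\<lambda>\<tau>. J s \<tau>) has_derivative blinfun_apply (Jt s \<tau> *\<^sub>R id_blinfun)) (at \<tau>)" for s \<tau>
    proof -
      have "blinfun_apply (Jt s \<tau> *\<^sub>R id_blinfun) = (*) (Jt s \<tau>)"
        by (auto simp: blinfun.scaleR_left fun_eq_iff)
      then show ?thesis using J_deriv_t[of s \<tau>] by (simp add: has_field_derivative_def)
    qed
    have "continuous_on UNIV (\<lambda>z :: real \<times> real. Jt (fst z) (snd z) *\<^sub>R (id_blinfun :: real \<Rightarrow>\<^sub>L real))"
      by (intro continuous_intros)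
    then show "continuous (at (s, \<tau>) within UNIV \<times> UNIV)
       (\<lambda>(x, y). Jt x y *\<^sub>R (id_blinfun :: real \<Rightarrow>\<^sub>L real))"
      by (simp add: case_prod_unfold continuous_on_eq_continuous_at)
  qed auto
  then show ?thesis by (simp add: blinfun.scaleR_left case_prod_unfold)
qed

lemma J_has_field_derivative:
  assumes "(f has_real_derivative f') (at x within A)" "(g has_real_derivative g') (at x within A)"
  shows "((\<lambda>x. J (f x) (g x)) has_real_derivative Js (f x) (g x) * f' + Jt (f x) (g x) * g') (at x within A)"
proof -
  have "((\<lambda>x. (\<lambda>(s, \<tau>). J s \<tau>) (f x, g x)) has_derivative
     (\<lambda>h. (\<lambda>(u, v). Js (f x) (g x) * u + Jt (f x) (g x) * v) (f' * h, g' * h))) (at x within A)"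
    using assms by (intro has_derivative_compose[OF has_derivative_Pair J_has_derivative])
      (simp_all add: has_field_derivative_def)
  moreover have "(\<lambda>h. (\<lambda>(u, v). Js (f x) (g x) * u + Jt (f x) (g x) * v) (f' * h, g' * h))
      = (*) (Js (f x) (g x) * f' + Jt (f x) (g x) * g')"
    by (auto simp: fun_eq_iff algebra_simps)
  ultimately show ?thesis by (simp add: has_field_derivative_def)
qed

lemma continuous_on_J_compose [continuous_intros]:
  assumes "continuous_on S f" "continuous_on S g"
  shows "continuous_on S (\<lambda>x. J (f x) (g x))"
proof -
  have "continuous_on UNIV (\<lambda>(s, \<tau>). J s \<tau>)"
    using J_has_derivative by (auto simp: continuous_on_eq_continuous_at intro: has_derivative_continuous)
  from continuous_on_compose2[OF this, of S "\<lambda>x. (f x, g x)"] assms show ?thesis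
    by (simp add: continuous_on_Pair)
qed

text \<open>T is chosen so that the coercive lower bound exceeds the absolute value of y, and the
  values at -T and T enclose y. The lemma recovers a slope from a given flux in the limit.\<close>

lemma Jt_inverse:
  obtains d where "Jt s d = y"
proof -
  define T where "T = ((\<bar>y\<bar> + 1) / \<alpha>\<^sub>0) powr (1 / (p - 1))"
  have T: "0 \<le> T" "\<alpha>\<^sub>0 * T powr (p - 1) = \<bar>y\<bar> + 1"
    using \<alpha>0 p1 by (auto simp: T_def powr_powr)
  have "\<bar>y\<bar> \<le> Jt s T" using Jt_lower[of T s] T by auto
  moreover have "Jt s (- T) \<le> - \<bar>y\<bar>"
    using Jt_lower[of "- T" s] T by (cases "T = 0") (auto simp: abs_if split: if_splits)
  moreover have "continuous_on {- T..T} (Jt s)" by (intro continuous_intros)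
  ultimately show ?thesis
    using IVT'[of "Jt s" "-T" y T] T that abs_ge_self[of y] abs_ge_minus_self[of y]
    by (metis add.inverse_inverse le_imp_neg_le minus_le_iff neg_le_0_iff_le order_trans)
qed

section \<open>The potential of the zero-order terms\<close>

definition F :: "real \<Rightarrow> real" where "F s = \<bar>s\<bar> powr p / p - \<bar>s\<bar> powr q / q"
definition F' :: "real \<Rightarrow> real" where "F' s = (\<bar>s\<bar> powr (p - 1) - \<bar>s\<bar> powr (q - 1)) * sgn s"

lemma abs_powr_has_field_derivative:
  assumes "1 < r"
  shows "((\<lambda>s :: real. \<bar>s\<bar> powr r / r) has_real_derivative \<bar>s\<bar> powr (r - 1) * sgn s) (at s)"
proof -
  have pos: "((\<lambda>s :: real. s powr r / r) has_real_derivative s powr (r - 1)) (at s)" if "0 < s" for s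
    using that assms by (auto intro!: derivative_eq_intros simp: powr_diff)
  consider "s = 0" | "0 < s" | "s < 0" by linarith
  then show ?thesis
  proof cases
    case 1
    have "((\<lambda>s::real. \<bar>s\<bar> powr (r - 1) / r) \<longlongrightarrow> \<bar>0\<bar> powr (r - 1) / r) (at 0)"
      using assms by (intro tendsto_divide tendsto_const tendsto_powr2 tendsto_rabs tendsto_ident_at) auto
    then have lim: "((\<lambda>s::real. \<bar>s\<bar> powr (r - 1) / r) \<longlongrightarrow> 0) (at 0)" using assms by simp
    have "((\<lambda>s::real. (\<bar>s\<bar> powr r / r - \<bar>0\<bar> powr r / r) / (s - 0)) \<longlongrightarrow> 0) (at 0)"
      by (rule Lim_null_comparison[OF _ lim])
        (use assms in \<open>auto simp: eventually_at_filter powr_diff field_simps abs_mult intro!: eventuallyI\<close>)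
    then show ?thesis using 1 by (simp add: has_field_derivative_iff)
  next
    case 2
    have "((\<lambda>s :: real. \<bar>s\<bar> powr r / r) has_real_derivative s powr (r - 1)) (at s)"
      by (rule has_field_derivative_transform_within[OF pos[OF 2] 2]) (auto simp: dist_real_def)
    then show ?thesis using 2 by simp
  next
    case 3
    have "((\<lambda>s :: real. (- s) powr r / r) has_real_derivative (- s) powr (r - 1) * (- 1)) (at s)"
      by (rule DERIV_chain2[OF pos]) (use 3 in \<open>auto intro!: derivative_eq_intros\<close>)
    then have "((\<lambda>s :: real. \<bar>s\<bar> powr r / r) has_real_derivative (- s) powr (r - 1) * (- 1)) (at s)"
      by (rule has_field_derivative_transform_within[where d = "- s"])
        (use 3 in \<open>auto simp: dist_real_def\<close>)
    then show ?thesis using 3 by simp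
  qed
qed

lemma F_has_field_derivative: "(F has_real_derivative F' s) (at s)"
  using DERIV_diff[OF abs_powr_has_field_derivative[OF p1, of s] abs_powr_has_field_derivative[of q s]] p1 pq
  by (simp add: F_def[abs_def] F'_def left_diff_distrib)

lemma continuous_on_F' [continuous_intros]:
  assumes f: "continuous_on S f"
  shows "continuous_on S (\<lambda>x. F' (f x))"
proof -
  have F'_eq: "F' s = (max s 0 powr (p - 1) - max s 0 powr (q - 1)) - (max (- s) 0 powr (p - 1) - max (- s) 0 powr (q - 1))" for s
    using p1 pq by (auto simp: F'_def sgn_if max_def)
  show ?thesis unfolding F'_eq using p1 pq f
    by (intro continuous_intros continuous_on_powr') auto
qed

lemma continuous_on_F [continuous_intros]: "continuous_on S f \<Longrightarrow> continuous_on S (\<lambda>x. F (f x))"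
  using continuous_on_compose2[of UNIV F S f] DERIV_continuous_on[of UNIV F F'] F_has_field_derivative
  by (simp add: has_field_derivative_at_within)

lemma F_0 [simp]: "F 0 = 0" and F'_0 [simp]: "F' 0 = 0"
  by (simp_all add: F_def F'_def)

text \<open>For values in [0, 1] every term of the energy is nonnegative, which provides the ridge
  of the mountain pass.\<close>

lemma F_nonneg_small: "0 \<le> s \<Longrightarrow> s \<le> 1 \<Longrightarrow> 0 \<le> F s"
proof (cases "s = 0")
  case False
  assume s: "0 \<le> s" "s \<le> 1"
  then have "s powr q \<le> s powr p" using False pq by (intro powr_mono') auto
  then have "s powr q / q \<le> s powr p / p" using p1 pq by (intro frac_le) auto
  then show ?thesis using s by (simp add: F_def)
qed simp

end

section \<open>The discrete energy\<close>

lemma continuous_on_Max_image: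
  fixes f :: "'i \<Rightarrow> 'a::topological_space \<Rightarrow> real"
  assumes "finite I" "I \<noteq> {}" "\<And>i. i \<in> I \<Longrightarrow> continuous_on A (f i)"
  shows "continuous_on A (\<lambda>x. Max ((\<lambda>i. f i x) ` I))"
  using assms
proof (induction I rule: finite_ne_induct)
  case (insert i I)
  then have "continuous_on A (\<lambda>x. max (f i x) (Max ((\<lambda>i. f i x) ` I)))"
    by (intro continuous_intros) auto
  then show ?case using insert by simp
qed auto

lemma sum_by_parts_zero_ends:
  fixes w v :: "nat \<Rightarrow> 'a::comm_ring"
  assumes "n \<le> m"
  shows "(\<Sum>i=Suc n..Suc m. w i * (v i - v (i - 1)))
    = (\<Sum>i=n..m. (w i - w (Suc i)) * v i) + w (Suc m) * v (Suc m) - w n * v n"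
  using assms
proof (induction m rule: dec_induct)
  case base
  then show ?case by (simp add: algebra_simps)
next
  case (step m)
  then show ?case by (simp add: algebra_simps)
qed

text \<open>Grid functions live on all of \<open>nat\<close>, so that one type serves every mesh.
  Compactness is Tychonoff's theorem; through sequential compactness it also supplies the diagonal
  subsequence for the limit of the meshes.\<close>

lemma compact_box_fun:
  fixes B :: real
  shows "compact {u :: nat \<Rightarrow> real. \<forall>i. 0 \<le> u i \<and> u i \<le> B}"
proof -
  have "compactin (product_topology (\<lambda>i. euclidean) UNIV) (PiE UNIV (\<lambda>i :: nat. {0..B}))"
    by (subst compactin_PiE) auto
  moreover have "PiE UNIV (\<lambda>i :: nat. {0..B}) = {u. \<forall>i. 0 \<le> u i \<and> u i \<le> B}"
    by (auto simp: PiE_def)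
  ultimately show ?thesis by (simp add: euclidean_product_topology)
qed

context quasilinear
begin

text \<open>The limit \<open>\<alpha>_growth\<close> absorbs any constant. It is used twice: to make
  the energy negative at large functions on a fixed mesh, and to choose the height of the far
  endpoint of the paths.\<close>

lemma growth:
  obtains B where "1 \<le> B" "\<And>\<mu>. B \<le> \<mu> \<Longrightarrow> C * (\<alpha> \<mu> + 1) < \<mu> powr (q - p)"
proof -
  define \<epsilon> where "\<epsilon> = 1 / (2 * (\<bar>C\<bar> + 1))"
  have \<epsilon>: "0 < \<epsilon>" "C * \<epsilon> < 1/2" by (auto simp: \<epsilon>_def field_simps)
  have "\<forall>\<^sub>F s in at_top. \<alpha> \<bar>s\<bar> / \<bar>s\<bar> powr (q - p) < \<epsilon>"
    using order_tendstoD(2)[OF \<alpha>_growth \<epsilon>(1)] by (rule filter_leD[OF at_top_le_at_infinity])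
  moreover have "filterlim (\<lambda>s::real. s powr (q - p)) at_top at_top"
  proof -
    have "filterlim (\<lambda>s::real. exp ((q - p) * ln s)) at_top at_top"
      using pq by (intro filterlim_compose[OF exp_at_top]
          filterlim_tendsto_pos_mult_at_top[OF tendsto_const] ln_at_top) auto
    moreover have "\<forall>\<^sub>F s::real in at_top. s powr (q - p) = exp ((q - p) * ln s)"
      using eventually_gt_at_top[of 0] by eventually_elim (simp add: powr_def)
    ultimately show ?thesis by (subst filterlim_cong[OF refl refl])
  qed
  then have "\<forall>\<^sub>F s::real in at_top. s powr (q - p) > 2 * \<bar>C\<bar> + 1"
    by (simp add: filterlim_at_top_dense)
  moreover have "\<forall>\<^sub>F s::real in at_top. s \<ge> 1" by (rule eventually_ge_at_top)
  ultimately have "\<forall>\<^sub>F s in at_top. C * (\<alpha> s + 1) < s powr (q - p)"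
  proof eventually_elim
    case (elim s)
    then have P: "0 < s powr (q - p)" by simp
    then have "\<alpha> s \<le> \<epsilon> * s powr (q - p)" using elim by (simp add: field_simps)
    then have "C * \<alpha> s \<le> \<bar>C\<bar> * (\<epsilon> * s powr (q - p))" using \<alpha>_pos[of s]
      by (intro mult_mono) auto
    also have "\<dots> = (\<bar>C\<bar> * \<epsilon>) * s powr (q - p)" by simp
    also have "\<dots> \<le> 1/2 * s powr (q - p)" using P by (intro mult_right_mono) (auto simp: \<epsilon>_def field_simps)
    finally have "C * \<alpha> s \<le> 1/2 * s powr (q - p)" .
    moreover have "C < 1/2 * s powr (q - p)" using elim by auto
    ultimately show ?case by (simp add: algebra_simps)
  qed
  then obtain B0 where "\<And>s. B0 \<le> s \<Longrightarrow> C * (\<alpha> s + 1) < s powr (q - p)"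
    by (auto simp: eventually_at_top_linorder)
  then show ?thesis using that[of "max 1 B0"] by auto
qed

end

locale mesh = quasilinear +
  fixes n0 m :: nat
  assumes n0: "1 \<le> n0" and nm: "n0 \<le> m"
begin

text \<open>No difference is taken across \<open>n0\<close>: the inner end is free and the flux
  vanishes there, the discrete form of regularity at the origin. The outer end is a Dirichlet
  condition, imposed by \<open>feasible\<close>.\<close>

definition slope :: "real \<Rightarrow> (nat \<Rightarrow> real) \<Rightarrow> nat \<Rightarrow> real" where
  "slope h u i = (if i \<le> n0 then 0 else (u i - u (i - 1)) / h)"

text \<open>The sum includes \<open>Suc m\<close> to count the last difference, from
  \<open>u m\<close> down to 0. The factor \<open>h ^ N\<close> that would make it a Riemann sum is
  restored only in the estimates.\<close>

definition energy :: "real \<Rightarrow> (nat \<Rightarrow> real) \<Rightarrow> real" where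
  "energy h u = (\<Sum>i=n0..Suc m. real i ^ (N - 1) * (J (u i) (slope h u i) + F (u i)))"

definition flux :: "real \<Rightarrow> (nat \<Rightarrow> real) \<Rightarrow> nat \<Rightarrow> real" where
  "flux h u i = real i ^ (N - 1) * Jt (u i) (slope h u i)"

definition grad :: "real \<Rightarrow> (nat \<Rightarrow> real) \<Rightarrow> nat \<Rightarrow> real" where
  "grad h u i = (flux h u i - flux h u (Suc i)) / h
     + real i ^ (N - 1) * (Js (u i) (slope h u i) + F' (u i))"

definition mesh_rate :: "real \<Rightarrow> (nat \<Rightarrow> real) \<Rightarrow> real" where
  "mesh_rate h u = (\<Sum>i=n0..Suc m. flux h u i * slope h u i) / h"

definition feasible :: "(nat \<Rightarrow> real) set" where
  "feasible = {u. (\<forall>i. 0 \<le> u i) \<and> (\<forall>i. i < n0 \<or> m < i \<longrightarrow> u i = 0)}"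

text \<open>A bounded descent direction that keeps the feasible set invariant: a positive component of the
  gradient is damped by \<open>min 1 (u i)\<close> near the boundary of the feasible set.\<close>

definition descent :: "real \<Rightarrow> (nat \<Rightarrow> real) \<Rightarrow> nat \<Rightarrow> real" where
  "descent h u i = (if n0 \<le> i \<and> i \<le> m then
     (max 0 (grad h u i) * min 1 (u i) - max 0 (- grad h u i)) / (1 + (\<Sum>k=n0..m. (grad h u k)\<^sup>2)) else 0)"

lemma slope_n0 [simp]: "slope h u n0 = 0" by (simp add: slope_def)
lemma flux_n0 [simp]: "flux h u n0 = 0" by (simp add: flux_def)

lemma continuous_on_slope [continuous_intros]:
  assumes "continuous_on A h" "\<And>i. continuous_on A (\<lambda>x. u x i)" "\<And>x. x \<in> A \<Longrightarrow> h x \<noteq> 0"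
  shows "continuous_on A (\<lambda>x. slope (h x) (u x) i)"
  using assms by (cases "i \<le> n0") (auto simp: slope_def intro!: continuous_intros)

lemma continuous_on_energy:
  assumes "continuous_on A h" "\<And>i. continuous_on A (\<lambda>x. u x i)" "\<And>x. x \<in> A \<Longrightarrow> h x \<noteq> 0"
  shows "continuous_on A (\<lambda>x. energy (h x) (u x))"
  using assms unfolding energy_def by (intro continuous_intros) auto

lemma continuous_on_flux [continuous_intros]:
  assumes "continuous_on A h" "\<And>i. continuous_on A (\<lambda>x. u x i)" "\<And>x. x \<in> A \<Longrightarrow> h x \<noteq> 0"
  shows "continuous_on A (\<lambda>x. flux (h x) (u x) i)"
  using assms unfolding flux_def by (intro continuous_intros) auto

lemma continuous_on_grad [continuous_intros]:
  assumes "continuous_on A h" "\<And>i. continuous_on A (\<lambda>x. u x i)" "\<And>x. x \<in> A \<Longrightarrow> h x \<noteq> 0"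
  shows "continuous_on A (\<lambda>x. grad (h x) (u x) i)"
  using assms unfolding grad_def by (intro continuous_intros) auto

lemma continuous_on_mesh_rate:
  assumes "continuous_on A h" "\<And>i. continuous_on A (\<lambda>x. u x i)" "\<And>x. x \<in> A \<Longrightarrow> h x \<noteq> 0"
  shows "continuous_on A (\<lambda>x. mesh_rate (h x) (u x))"
  using assms unfolding mesh_rate_def by (intro continuous_intros) auto

lemma continuous_on_descent [continuous_intros]:
  assumes "continuous_on A h" "\<And>i. continuous_on A (\<lambda>x. u x i)" "\<And>x. x \<in> A \<Longrightarrow> h x \<noteq> 0"
  shows "continuous_on A (\<lambda>x. descent (h x) (u x) i)"
proof (cases "n0 \<le> i \<and> i \<le> m")
  case True
  have "1 + (\<Sum>k=n0..m. (grad (h x) (u x) k)\<^sup>2) \<noteq> 0" for x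
    using sum_nonneg[of "{n0..m}" "\<lambda>k. (grad (h x) (u x) k)\<^sup>2"] by auto
  then show ?thesis using assms True unfolding descent_def by (simp, intro continuous_intros) auto
next
  case False
  then have "descent (h x) (u x) i = 0" for x by (auto simp: descent_def)
  then show ?thesis by simp
qed

section \<open>Derivatives of the energy in the grid function and in the mesh width\<close>

lemma energy_line_deriv:
  assumes v: "v (Suc m) = 0" and h: "h \<noteq> 0"
  shows "((\<lambda>\<sigma>. energy h (\<lambda>i. u i - \<sigma> * v i)) has_real_derivative
     - (\<Sum>i=n0..m. grad h (\<lambda>i. u i - \<sigma> * v i) i * v i)) (at \<sigma> within A)"
proof -
  define U where "U = (\<lambda>\<sigma> i. u i - \<sigma> * v i)"
  define dv where "dv = slope h v"
  have slopeU: "slope h (U \<sigma>) i = slope h u i - \<sigma> * dv i" for \<sigma> i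
    using h by (simp add: slope_def U_def dv_def field_simps)
  have trm: "((\<lambda>\<sigma>. real i ^ (N - 1) * (J (U \<sigma> i) (slope h (U \<sigma>) i) + F (U \<sigma> i))) has_real_derivative
     - (real i ^ (N - 1) * (Js (U \<sigma> i) (slope h (U \<sigma>) i) + F' (U \<sigma> i)) * v i + flux h (U \<sigma>) i * dv i))
     (at \<sigma> within A)" for i
  proof -
    have U': "((\<lambda>\<sigma>. U \<sigma> i) has_real_derivative - v i) (at \<sigma> within A)"
      unfolding U_def by (auto intro!: derivative_eq_intros)
    have S': "((\<lambda>\<sigma>. slope h (U \<sigma>) i) has_real_derivative - dv i) (at \<sigma> within A)"
      unfolding slopeU by (auto intro!: derivative_eq_intros)
    have "((\<lambda>\<sigma>. real i ^ (N - 1) * (J (U \<sigma> i) (slope h (U \<sigma>) i) + F (U \<sigma> i))) has_real_derivative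
       real i ^ (N - 1) * ((Js (U \<sigma> i) (slope h (U \<sigma>) i) * (- v i) + Jt (U \<sigma> i) (slope h (U \<sigma>) i) * (- dv i))
         + F' (U \<sigma> i) * (- v i))) (at \<sigma> within A)"
      by (intro DERIV_cmult DERIV_add J_has_field_derivative[OF U' S'] DERIV_chain2[OF F_has_field_derivative U'])
    then show ?thesis by (rule DERIV_cong) (simp add: flux_def algebra_simps)
  qed
  have "((\<lambda>\<sigma>. energy h (U \<sigma>)) has_real_derivative
     (\<Sum>i=n0..Suc m. - (real i ^ (N - 1) * (Js (U \<sigma> i) (slope h (U \<sigma>) i) + F' (U \<sigma> i)) * v i
       + flux h (U \<sigma>) i * dv i))) (at \<sigma> within A)"
    unfolding energy_def by (rule DERIV_sum[OF trm])
  moreover have "(\<Sum>i=n0..Suc m. - (real i ^ (N - 1) * (Js (U \<sigma> i) (slope h (U \<sigma>) i) + F' (U \<sigma> i)) * v i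
       + flux h (U \<sigma>) i * dv i)) = - (\<Sum>i=n0..m. grad h (U \<sigma>) i * v i)"
  proof -
    have "(\<Sum>i=n0..Suc m. flux h (U \<sigma>) i * dv i) = (\<Sum>i=Suc n0..Suc m. flux h (U \<sigma>) i * dv i)"
      using nm by (subst sum.atLeast_Suc_atMost) (auto simp: dv_def)
    also have "\<dots> = (\<Sum>i=Suc n0..Suc m. flux h (U \<sigma>) i * (v i - v (i - 1))) / h"
      unfolding sum_divide_distrib by (intro sum.cong) (auto simp: dv_def slope_def)
    \<comment> \<open>Both boundary terms vanish: the flux is 0 at \<open>n0\<close>, and v is 0 at
      \<open>Suc m\<close>.\<close>
    also have "\<dots> = (\<Sum>i=n0..m. (flux h (U \<sigma>) i - flux h (U \<sigma>) (Suc i)) / h * v i)"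
      using sum_by_parts_zero_ends[OF nm, of "flux h (U \<sigma>)" v] v
      by (simp add: sum_divide_distrib)
    finally have "(\<Sum>i=n0..Suc m. flux h (U \<sigma>) i * dv i) = \<dots>" .
    moreover have "(\<Sum>i=n0..Suc m. real i ^ (N - 1) * (Js (U \<sigma> i) (slope h (U \<sigma>) i) + F' (U \<sigma> i)) * v i)
      = (\<Sum>i=n0..m. real i ^ (N - 1) * (Js (U \<sigma> i) (slope h (U \<sigma>) i) + F' (U \<sigma> i)) * v i)"
      using nm v by simp
    ultimately show ?thesis
      unfolding sum_negf sum.distrib grad_def distrib_right by simp
  qed
  ultimately show ?thesis by (simp add: U_def)
qed

lemma energy_mesh_deriv:
  assumes "0 < h"
  shows "((\<lambda>h. energy h u) has_real_derivative - mesh_rate h u) (at h)"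
proof -
  have trm: "((\<lambda>h. real i ^ (N - 1) * (J (u i) (slope h u i) + F (u i))) has_real_derivative
     - (flux h u i * slope h u i / h)) (at h)" for i
  proof -
    have S': "((\<lambda>h. slope h u i) has_real_derivative - (slope h u i / h)) (at h)"
    proof (cases "i \<le> n0")
      case False
      have "((\<lambda>h. (u i - u (i - 1)) / h) has_real_derivative - ((u i - u (i - 1)) / h / h)) (at h)"
        using assms by (auto intro!: derivative_eq_intros simp: field_simps)
      then show ?thesis using False by (simp add: slope_def)
    qed (simp add: slope_def)
    have "((\<lambda>h. real i ^ (N - 1) * (J (u i) (slope h u i) + F (u i))) has_real_derivative
       real i ^ (N - 1) * ((Js (u i) (slope h u i) * 0 + Jt (u i) (slope h u i) * (- (slope h u i / h))) + 0)) (at h)"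
      by (intro DERIV_cmult DERIV_add J_has_field_derivative[OF DERIV_const S'] DERIV_const)
    then show ?thesis by (rule DERIV_cong) (simp add: flux_def)
  qed
  have "((\<lambda>h. energy h u) has_real_derivative (\<Sum>i=n0..Suc m. - (flux h u i * slope h u i / h))) (at h)"
    unfolding energy_def by (rule DERIV_sum[OF trm])
  then show ?thesis by (simp only: mesh_rate_def sum_divide_distrib sum_negf)
qed

lemma energy_antitone:
  assumes "0 < h" "h \<le> h'"
  shows "energy h' u \<le> energy h u"
proof -
  have "\<bar>slope h' u i\<bar> \<le> \<bar>slope h u i\<bar>" for i
    using assms by (auto simp: slope_def abs_divide intro!: divide_left_mono)
  then show ?thesis unfolding energy_def
    by (intro sum_mono mult_left_mono add_mono J_mono) auto
qed

section \<open>The feasible cone: compactness and descent steps\<close>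

lemma feasible_nonneg: "u \<in> feasible \<Longrightarrow> 0 \<le> u i" by (simp add: feasible_def)

lemma feasible_max:
  assumes u: "u \<in> feasible"
  obtains k \<mu> where "n0 \<le> k" "k \<le> m" "u k = \<mu>" "\<And>i. u i \<le> \<mu>"
proof -
  define \<mu> where "\<mu> = Max (u ` {n0..m})"
  have "\<mu> \<in> u ` {n0..m}" unfolding \<mu>_def using nm by (intro Max_in) auto
  then obtain k where k: "n0 \<le> k" "k \<le> m" "u k = \<mu>" by auto
  have "u i \<le> \<mu>" for i
  proof (cases "n0 \<le> i \<and> i \<le> m")
    case True
    then show ?thesis by (simp add: \<mu>_def)
  next
    case False
    then show ?thesis using u k feasible_nonneg[OF u, of k] by (auto simp: feasible_def)
  qed
  with k show thesis by (rule that)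
qed

lemma slope_bound:
  assumes "u \<in> feasible" "\<And>i. u i \<le> \<mu>" "0 < h"
  shows "\<bar>slope h u i\<bar> \<le> \<mu> / h"
proof -
  have "\<bar>u i - u (i - 1)\<bar> \<le> \<mu>"
    using assms(2)[of i] assms(2)[of "i - 1"] feasible_nonneg[OF assms(1), of i] feasible_nonneg[OF assms(1), of "i - 1"]
    by linarith
  moreover have "0 \<le> \<mu>" using assms(2)[of 0] feasible_nonneg[OF assms(1), of 0] by linarith
  ultimately show ?thesis using assms(3) by (auto simp: slope_def abs_divide intro!: divide_right_mono)
qed

text \<open>At a node where u takes its maximum \<mu> the negative term is at least
  \<open>\<mu> powr q / q\<close>, since the weights are at least 1. Slopes are at most \<mu> / h,
  so all positive terms together are of order \<open>(\<alpha> \<mu> + 1) * \<mu> powr p\<close>,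
  with a constant that may depend on the mesh; \<open>growth\<close> then excludes large
  \<mu>.\<close>

lemma energy_anticoercive:
  assumes h: "0 < h"
  obtains B where "\<And>u i. u \<in> feasible \<Longrightarrow> 0 \<le> energy h u \<Longrightarrow> u i \<le> B"
proof -
  define L where "L = real (Suc m) ^ N * q"
  define C where "C = L * (1 / h powr p + 1)"
  have L0: "0 < L" using p1 pq by (simp add: L_def)
  then have C0: "0 < C" using h by (simp add: C_def add_pos_pos)
  obtain B where B: "1 \<le> B" "\<And>\<mu>. B \<le> \<mu> \<Longrightarrow> C * (\<alpha> \<mu> + 1) < \<mu> powr (q - p)" using growth[of C] by blast
  have "u i \<le> B" if u: "u \<in> feasible" "0 \<le> energy h u" for u i
  proof (rule ccontr)
    assume "\<not> u i \<le> B"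
    obtain k \<mu> where k: "n0 \<le> k" "k \<le> m" "u k = \<mu>" and ule: "\<And>k. u k \<le> \<mu>"
      using u by (auto elim: feasible_max)
    have \<mu>B: "B < \<mu>" using ule[of i] \<open>\<not> u i \<le> B\<close> by simp
    then have \<mu>: "1 < \<mu>" using B by simp
    define M where "M = (\<alpha> \<mu> + 1) * (1 / h powr p + 1) * \<mu> powr p"
    have trm: "J (u l) (slope h u l) + \<bar>u l\<bar> powr p / p \<le> M" for l
    proof -
      have "J (u l) (slope h u l) \<le> \<alpha> \<bar>u l\<bar> * \<bar>slope h u l\<bar> powr p" by (rule J_upper)
      also have "\<dots> \<le> \<alpha> \<mu> * (\<mu> / h) powr p"
        using slope_bound[OF u(1) ule h] ule[of l] u p1 \<alpha>_pos[of "\<mu>"]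
        by (intro mult_mono powr_mono2 monoD[OF \<alpha>_mono]) (auto simp: feasible_def less_imp_le)
      also have "\<dots> = \<alpha> \<mu> * (1 / h powr p) * \<mu> powr p" using \<mu> h by (simp add: powr_divide)
      finally have 1: "J (u l) (slope h u l) \<le> \<alpha> \<mu> * (1 / h powr p) * \<mu> powr p" .
      have "\<bar>u l\<bar> powr p / p \<le> \<mu> powr p / 1"
        using ule[of l] u p1 by (intro frac_le powr_mono2) (auto simp: feasible_def)
      then have 2: "\<bar>u l\<bar> powr p / p \<le> \<mu> powr p" by simp
      have "0 \<le> (\<alpha> \<mu> + 1 / h powr p) * \<mu> powr p" using \<alpha>_pos[of \<mu>] by simp
      then show ?thesis using 1 2 by (simp add: M_def algebra_simps add_divide_distrib)
    qed
    have M0: "0 \<le> M" using trm[of 0] J_nonneg[of "u 0" "slope h u 0"] p1 by (smt (verit) divide_nonneg_pos powr_ge_zero)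
    have "energy h u = (\<Sum>i=n0..Suc m. real i ^ (N - 1) * (J (u i) (slope h u i) + \<bar>u i\<bar> powr p / p))
       - (\<Sum>i=n0..Suc m. real i ^ (N - 1) * (\<bar>u i\<bar> powr q / q))"
      unfolding energy_def F_def sum_subtractf[symmetric]
      by (intro sum.cong refl) (simp only: right_diff_distrib[symmetric] add_diff_eq)
    also have "(\<Sum>i=n0..Suc m. real i ^ (N - 1) * (J (u i) (slope h u i) + \<bar>u i\<bar> powr p / p))
       \<le> (\<Sum>i=n0..Suc m. real (Suc m) ^ (N - 1) * M)"
      using trm M0 p1 by (intro sum_mono mult_mono power_mono) (auto simp: J_nonneg intro!: add_nonneg_nonneg divide_nonneg_nonneg)
    also have "\<dots> \<le> real (Suc m) ^ N * M"
    proof -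
      have "real (card {n0..Suc m}) \<le> real (Suc m)" using n0 by simp
      then have "real (card {n0..Suc m}) * (real (Suc m) ^ (N - 1) * M) \<le> real (Suc m) * (real (Suc m) ^ (N - 1) * M)"
        using M0 by (intro mult_right_mono) auto
      also have "\<dots> = real (Suc m) ^ N * M" using N2 by (simp add: power_eq_if)
      finally show ?thesis by simp
    qed
    also have "(\<Sum>i=n0..Suc m. real i ^ (N - 1) * (\<bar>u i\<bar> powr q / q)) \<ge> real k ^ (N - 1) * (\<bar>u k\<bar> powr q / q)"
      using k p1 pq by (intro member_le_sum) auto
    moreover have "real k ^ (N - 1) * (\<bar>u k\<bar> powr q / q) \<ge> 1 * (\<mu> powr q / q)"
      using k n0 \<mu> p1 pq by (intro mult_mono) (auto simp: one_le_power)
    ultimately have "energy h u \<le> real (Suc m) ^ N * M - \<mu> powr q / q" by linarith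
    then have "\<mu> powr q / q \<le> real (Suc m) ^ N * M" using u by linarith
    then have "\<mu> powr q \<le> L * M" using p1 pq by (simp add: L_def field_simps)
    also have "L * M = C * (\<alpha> \<mu> + 1) * \<mu> powr p" by (simp add: M_def C_def)
    also have "\<dots> < \<mu> powr (q - p) * \<mu> powr p" using B(2)[of \<mu>] \<mu>B \<mu> by (intro mult_strict_right_mono) auto
    also have "\<dots> = \<mu> powr q" by (simp flip: powr_add)
    finally show False by simp
  qed
  then show ?thesis using that by blast
qed

lemma closed_feasible: "closed feasible"
proof -
  have "feasible = (\<Inter>i. {u. 0 \<le> u i}) \<inter> (\<Inter>i\<in>{i. i < n0 \<or> m < i}. {u. u i = 0})"
    by (auto simp: feasible_def)
  moreover have "closed {u :: nat \<Rightarrow> real. 0 \<le> u i}" for i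
    by (intro closed_Collect_le continuous_intros continuous_on_product_coordinates)
  moreover have "closed {u :: nat \<Rightarrow> real. u i = 0}" for i
    by (intro closed_Collect_eq continuous_intros continuous_on_product_coordinates)
  ultimately show ?thesis by (auto intro!: closed_Int closed_INT)
qed

lemma compact_superlevel:
  assumes h: "0 < h"
  shows "compact {u\<in>feasible. energy h u \<ge> 0}"
proof -
  obtain B where B: "\<And>u i. u \<in> feasible \<Longrightarrow> 0 \<le> energy h u \<Longrightarrow> u i \<le> B" using energy_anticoercive[OF h] by blast
  have "closed {u. energy h u \<ge> 0}"
    using h by (intro closed_Collect_le continuous_intros continuous_on_energy continuous_on_product_coordinates) auto
  then have "compact ({u. \<forall>i. 0 \<le> u i \<and> u i \<le> B} \<inter> ({u. energy h u \<ge> 0} \<inter> feasible))"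
    by (intro compact_Int_closed compact_box_fun closed_Int closed_feasible)
  also have "{u. \<forall>i. 0 \<le> u i \<and> u i \<le> B} \<inter> ({u. energy h u \<ge> 0} \<inter> feasible) = {u\<in>feasible. energy h u \<ge> 0}"
    using B by (auto simp: feasible_def)
  finally show ?thesis .
qed

text \<open>The denominator of \<open>descent\<close> dominates every positive gradient component,
  because x is at most 1 plus its square, and the factor \<open>min 1 (u i)\<close> is at most
  \<open>u i\<close>. Hence a step of length at most 1 cannot leave the cone.\<close>

lemma descent_bounds:
  assumes "u \<in> feasible"
  shows "descent h u i \<le> u i"
proof (cases "n0 \<le> i \<and> i \<le> m")
  case True
  define S where "S = 1 + (\<Sum>k=n0..m. (grad h u k)\<^sup>2)"
  have "(grad h u i)\<^sup>2 \<le> (\<Sum>k=n0..m. (grad h u k)\<^sup>2)" using True by (intro member_le_sum) auto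
  moreover have "max 0 (grad h u i) \<le> 1 + (grad h u i)\<^sup>2"
    using sum_squares_bound[of 1 "grad h u i"] by (auto simp: max_def power2_eq_square intro: order_trans[OF _ add_mono])
  ultimately have S: "max 0 (grad h u i) \<le> S" "0 < S"
    by (auto simp: S_def intro!: add_pos_nonneg add_nonneg_nonneg sum_nonneg)
  have ui: "0 \<le> u i" using assms by (rule feasible_nonneg)
  have "max 0 (grad h u i) * min 1 (u i) - max 0 (- grad h u i) \<le> S * u i"
    using S ui by (intro order_trans[OF _ mult_mono[of "max 0 (grad h u i)" S "min 1 (u i)" "u i"]]) auto
  then show ?thesis using True S by (simp add: descent_def field_simps flip: S_def)
next
  case False
  then show ?thesis using feasible_nonneg[OF assms] by (auto simp: descent_def)
qed

lemma descent_step_feasible: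
  assumes "u \<in> feasible" "0 \<le> \<sigma>" "\<sigma> \<le> 1"
  shows "(\<lambda>i. u i - \<sigma> * descent h u i) \<in> feasible"
proof -
  have "\<sigma> * descent h u i \<le> u i" for i
  proof (cases "0 \<le> descent h u i")
    case True
    then have "\<sigma> * descent h u i \<le> descent h u i" using assms by (simp add: mult_left_le_one_le)
    then show ?thesis using descent_bounds[OF assms(1), of h i] by linarith
  next
    case False
    then have "\<sigma> * descent h u i \<le> 0" using assms by (simp add: mult_nonneg_nonpos)
    then show ?thesis using feasible_nonneg[OF assms(1), of i] by linarith
  qed
  then show ?thesis using assms(1) by (auto simp: feasible_def descent_def)
qed

text \<open>The damping changes the size but not the sign of a component, and a positive component
  is damped to 0 only where u vanishes. Vanishing slope therefore means the complementarity
  conditions, not the vanishing of the gradient.\<close>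

lemma grad_descent:
  assumes "u \<in> feasible" "n0 \<le> i" "i \<le> m"
  shows "0 \<le> grad h u i * descent h u i"
    "grad h u i * descent h u i = 0 \<Longrightarrow> 0 \<le> grad h u i \<and> grad h u i * u i = 0"
proof -
  define S where "S = 1 + (\<Sum>k=n0..m. (grad h u k)\<^sup>2)"
  have S: "0 < S" by (auto simp: S_def intro!: add_pos_nonneg sum_nonneg)
  have ui: "0 \<le> u i" using assms by (auto intro: feasible_nonneg)
  have eq: "descent h u i = (max 0 (grad h u i) * min 1 (u i) - max 0 (- grad h u i)) / S"
    using assms by (simp add: descent_def S_def)
  show "0 \<le> grad h u i * descent h u i"
    using S ui by (auto simp: eq max_def zero_le_divide_iff intro!: mult_nonneg_nonneg mult_nonpos_nonpos divide_nonpos_pos)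
  show "grad h u i * descent h u i = 0 \<Longrightarrow> 0 \<le> grad h u i \<and> grad h u i * u i = 0"
    using S ui by (auto simp: eq max_def min_def split: if_splits)
qed

text \<open>The ridge is the unit sphere of the maximum norm: all terms are nonnegative on it, and
  the node with value 1 alone contributes at least \<open>F 1 = 1 / p - 1 / q\<close>.\<close>

lemma unit_sphere_level:
  assumes u: "u \<in> feasible" "Max (u ` {n0..m}) = 1" and h: "0 < h"
  shows "1 / p - 1 / q \<le> energy h u"
proof -
  have u1: "0 \<le> u i \<and> u i \<le> 1" for i
  proof (cases "n0 \<le> i \<and> i \<le> m")
    case True
    then show ?thesis using Max_ge[of "u ` {n0..m}" "u i"] u by (auto simp: feasible_nonneg)
  next
    case False
    then have "u i = 0" using u by (auto simp: feasible_def)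
    then show ?thesis by simp
  qed
  have "1 \<in> u ` {n0..m}" using u(2) nm Max_in[of "u ` {n0..m}"] by auto
  then obtain k where k: "n0 \<le> k" "k \<le> m" "u k = 1" by auto
  have "1 / p - 1 / q = 1 * F (u k)" using k by (simp add: F_def)
  also have "\<dots> \<le> real k ^ (N - 1) * (J (u k) (slope h u k) + F (u k))"
    using k n0 u1 F_nonneg_small[of "u k"] J_nonneg[of "u k" "slope h u k"]
    by (intro mult_mono) (auto simp: one_le_power)
  also have "\<dots> \<le> energy h u" unfolding energy_def
    using k u1 J_nonneg F_nonneg_small
    by (intro member_le_sum[of k "{n0..Suc m}" "\<lambda>k. real k ^ (N - 1) * (J (u k) (slope h u k) + F (u k))"]) auto
  finally show ?thesis .
qed

text \<open>The parameter interval \<open>[h0, 2 * h0]\<close> has length \<open>h0\<close>, whence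
  the rate \<open>C / h0 + 2\<close>. The path from 0 to \<open>e0\<close> is the segment, and the
  descent step plays the deformation.\<close>

theorem discrete_mountain_pass:
  assumes h0: "0 < h0" and e0: "e0 \<in> feasible" "n0 \<le> k0" "k0 \<le> m" "1 < e0 k0"
    and neg: "\<And>h. h0 \<le> h \<Longrightarrow> h \<le> 2 * h0 \<Longrightarrow> energy h e0 \<le> 0"
    and C: "\<And>t. 0 \<le> t \<Longrightarrow> t \<le> 1 \<Longrightarrow> energy h0 (\<lambda>i. t * e0 i) \<le> C"
  obtains h u where "h0 < h" "h \<le> 2 * h0" "u \<in> feasible" "1 / p - 1 / q \<le> energy h u" "energy h u \<le> C"
    "\<And>i. n0 \<le> i \<Longrightarrow> i \<le> m \<Longrightarrow> 0 \<le> grad h u i \<and> grad h u i * u i = 0"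
    "mesh_rate h u \<le> C / h0 + 2"
proof -
  have pos: "0 < h" if "h0 \<le> h" for h using that h0 by simp
  have coord: "continuous_on A (\<lambda>u :: nat \<Rightarrow> real. u i)" for A i
    by (rule continuous_on_subset[OF continuous_on_product_coordinates]) simp
  have coord2: "continuous_on A (\<lambda>x :: real \<times> (nat \<Rightarrow> real). snd x i)" for A i
    by (rule continuous_on_compose2[OF coord[of UNIV] continuous_on_snd[OF continuous_on_id]]) auto
  obtain h u where hu: "h0 < h" "h \<le> 2 * h0" "u \<in> feasible" "energy h u \<ge> 1 / p - 1 / q" "energy h u \<le> C"
    "(\<Sum>i=n0..m. grad h (\<lambda>i. u i - 0 * descent h u i) i * descent h u i) = 0"
    "mesh_rate h u \<le> C / (2 * h0 - h0) + 2"
  proof (rule struwe_mountain_pass[of h0 "2 * h0" "1 / p - 1 / q" "\<lambda>i. 0" feasible e0 energy mesh_rate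
        "\<lambda>t i. t * e0 i" C "\<lambda>h \<sigma> u i. u i - \<sigma> * descent h u i"
        "\<lambda>h \<sigma> u. \<Sum>i=n0..m. grad h (\<lambda>i. u i - \<sigma> * descent h u i) i * descent h u i"])
    show "1 / p - 1 / q > 0" using p1 pq by (simp add: field_simps)
    show "energy h (\<lambda>i. 0) \<le> 0" for h 
    proof -
      have "slope h (\<lambda>i. 0) i = 0" for i by (auto simp: slope_def)
      then show ?thesis by (simp add: energy_def)
    qed
    show "continuous_on feasible (energy h)" if "h0 \<le> h" for h
      using continuous_on_energy[of feasible "\<lambda>_. h" "\<lambda>u. u"] pos[OF that] by (simp add: coord)
    show "((\<lambda>h. energy h x) has_real_derivative - mesh_rate h x) (at h)" if "h0 \<le> h" for h x
      using energy_mesh_deriv pos that by blast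
    show "continuous_on ({h0..2 * h0} \<times> feasible) (\<lambda>(h, x). mesh_rate h x)"
      unfolding case_prod_unfold using h0
      by (intro continuous_on_mesh_rate continuous_intros coord2) auto
    show "compact {u\<in>feasible. energy h0 u \<ge> 0}" by (rule compact_superlevel[OF h0])
    show "continuous_on {0..1} (\<lambda>t i. t * e0 i)"
      by (intro continuous_on_coordinatewise_then_product continuous_intros)
    show "(\<lambda>t i. t * e0 i) ` {0..1} \<subseteq> feasible" using e0 by (auto simp: feasible_def)
    show "continuous_on ({0..1} \<times> feasible) (\<lambda>(\<sigma>, u) i. u i - \<sigma> * descent h u i)" if "h0 \<le> h" for h
      unfolding case_prod_unfold using pos[OF that]
      by (intro continuous_on_coordinatewise_then_product continuous_intros coord2) auto
    show "continuous_on ({0..1} \<times> feasible)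
       (\<lambda>(\<sigma>, u). \<Sum>i=n0..m. grad h (\<lambda>i. u i - \<sigma> * descent h u i) i * descent h u i)" if "h0 \<le> h" for h
      unfolding case_prod_unfold using pos[OF that]
      by (intro continuous_intros coord2) auto
    show "((\<lambda>\<sigma>. energy h (\<lambda>i. u i - \<sigma> * descent h u i)) has_real_derivative
       - (\<Sum>i=n0..m. grad h (\<lambda>i. u i - \<sigma> * descent h u i) i * descent h u i)) (at \<sigma> within {0..1})"
      if "h0 \<le> h" for h u \<sigma>
      using pos[OF that] by (intro energy_line_deriv) (auto simp: descent_def)
    show "0 \<le> (\<Sum>i=n0..m. grad h (\<lambda>i. u i - 0 * descent h u i) i * descent h u i)" if "u \<in> feasible" for h u
      using grad_descent(1)[OF that] by (auto intro!: sum_nonneg)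
    show "\<exists>t\<in>{0..1}. 1 / p - 1 / q \<le> energy h (\<gamma> t)"
      if h: "h0 \<le> h" and \<gamma>: "continuous_on {0..1} \<gamma>" "\<gamma> ` {0..1} \<subseteq> feasible" "\<gamma> 0 = (\<lambda>i. 0)" "\<gamma> 1 = e0"
      for h and \<gamma> :: "real \<Rightarrow> nat \<Rightarrow> real"
    proof -
      \<comment> \<open>The maximum norm runs continuously from 0 to more than 1, so every
        admissible path crosses the unit sphere.\<close>
      have "continuous_on {0..1} (\<lambda>t. Max ((\<lambda>i. \<gamma> t i) ` {n0..m}))"
        using nm continuous_on_product_then_coordinatewise[OF \<gamma>(1)] by (intro continuous_on_Max_image) auto
      moreover have "Max ((\<lambda>i. \<gamma> 0 i) ` {n0..m}) \<le> 1" using nm \<gamma>(3) by simp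
      moreover have "1 \<le> Max ((\<lambda>i. \<gamma> 1 i) ` {n0..m})"
        using e0 \<gamma>(4) by (auto simp: Max_ge_iff intro!: bexI[of _ k0])
      ultimately obtain t where t: "0 \<le> t" "t \<le> 1" "Max ((\<lambda>i. \<gamma> t i) ` {n0..m}) = 1"
        using IVT'[of "\<lambda>t. Max ((\<lambda>i. \<gamma> t i) ` {n0..m})" 0 1 1] by auto
      then have "\<gamma> t \<in> feasible" using \<gamma>(2) by (auto simp: image_subset_iff)
      then show ?thesis using unit_sphere_level[of "\<gamma> t" h] t pos[OF h] by auto
    qed
    show "energy h' x \<le> energy h x" if "h0 \<le> h" "h \<le> h'" for h h' x
      using energy_antitone pos that by blast
    show "(\<lambda>i. u i - \<sigma> * descent h u i) \<in> feasible" if "u \<in> feasible" "0 \<le> \<sigma>" "\<sigma> \<le> 1" for h \<sigma> u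
      using that by (rule descent_step_feasible)
    show "(\<lambda>i. 0) \<in> feasible" by (simp add: feasible_def)
  qed (use h0 e0 neg C in simp_all)
  have "grad h u i * descent h u i = 0" if "n0 \<le> i" "i \<le> m" for i
    using sum_nonneg_0[of "{n0..m}" "\<lambda>i. grad h u i * descent h u i" i] hu(6) grad_descent(1)[OF hu(3)] that
    by simp
  then have "0 \<le> grad h u i \<and> grad h u i * u i = 0" if "n0 \<le> i" "i \<le> m" for i
    using grad_descent(2)[OF hu(3)] that by blast
  then show ?thesis using that hu h0 by auto
qed

end

section \<open>Discrete solutions\<close>

text \<open>Comparison with an integral: by the mean value theorem each term is at most a difference
  of values of \<open>x powr (1 - b) / (b - 1)\<close>, and the differences telescope.\<close>

lemma sum_powr_tail:
  assumes b: "1 < b" and i: "1 \<le> i"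
  shows "(\<Sum>k=Suc i..n. real k powr (- b)) \<le> real i powr (1 - b) / (b - 1)"
proof -
  have step: "real (Suc k) powr (- b) \<le> (real k powr (1 - b) - real (Suc k) powr (1 - b)) / (b - 1)"
    if k: "1 \<le> k" for k
  proof -
    have "\<exists>z>real k. z < real (Suc k) \<and>
        real (Suc k) powr (1 - b) - real k powr (1 - b) = (real (Suc k) - real k) * ((1 - b) * z powr (1 - b - 1))"
      using k by (intro MVT2) (auto intro!: derivative_eq_intros)
    then obtain z where z: "real k < z" "z < real (Suc k)"
      "real (Suc k) powr (1 - b) - real k powr (1 - b) = (1 - b) * z powr (- b)" by auto
    have "real (Suc k) powr (- b) \<le> z powr (- b)"
      using z k b by (intro powr_mono2') auto
    moreover have "z powr (- b) = (real k powr (1 - b) - real (Suc k) powr (1 - b)) / (b - 1)"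
      using z(3) b by (simp add: field_simps)
    ultimately show ?thesis by simp
  qed
  have "(\<Sum>k=Suc i..n. real k powr (- b)) \<le> (real i powr (1 - b) - real n powr (1 - b)) / (b - 1)" if "i \<le> n"
    using that
  proof (induction n rule: dec_induct)
    case (step n)
    have "(\<Sum>k=Suc i..Suc n. real k powr (- b)) = (\<Sum>k=Suc i..n. real k powr (- b)) + real (Suc n) powr (- b)"
      using step by simp
    also have "\<dots> \<le> (real i powr (1 - b) - real n powr (1 - b)) / (b - 1)
        + (real n powr (1 - b) - real (Suc n) powr (1 - b)) / (b - 1)"
      using step i by (intro add_mono \<open>\<And>k. 1 \<le> k \<Longrightarrow> real (Suc k) powr (- b) \<le> (real k powr (1 - b) - real (Suc k) powr (1 - b)) / (b - 1)\<close>) auto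
    also have "\<dots> = (real i powr (1 - b) - real (Suc n) powr (1 - b)) / (b - 1)"
      by (simp add: diff_divide_distrib)
    finally show ?case .
  qed simp
  moreover have "(real i powr (1 - b) - real n powr (1 - b)) / (b - 1) \<le> real i powr (1 - b) / (b - 1)"
    using b by (intro divide_right_mono) auto
  ultimately show ?thesis
    using b by (cases "i \<le> n") (auto intro: order_trans)
qed

text \<open>For \<theta> \<ge> 1 the terms increase, and k times the last one is enough. For
  \<theta> < 1 they decrease and telescope against \<open>x powr \<theta> / \<theta>\<close>. The
  maximum in the constant covers both cases.\<close>

lemma sum_powr_head:
  assumes \<theta>: "0 < \<theta>"
  shows "(\<Sum>l=1..k. real l powr (\<theta> - 1)) \<le> max 1 (1 / \<theta>) * real k powr \<theta>"
proof (cases "1 \<le> \<theta>")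
  case True
  have "(\<Sum>l=1..k. real l powr (\<theta> - 1)) \<le> (\<Sum>l=1..k. real k powr (\<theta> - 1))"
    using True by (intro sum_mono powr_mono2) auto
  also have "\<dots> = real k powr \<theta>"
    using \<theta> by (cases "k = 0") (auto simp: powr_diff)
  also have "\<dots> \<le> max 1 (1 / \<theta>) * real k powr \<theta>"
    using mult_right_mono[of 1 "max 1 (1 / \<theta>)" "real k powr \<theta>"] by simp
  finally show ?thesis .
next
  case False
  have "real l powr (\<theta> - 1) \<le> (real l powr \<theta> - real (l - 1) powr \<theta>) / \<theta>" if l: "1 \<le> l" for l
  proof (cases "l = 1")
    case True
    then show ?thesis using \<theta> False by (simp add: field_simps)
  next
    case False
    then have l2: "2 \<le> l" using l by simp
    have "\<exists>z>real (l - 1). z < real l \<and>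
        real l powr \<theta> - real (l - 1) powr \<theta> = (real l - real (l - 1)) * (\<theta> * z powr (\<theta> - 1))"
      using l2 by (intro MVT2) (auto intro!: derivative_eq_intros)
    then obtain z where z: "real (l - 1) < z" "z < real l"
      "real l powr \<theta> - real (l - 1) powr \<theta> = \<theta> * z powr (\<theta> - 1)" using l2 by (auto simp: of_nat_diff)
    have "real l powr (\<theta> - 1) \<le> z powr (\<theta> - 1)"
      using z \<open>\<not> 1 \<le> \<theta>\<close> by (intro powr_mono2') auto
    then show ?thesis using z(3) \<theta> by (simp add: field_simps)
  qed
  then have "(\<Sum>l=1..k. real l powr (\<theta> - 1)) \<le> (\<Sum>l=1..k. (real l powr \<theta> - real (l - 1) powr \<theta>) / \<theta>)"
    by (intro sum_mono) auto
  also have "\<dots> = real k powr \<theta> / \<theta>"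
    using \<theta> by (induction k) (auto simp: diff_divide_distrib)
  also have "\<dots> \<le> max 1 (1 / \<theta>) * real k powr \<theta>"
    using mult_right_mono[of "1 / \<theta>" "max 1 (1 / \<theta>)" "real k powr \<theta>"] by simp
  finally show ?thesis .
qed

text \<open>Young's inequality with crude constants: either x is at most the second term, or
  \<open>c * x powr (p - 1)\<close> is at least 1 and x is at most the first.\<close>

lemma le_weighted_powr:
  fixes x c p :: real
  assumes "0 \<le> x" "0 < c" "1 < p"
  shows "x \<le> c * x powr p + c powr (- 1 / (p - 1))"
proof (cases "x \<le> c powr (- 1 / (p - 1))")
  case False
  then have x: "0 < x" using powr_ge_zero[of c "- 1 / (p - 1)"] by linarith
  have "c powr (-1) = (c powr (- 1 / (p - 1))) powr (p - 1)" using assms by (simp add: powr_powr)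
  also have "\<dots> \<le> x powr (p - 1)" using False assms by (intro powr_mono2) auto
  finally have "1 \<le> c * x powr (p - 1)" using assms by (simp add: powr_minus field_simps)
  then have "1 * x \<le> c * x powr (p - 1) * x" using x by (intro mult_right_mono) auto
  also have "\<dots> = c * x powr p" using x by (simp add: powr_diff)
  finally show ?thesis using powr_ge_zero[of c "- 1 / (p - 1)"] by linarith
qed (use assms in \<open>auto intro: add_increasing\<close>)

context quasilinear
begin

text \<open>What the estimates use of a mountain pass solution, with \<open>CA\<close> and
  \<open>CE\<close> independent of the mesh. The mesh is an argument because it varies. The factor
  \<open>h ^ N\<close> turns the weights into the radial volume element.\<close>

definition discrete_solution :: "real \<Rightarrow> real \<Rightarrow> nat \<Rightarrow> nat \<Rightarrow> real \<Rightarrow> (nat \<Rightarrow> real) \<Rightarrow> bool" where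
  "discrete_solution CA CE n0 m h u \<longleftrightarrow> 1 \<le> n0 \<and> n0 \<le> m \<and> 0 < h \<and> h \<le> 1 \<and> u \<in> mesh.feasible n0 m \<and>
     (\<forall>i. n0 \<le> i \<longrightarrow> i \<le> m \<longrightarrow> 0 \<le> mesh.grad N p q js jt n0 h u i \<and> mesh.grad N p q js jt n0 h u i * u i = 0) \<and>
     h ^ N * (\<Sum>i=n0..Suc m. real i ^ (N - 1) * \<bar>mesh.slope n0 h u i\<bar> powr p) \<le> CA \<and>
     h ^ N * (\<Sum>i=n0..m. real i ^ (N - 1) * F (u i)) \<le> CE \<and> (\<exists>i. 0 < u i)"

lemma mesh_axiomsI: "1 \<le> n0 \<Longrightarrow> n0 \<le> m \<Longrightarrow> mesh N p q \<alpha>\<^sub>0 R j js jt \<alpha> \<beta> n0 m"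
  by (intro mesh.intro mesh_axioms.intro quasilinear_axioms)

text \<open>The tent T (1 - r) is sampled with width \<open>h0\<close>, while slopes are taken with
  h \<ge> \<open>h0\<close>; this keeps them at most T for every h in the parameter interval, so one
  endpoint serves all of them.\<close>

lemma tent_energy:
  fixes n0 m :: nat and h0 h t T :: real
  defines "e \<equiv> \<lambda>i. if n0 \<le> i \<and> i \<le> m then t * (T * max 0 (1 - real i * h0)) else 0"
    and "B \<equiv> \<alpha> T * T powr p + T powr p"
  assumes mesh: "1 \<le> n0" "n0 \<le> m" and h0: "0 < h0" "h0 \<le> 1/8" "real n0 * h0 \<le> 1/4" "1 \<le> real m * h0"
    and T: "1 \<le> T" and t: "0 \<le> t" "t \<le> 1" and h: "h0 \<le> h"
  shows "mesh.energy N p q j n0 m h e \<le> (2 / h0) ^ N * B"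
    and "t = 1 \<Longrightarrow> mesh.energy N p q j n0 m h e \<le> (2 / h0) ^ N * B - (1 / (8 * h0)) ^ N * ((T / 2) powr q / q)"
proof -
  interpret mesh N p q \<alpha>\<^sub>0 R j js jt \<alpha> \<beta> n0 m using mesh by (rule mesh_axiomsI)
  have e: "e i = t * (T * max 0 (1 - real i * h0))" if "n0 \<le> i" for i
  proof (cases "i \<le> m")
    case False
    then have "real m * h0 \<le> real i * h0" using h0 by (intro mult_right_mono) auto
    then have "max 0 (1 - real i * h0) = 0" using h0 by (intro max_absorb1) linarith
    then show ?thesis using False by (simp add: e_def)
  qed (use that in \<open>simp add: e_def\<close>)
  have e0: "0 \<le> e i" "e i \<le> T" if "n0 \<le> i" for i
  proof -
    show "0 \<le> e i" using e[OF that] t T by simp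
    have "T * max 0 (1 - real i * h0) \<le> T * 1" using T h0 by (intro mult_left_mono) auto
    moreover have "t * (T * max 0 (1 - real i * h0)) \<le> 1 * (T * max 0 (1 - real i * h0))"
      using t T by (intro mult_right_mono) auto
    ultimately show "e i \<le> T" using e[OF that] by simp
  qed
  have slope: "\<bar>slope h e i\<bar> \<le> T" for i
  proof (cases "i \<le> n0")
    case False
    then have i: "n0 \<le> i - 1" "n0 \<le> i" "real i = real (i - 1) + 1" by auto
    have "\<bar>max 0 (1 - real i * h0) - max 0 (1 - real (i - 1) * h0)\<bar> \<le> h0"
    proof -
      define y where "y = real (i - 1) * h0"
      have "real i * h0 = y + h0" unfolding i(3) y_def by (simp add: distrib_right)
      then show ?thesis unfolding y_def[symmetric] using h0 by (auto simp: max_def)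
    qed
    moreover have "t * (T * X) \<le> T * h0" if "X \<le> h0" "0 \<le> X" for X
    proof -
      have "t * (T * X) \<le> 1 * (T * X)" using t T that by (intro mult_right_mono) auto
      also have "\<dots> \<le> T * h0" using that T by simp
      finally show ?thesis .
    qed
    ultimately have "t * (T * \<bar>max 0 (1 - real i * h0) - max 0 (1 - real (i - 1) * h0)\<bar>) \<le> T * h0"
      using abs_ge_zero by blast
    then have "\<bar>e i - e (i - 1)\<bar> \<le> T * h0"
      unfolding e[OF i(1)] e[OF i(2)] right_diff_distrib[symmetric] abs_mult using t T by simp
    also have "\<dots> \<le> T * h" using h T by simp
    finally show ?thesis using False h h0 by (simp add: slope_def abs_divide pos_divide_le_eq)
  qed (use T in \<open>simp add: slope_def\<close>)
  have far: "e i = 0 \<and> slope h e i = 0" if i: "n0 \<le> i" "2 \<le> real i * h0" for i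
  proof -
    have "i \<noteq> n0" using i h0 by auto
    then obtain k where k: "i = Suc k" "n0 \<le> k" using i by (metis Suc_leI le_Suc_ex le_neq_implies_less add_Suc_right less_natE le_add1)
    have "real i * h0 = real k * h0 + h0" unfolding k by (simp add: distrib_right)
    then have "1 \<le> real k * h0" "1 \<le> real i * h0" using i(2) h0 by linarith+
    then have z: "max 0 (1 - real k * h0) = 0" "max 0 (1 - real i * h0) = 0"
      by (auto intro!: max_absorb1)
    have "e i = 0" "e k = 0" unfolding e[OF i(1)] e[OF k(2)] z by simp_all
    then show ?thesis by (simp add: slope_def k(1))
  qed
  have B: "J (e i) (slope h e i) + \<bar>e i\<bar> powr p / p \<le> B" if "n0 \<le> i" for i
  proof -
    have "J (e i) (slope h e i) \<le> \<alpha> \<bar>e i\<bar> * \<bar>slope h e i\<bar> powr p" by (rule J_upper)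
    also have "\<dots> \<le> \<alpha> T * T powr p"
      using slope[of i] e0[OF that] p1 \<alpha>_pos[of T]
      by (intro mult_mono powr_mono2 monoD[OF \<alpha>_mono]) (auto simp: less_imp_le)
    finally have "J (e i) (slope h e i) \<le> \<alpha> T * T powr p" .
    moreover have "\<bar>e i\<bar> powr p / p \<le> T powr p / 1"
      using e0[OF that] p1 by (intro frac_le powr_mono2) auto
    ultimately show ?thesis by (simp add: B_def)
  qed
  have B0: "0 \<le> B" using \<alpha>_pos[of T] by (simp add: B_def)
  \<comment> \<open>Radius 2 instead of 1 leaves room for the cell in which the tent comes down to
    0: from there on both the value and the slope vanish.\<close>
  define I where "I = {n0..Suc m} \<inter> {i. real i * h0 < 2}"
  have Icard: "real (card I) \<le> 2 / h0"
  proof -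
    have "I \<subseteq> {1..nat \<lfloor>2 / h0\<rfloor>}"
      using mesh h0 by (auto simp: I_def le_nat_iff le_floor_iff field_simps)
    then have "card I \<le> card {1..nat \<lfloor>2 / h0\<rfloor>}" by (intro card_mono) auto
    then have "real (card I) \<le> real (nat \<lfloor>2 / h0\<rfloor>)" by simp
    also have "\<dots> \<le> 2 / h0" using h0 by (simp add: of_nat_nat)
    finally show ?thesis .
  qed
  have pos: "(\<Sum>i=n0..Suc m. real i ^ (N - 1) * (J (e i) (slope h e i) + \<bar>e i\<bar> powr p / p)) \<le> (2 / h0) ^ N * B"
  proof -
    have "(\<Sum>i=n0..Suc m. real i ^ (N - 1) * (J (e i) (slope h e i) + \<bar>e i\<bar> powr p / p))
      = (\<Sum>i\<in>I. real i ^ (N - 1) * (J (e i) (slope h e i) + \<bar>e i\<bar> powr p / p))"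
      using far by (intro sum.mono_neutral_right) (auto simp: I_def not_less)
    also have "\<dots> \<le> (\<Sum>i\<in>I. (2 / h0) ^ (N - 1) * B)"
      using h0 B J_nonneg p1 B0
      by (intro sum_mono mult_mono power_mono) (auto simp: I_def field_simps intro!: add_nonneg_nonneg divide_nonneg_nonneg)
    also have "\<dots> = real (card I) * ((2 / h0) ^ (N - 1) * B)" by simp
    also have "\<dots> \<le> 2 / h0 * ((2 / h0) ^ (N - 1) * B)"
      using Icard h0 B0 by (intro mult_right_mono) auto
    also have "\<dots> = (2 / h0) ^ N * B" using N2 by (simp add: power_eq_if)
    finally show ?thesis .
  qed
  have split: "energy h e = (\<Sum>i=n0..Suc m. real i ^ (N - 1) * (J (e i) (slope h e i) + \<bar>e i\<bar> powr p / p))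
       - (\<Sum>i=n0..Suc m. real i ^ (N - 1) * (\<bar>e i\<bar> powr q / q))"
    unfolding energy_def F_def sum_subtractf[symmetric]
    by (intro sum.cong refl) (simp only: right_diff_distrib[symmetric] add_diff_eq)
  have "0 \<le> (\<Sum>i=n0..Suc m. real i ^ (N - 1) * (\<bar>e i\<bar> powr q / q))"
    using p1 pq by (intro sum_nonneg) auto
  then show "energy h e \<le> (2 / h0) ^ N * B" using split pos by linarith
  assume t1: "t = 1"
  \<comment> \<open>Nodes with radius between 1/4 and 1/2: there the tent is at least T/2, and since
    \<open>h0 \<le> 1/8\<close> there are at least 1 / (8 \<open>h0\<close>) of them.\<close>
  define K where "K = {nat \<lceil>1 / (4 * h0)\<rceil>..nat \<lfloor>1 / (2 * h0)\<rfloor>}"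
  have K: "1 / (4 * h0) \<le> real i" "real i \<le> 1 / (2 * h0)" "n0 \<le> i" "i \<le> m" if "i \<in> K" for i
  proof -
    show 1: "1 / (4 * h0) \<le> real i" using that unfolding K_def by (auto simp: nat_le_iff ceiling_le_iff)
    show 2: "real i \<le> 1 / (2 * h0)" using that h0 unfolding K_def by (auto simp: le_nat_iff le_floor_iff)
    have "real n0 \<le> 1 / (4 * h0)" using h0 by (simp add: field_simps)
    then show "n0 \<le> i" using 1 by linarith
    have "1 / (2 * h0) \<le> real m" using h0 by (simp add: field_simps)
    then show "i \<le> m" using 2 by linarith
  qed
  have Kcard: "1 / (8 * h0) \<le> real (card K)"
  proof -
    define c f where "c = nat \<lceil>1 / (4 * h0)\<rceil>" and "f = nat \<lfloor>1 / (2 * h0)\<rfloor>"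
    have "1 / (8 * h0) = 1 / (2 * h0) - 1 / (4 * h0) - 1 / (8 * h0)" using h0 by (simp add: field_simps)
    moreover have "1 \<le> 1 / (8 * h0)" using h0 by (simp add: field_simps)
    moreover have "0 \<le> 1 / (4 * h0)" "0 \<le> 1 / (2 * h0)" using h0 by auto
    then have "real c < 1 / (4 * h0) + 1" "1 / (2 * h0) < real f + 1"
      unfolding c_def f_def by linarith+
    moreover have "real (Suc f) - real c \<le> real (card K)"
      by (cases "c \<le> Suc f") (auto simp: K_def c_def[symmetric] f_def[symmetric] of_nat_diff)
    ultimately show ?thesis by simp
  qed
  have "(1 / (8 * h0)) ^ N * ((T / 2) powr q / q) = 1 / (8 * h0) * ((1 / (8 * h0)) ^ (N - 1) * ((T / 2) powr q / q))"
    using N2 by (simp add: power_eq_if)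
  also have "\<dots> \<le> real (card K) * ((1 / (4 * h0)) ^ (N - 1) * ((T / 2) powr q / q))"
    using Kcard h0 p1 pq by (intro mult_mono power_mono divide_left_mono) auto
  also have "\<dots> = (\<Sum>i\<in>K. (1 / (4 * h0)) ^ (N - 1) * ((T / 2) powr q / q))" by simp
  also have "\<dots> \<le> (\<Sum>i\<in>K. real i ^ (N - 1) * (\<bar>e i\<bar> powr q / q))"
  proof (intro sum_mono mult_mono power_mono)
    fix i assume i: "i \<in> K"
    have "1 / 2 \<le> max 0 (1 - real i * h0)" using K(2)[OF i] h0 by (simp add: field_simps)
    then have "T * (1 / 2) \<le> T * max 0 (1 - real i * h0)" by (rule mult_left_mono) (use T in simp)
    then have "T / 2 \<le> \<bar>e i\<bar>" using e[OF K(3)[OF i]] t1 by simp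
    then show "(T / 2) powr q / q \<le> \<bar>e i\<bar> powr q / q"
      using T p1 pq by (intro divide_right_mono powr_mono2) auto
  qed (use K h0 p1 pq in auto)
  also have "\<dots> \<le> (\<Sum>i=n0..Suc m. real i ^ (N - 1) * (\<bar>e i\<bar> powr q / q))"
    using K p1 pq by (intro sum_mono2) (auto simp: le_SucI)
  finally show "energy h e \<le> (2 / h0) ^ N * B - (1 / (8 * h0)) ^ N * ((T / 2) powr q / q)"
    using split pos by linarith
qed

text \<open>The level is at most of order \<open>h0\<close> to the power -N, and the rate in h one
  power worse. The rate contains one further factor 1 / h, so \<open>h ^ (N + 1)\<close> times it
  bounds the gradient sum; h \<le> 2 \<open>h0\<close> cancels all powers of
  \<open>h0\<close>.\<close>

lemma discrete_solution_exists:
  obtains CA CE where "\<And>n0 m h0. 1 \<le> n0 \<Longrightarrow> n0 \<le> m \<Longrightarrow> 0 < h0 \<Longrightarrow> h0 \<le> 1/8 \<Longrightarrow> real n0 * h0 \<le> 1/4 \<Longrightarrow>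
    1 \<le> real m * h0 \<Longrightarrow> \<exists>h u. h0 < h \<and> h \<le> 2 * h0 \<and> discrete_solution CA CE n0 m h u"
proof -
  \<comment> \<open>The ratio of the constants in the two tent bounds: 2/h0 against 1/(8 h0) to the
    power N, and T against T/2 under the power q, divided by q.\<close>
  define C where "C = 2 ^ N * 8 ^ N * 2 powr q * q"
  obtain B0 where B0: "1 \<le> B0" "\<And>\<mu>. B0 \<le> \<mu> \<Longrightarrow> C * (\<alpha> \<mu> + 1) < \<mu> powr (q - p)"
    using growth[of C] by blast
  define T where "T = max 2 B0"
  have T: "2 \<le> T" "1 \<le> T" "C * (\<alpha> T + 1) < T powr (q - p)" using B0(2)[of T] by (auto simp: T_def)
  define B where "B = \<alpha> T * T powr p + T powr p"
  have Bpos: "0 \<le> B" using \<alpha>_pos[of T] by (simp add: B_def)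
  \<comment> \<open>From (2 h0) to the power N + 1 times the rate bound, divided by
    \<open>\<alpha>\<^sub>0\<close>, with \<open>h0 \<le> 1\<close> in the additive term. Likewise
    \<open>CE\<close> is (2 h0) times (2 / h0), to the power N, times B.\<close>
  define CA where "CA = 2 ^ (N + 1) * (2 ^ N * B + 2) / \<alpha>\<^sub>0"
  define CE where "CE = 4 ^ N * B"
  show ?thesis
  proof (rule that[of CA CE])
    fix n0 m h0
    assume A: "1 \<le> n0" "n0 \<le> m" "0 < h0" "h0 \<le> 1/8" "real n0 * h0 \<le> 1/4" "1 \<le> real m * h0"
    interpret mesh N p q \<alpha>\<^sub>0 R j js jt \<alpha> \<beta> n0 m using A by (intro mesh_axiomsI) auto
    define e where "e = (\<lambda>i. if n0 \<le> i \<and> i \<le> m then 1 * (T * max 0 (1 - real i * h0)) else 0)"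
    have te: "(\<lambda>i. t * e i) = (\<lambda>i. if n0 \<le> i \<and> i \<le> m then t * (T * max 0 (1 - real i * h0)) else 0)" for t
      by (auto simp: e_def)
    have neg: "energy h e \<le> 0" if "h0 \<le> h" for h
    proof -
      have "energy h e \<le> (2 / h0) ^ N * B - (1 / (8 * h0)) ^ N * ((T / 2) powr q / q)"
        unfolding e_def B_def using A T that by (intro tent_energy(2)) auto
      also have "\<dots> = (1 / (8 * h0)) ^ N * ((T / 2) powr q / q) * (C * B / T powr q - 1)"
        using A(3) T p1 pq by (simp add: C_def power_divide power_mult_distrib powr_divide field_simps)
      also have "\<dots> \<le> 0"
      proof (rule mult_nonneg_nonpos)
        have "C * B = C * (\<alpha> T + 1) * T powr p" by (simp add: B_def algebra_simps)
        also have "\<dots> \<le> T powr (q - p) * T powr p" using T by (intro mult_right_mono) auto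
        also have "\<dots> = T powr q" using T by (simp flip: powr_add)
        finally show "C * B / T powr q - 1 \<le> 0" using T by simp
      qed (use A p1 pq in auto)
      finally show ?thesis .
    qed
    have up: "energy h0 (\<lambda>i. t * e i) \<le> (2 / h0) ^ N * B" if "0 \<le> t" "t \<le> 1" for t
      unfolding te B_def using A T that by (intro tent_energy(1)) auto
    have "T * (3/4) \<le> T * max 0 (1 - real n0 * h0)" using T A by (intro mult_left_mono) auto
    moreover have "e n0 = T * max 0 (1 - real n0 * h0)" using A by (simp add: e_def)
    ultimately have "1 < e n0" using T by linarith
    moreover have "e \<in> feasible" using T by (auto simp: e_def feasible_def)
    ultimately obtain h u where hu: "h0 < h" "h \<le> 2 * h0" "u \<in> feasible" "1 / p - 1 / q \<le> energy h u"
      "energy h u \<le> (2 / h0) ^ N * B"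
      "\<And>i. n0 \<le> i \<Longrightarrow> i \<le> m \<Longrightarrow> 0 \<le> grad h u i \<and> grad h u i * u i = 0"
      "mesh_rate h u \<le> (2 / h0) ^ N * B / h0 + 2"
      using discrete_mountain_pass[of h0 e n0 "(2 / h0) ^ N * B"] A neg up by auto
    have h: "0 < h" "h \<le> 1" using hu A by auto
    have "\<alpha>\<^sub>0 * (\<Sum>i=n0..Suc m. real i ^ (N - 1) * \<bar>slope h u i\<bar> powr p)
        \<le> (\<Sum>i=n0..Suc m. flux h u i * slope h u i)"
      unfolding sum_distrib_left
    proof (rule sum_mono)
      fix i
      show "\<alpha>\<^sub>0 * (real i ^ (N - 1) * \<bar>slope h u i\<bar> powr p) \<le> flux h u i * slope h u i"
        using mult_left_mono[OF Jt_lower_times[of "slope h u i" "u i"], of "real i ^ (N - 1)"]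
        by (simp add: flux_def mult_ac)
    qed
    also have "\<dots> = h * mesh_rate h u" using h by (simp add: mesh_rate_def)
    also have "\<dots> \<le> h * ((2 / h0) ^ N * B / h0 + 2)" using hu h by (intro mult_left_mono) auto
    finally have "h ^ N * (\<alpha>\<^sub>0 * (\<Sum>i=n0..Suc m. real i ^ (N - 1) * \<bar>slope h u i\<bar> powr p))
        \<le> h ^ N * (h * ((2 / h0) ^ N * B / h0 + 2))" using h by (intro mult_left_mono) auto
    also have "\<dots> = h ^ (N + 1) * ((2 / h0) ^ N * B / h0 + 2)" by simp
    also have "\<dots> \<le> (2 * h0) ^ (N + 1) * ((2 / h0) ^ N * B / h0 + 2)"
      using hu h A Bpos by (intro mult_right_mono power_mono) auto
    also have "\<dots> = 2 ^ (N + 1) * (2 ^ N * B) + 2 ^ (N + 1) * (2 * h0 ^ (N + 1))"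
      using A by (simp add: power_mult_distrib power_divide field_simps)
    also have "\<dots> \<le> 2 ^ (N + 1) * (2 ^ N * B) + 2 ^ (N + 1) * (2 * 1)"
      using A by (intro add_left_mono mult_left_mono power_le_one) auto
    also have "\<dots> = 2 ^ (N + 1) * (2 ^ N * B + 2)" by (simp add: distrib_left)
    also have "\<dots> = \<alpha>\<^sub>0 * CA" using \<alpha>0 by (simp add: CA_def)
    finally have CA: "h ^ N * (\<Sum>i=n0..Suc m. real i ^ (N - 1) * \<bar>slope h u i\<bar> powr p) \<le> CA"
      using \<alpha>0 by (simp add: mult.left_commute)
    have "(\<Sum>i=n0..m. real i ^ (N - 1) * F (u i)) = (\<Sum>i=n0..Suc m. real i ^ (N - 1) * F (u i))"
      using A hu(3) by (simp add: feasible_def)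
    also have "\<dots> \<le> energy h u" unfolding energy_def
      using J_nonneg by (intro sum_mono mult_left_mono) auto
    also have "\<dots> \<le> (2 / h0) ^ N * B" by fact
    finally have "h ^ N * (\<Sum>i=n0..m. real i ^ (N - 1) * F (u i)) \<le> h ^ N * ((2 / h0) ^ N * B)"
      using h by (intro mult_left_mono) auto
    also have "\<dots> \<le> (2 * h0) ^ N * ((2 / h0) ^ N * B)"
    proof (rule mult_right_mono)
      show "h ^ N \<le> (2 * h0) ^ N" using hu(2) h by (intro power_mono) auto
      show "0 \<le> (2 / h0) ^ N * B" using Bpos A(3) by simp
    qed
    also have "(2 * h0) ^ N * ((2 / h0) ^ N * B) = ((2 * h0) * (2 / h0)) ^ N * B"
      by (simp only: power_mult_distrib mult.assoc)
    also have "(2 * h0) * (2 / h0) = 4" using A(3) by simp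
    also have "4 ^ N * B = CE" by (simp only: CE_def)
    finally have CE: "h ^ N * (\<Sum>i=n0..m. real i ^ (N - 1) * F (u i)) \<le> CE" .
    have "\<exists>i. 0 < u i"
    proof (rule ccontr)
      assume "\<nexists>i. 0 < u i"
      then have "u = (\<lambda>i. 0)" using hu(3) by (auto simp: feasible_def fun_eq_iff order.antisym not_less)
      moreover have "slope h (\<lambda>i. 0) i = 0" for i by (auto simp: slope_def)
      ultimately have "energy h u = 0" by (simp add: energy_def)
      moreover have "0 < 1 / p - 1 / q" using p1 pq by (simp add: field_simps)
      ultimately show False using hu(4) by simp
    qed
    then show "\<exists>h u. h0 < h \<and> h \<le> 2 * h0 \<and> discrete_solution CA CE n0 m h u"
      using hu h A CA CE unfolding discrete_solution_def by blast
  qed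
qed

end

section \<open>A priori estimates\<close>

context quasilinear
begin

text \<open>The exponent of the radial lemma: a radial function with p-integrable gradient that
  vanishes at infinity is at most a constant times r to this negative power.\<close>

definition decay_exp :: real where "decay_exp = (real N - p) / p"

lemma decay_exp_pos: "0 < decay_exp"
  using p1 pN by (simp add: decay_exp_def)

text \<open>Subcriticality of q in the form needed for the sup bound: with the decay of u, the
  coefficient \<open>u powr (q - p)\<close> is less singular at the origin than r to the power
  -p.\<close>

lemma subcritical: "decay_exp * (q - p) < p"
proof -
  have "q * (real N - p) < real N * p" using qcrit pN by (simp add: pos_less_divide_eq)
  then have "(real N - p) * (q - p) < p * p" by (simp add: algebra_simps)
  then show ?thesis using p1 by (simp add: decay_exp_def pos_divide_less_eq)
qed

lemma sum_increments:
  fixes u :: "nat \<Rightarrow> real"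
  assumes "i \<le> n"
  shows "(\<Sum>k=Suc i..n. u (k - 1) - u k) = u i - u n"
  using assms by (induction n rule: dec_induct) auto

text \<open>u is the sum of its decrements out to node \<open>Suc m\<close>, where it is 0. Each is
  split by the weighted Young inequality into a piece of the gradient sum and a pure power of the
  radius, summable because b > 1, that is p < N.\<close>

lemma discrete_decay:
  obtains C where "1 \<le> C" "\<And>n0 m h u i. discrete_solution CA CE n0 m h u \<Longrightarrow> n0 \<le> i \<Longrightarrow>
    u i \<le> C * (real i * h) powr (- decay_exp)"
proof -
  define b where "b = (real N - 1) / (p - 1)"
  have b: "1 < b" using p1 pN by (simp add: b_def)
  define C where "C = \<bar>CA\<bar> + 1 / (b - 1) + 1"
  have "u i \<le> C * (real i * h) powr (- decay_exp)"
    if sol: "discrete_solution CA CE n0 m h u" and i: "n0 \<le> i" for n0 m h u i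
  proof (cases "i \<le> m")
    case False
    then have "u i = 0" using sol i
      by (auto simp: discrete_solution_def mesh.feasible_def[OF mesh_axiomsI])
    then show ?thesis using b by (simp add: C_def)
  next
    case True
    interpret mesh N p q \<alpha>\<^sub>0 R j js jt \<alpha> \<beta> n0 m
      using sol by (intro mesh_axiomsI) (auto simp: discrete_solution_def)
    have h: "0 < h" and u: "u \<in> feasible" and
      CA: "h ^ N * (\<Sum>i=n0..Suc m. real i ^ (N - 1) * \<bar>slope h u i\<bar> powr p) \<le> CA"
      using sol by (auto simp: discrete_solution_def)
    have i0: "1 \<le> i" using i n0 by simp
    define r where "r = (\<lambda>k. real k * h)"
    have rpos: "0 < r k" if "1 \<le> k" for k using that h by (simp add: r_def)
    \<comment> \<open>The Young weight balances the two pieces: the gradient part is \<theta> times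
      \<open>CA\<close>, and the tail of the power sum gets the same order in the radius.\<close>
    define \<theta> where "\<theta> = r i powr (- decay_exp)"
    have \<theta>: "0 < \<theta>" using rpos[OF i0] by (simp add: \<theta>_def)
    have "u i = (\<Sum>k=Suc i..Suc m. u (k - 1) - u k)"
      using sum_increments[of i "Suc m" u] True u by (simp add: feasible_def)
    also have "\<dots> \<le> (\<Sum>k=Suc i..Suc m. \<theta> * (h ^ N * (real k ^ (N - 1) * \<bar>slope h u k\<bar> powr p))
        + \<theta> powr (- 1 / (p - 1)) * h powr (1 - b) * real k powr (- b))"
    proof (rule sum_mono)
      fix k assume k: "k \<in> {Suc i..Suc m}"
      then have k1: "1 \<le> k" "\<not> k \<le> n0" using i by auto
      have "u (k - 1) - u k \<le> h * \<bar>slope h u k\<bar>" using k1 h by (simp add: slope_def abs_divide)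
      also have "\<dots> \<le> h * ((\<theta> * r k ^ (N - 1)) * \<bar>slope h u k\<bar> powr p + (\<theta> * r k ^ (N - 1)) powr (- 1 / (p - 1)))"
        using h \<theta> rpos[OF k1(1)] p1 by (intro mult_left_mono le_weighted_powr) auto
      also have "\<dots> = \<theta> * (h * h ^ (N - 1) * (real k ^ (N - 1) * \<bar>slope h u k\<bar> powr p))
          + h * (\<theta> * r k ^ (N - 1)) powr (- 1 / (p - 1))"
        by (simp add: r_def power_mult_distrib algebra_simps)
      also have "h * h ^ (N - 1) = h ^ N" using N2 by (simp add: power_eq_if)
      also have "(\<theta> * r k ^ (N - 1)) powr (- 1 / (p - 1)) = \<theta> powr (- 1 / (p - 1)) * r k powr (- b)"
      proof -
        have "r k ^ (N - 1) = r k powr (real N - 1)"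
          using rpos[OF k1(1)] N2 by (simp add: powr_realpow[symmetric] of_nat_diff)
        then show ?thesis using \<theta> rpos[OF k1(1)] by (simp add: powr_mult powr_powr b_def)
      qed
      also have "h * (\<theta> powr (- 1 / (p - 1)) * r k powr (- b))
          = \<theta> powr (- 1 / (p - 1)) * h powr (1 - b) * real k powr (- b)"
        using h by (simp add: r_def powr_mult powr_diff powr_minus field_simps)
      finally show "u (k - 1) - u k \<le> \<theta> * (h ^ N * (real k ^ (N - 1) * \<bar>slope h u k\<bar> powr p))
        + \<theta> powr (- 1 / (p - 1)) * h powr (1 - b) * real k powr (- b)" .
    qed
    also have "\<dots> = \<theta> * (h ^ N * (\<Sum>k=Suc i..Suc m. real k ^ (N - 1) * \<bar>slope h u k\<bar> powr p))
        + \<theta> powr (- 1 / (p - 1)) * h powr (1 - b) * (\<Sum>k=Suc i..Suc m. real k powr (- b))"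
      by (simp only: sum.distrib sum_distrib_left)
    also have "\<dots> \<le> \<theta> * \<bar>CA\<bar> + \<theta> powr (- 1 / (p - 1)) * h powr (1 - b) * (real i powr (1 - b) / (b - 1))"
    proof (intro add_mono mult_left_mono sum_powr_tail b i0)
      have "h ^ N * (\<Sum>k=Suc i..Suc m. real k ^ (N - 1) * \<bar>slope h u k\<bar> powr p)
          \<le> h ^ N * (\<Sum>k=n0..Suc m. real k ^ (N - 1) * \<bar>slope h u k\<bar> powr p)"
        using h i by (intro mult_left_mono sum_mono2) auto
      then show "h ^ N * (\<Sum>k=Suc i..Suc m. real k ^ (N - 1) * \<bar>slope h u k\<bar> powr p) \<le> \<bar>CA\<bar>"
        using CA by linarith
    qed (use \<theta> in auto)
    also have "\<theta> powr (- 1 / (p - 1)) * h powr (1 - b) * (real i powr (1 - b) / (b - 1))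
        = r i powr (decay_exp / (p - 1) + (1 - b)) / (b - 1)"
      using h i0 by (simp add: \<theta>_def r_def powr_powr powr_mult powr_add)
    also have "decay_exp / (p - 1) + (1 - b) = - decay_exp"
    proof -
      have "1 - b = - (p * decay_exp / (p - 1))"
        using p1 by (simp add: decay_exp_def b_def divide_simps)
      then show ?thesis using p1 by (simp add: field_simps)
    qed
    finally have "u i \<le> \<theta> * (\<bar>CA\<bar> + 1 / (b - 1))" by (simp add: \<theta>_def distrib_left)
    also have "\<dots> \<le> \<theta> * C" using \<theta> by (simp add: C_def)
    finally show ?thesis by (simp add: \<theta>_def r_def mult.commute)
  qed
  moreover have "1 \<le> C" using b by (simp add: C_def)
  ultimately show ?thesis using that by blast
qed

text \<open>Where u > R the term with j_s is nonnegative, so to the right of a maximum the flux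
  falls at most by the accumulated \<open>u powr (q - 1)\<close>. Decay bounds most of this power by
  the radius and leaves the maximum \<mu> with a power slightly below p - 1. Inverting the flux and
  summing the slopes down to the first value below \<open>R1\<close> gives an inequality sublinear
  in \<mu>.\<close>

lemma discrete_bound:
  obtains M where "1 \<le> M" "\<And>n0 m h u i. discrete_solution CA CE n0 m h u \<Longrightarrow> u i \<le> M"
proof -
  obtain C where C: "1 \<le> C" and decay: "\<And>n0 m h u i. discrete_solution CA CE n0 m h u \<Longrightarrow> n0 \<le> i \<Longrightarrow>
    u i \<le> C * (real i * h) powr (- decay_exp)" using discrete_decay by blast
  define a where "a = decay_exp"
  have a: "0 < a" using decay_exp_pos by (simp add: a_def)
  \<comment> \<open>\<eta> is the share of the power taken away from \<mu>. It must keep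
    \<open>p - 1 - \<eta>\<close> positive and, by \<open>subcritical\<close>, the total decay b
    below p.\<close>
  define \<eta> where "\<eta> = min ((p - 1) / 2) ((p - a * (q - p)) / (2 * a))"
  have \<eta>: "0 < \<eta>" "\<eta> < p - 1" "a * (q - p + \<eta>) < p"
  proof -
    have pos: "0 < p - a * (q - p)" using subcritical by (simp add: a_def)
    then show "0 < \<eta>" using p1 a by (simp add: \<eta>_def)
    show "\<eta> < p - 1" using p1 by (simp add: \<eta>_def min_less_iff_disj)
    have "a * \<eta> \<le> a * ((p - a * (q - p)) / (2 * a))" using a by (intro mult_left_mono) (auto simp: \<eta>_def)
    also have "\<dots> = (p - a * (q - p)) / 2" using a by simp
    finally show "a * (q - p + \<eta>) < p" using pos by (simp add: distrib_left)
  qed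
  define b where "b = a * (q - p + \<eta>)"
  have b: "0 < b" "b < p" using \<eta> a pq by (auto simp: b_def)
  \<comment> \<open>Exponents after the two summations: of \<open>r powr (N - 1 - b)\<close> for the
    flux, then of \<open>r powr ((1 - b) / (p - 1))\<close> for the slope. Both are positive since b
    < p < N.\<close>
  define \<theta>1 where "\<theta>1 = real N - b"
  define \<theta>2 where "\<theta>2 = (p - b) / (p - 1)"
  have \<theta>: "0 < \<theta>1" "0 < \<theta>2" using b p1 pN by (auto simp: \<theta>1_def \<theta>2_def)
  define \<eta>' where "\<eta>' = \<eta> / (p - 1)"
  have \<eta>': "0 < \<eta>'" "\<eta>' < 1" using \<eta> p1 by (auto simp: \<eta>'_def)
  define K1 where "K1 = C powr (q - p + \<eta>) * max 1 (1 / \<theta>1)"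
  define K2 where "K2 = (K1 / \<alpha>\<^sub>0) powr (1 / (p - 1))"
  define K3 where "K3 = K2 * (max 1 (1 / \<theta>2) * 2 powr \<theta>2)"
  define R1 where "R1 = max R C"
  define M where "M = max R1 ((R1 + K3) powr (1 / \<eta>'))"
  have R1: "1 \<le> R1" "R \<le> R1" "C \<le> R1" using C by (auto simp: R1_def)
  have K1: "0 < K1" using C by (simp add: K1_def)
  have K2: "0 < K2" using K1 \<alpha>0 by (simp add: K2_def)
  have K3: "0 < K3" using K2 by (simp add: K3_def)
  have "u i \<le> M" if sol: "discrete_solution CA CE n0 m h u" for n0 m h u i
  proof -
    interpret mesh N p q \<alpha>\<^sub>0 R j js jt \<alpha> \<beta> n0 m
      using sol by (intro mesh_axiomsI) (auto simp: discrete_solution_def)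
    have h: "0 < h" "h \<le> 1" and u: "u \<in> feasible"
      and kkt: "\<And>i. n0 \<le> i \<Longrightarrow> i \<le> m \<Longrightarrow> grad h u i * u i = 0"
      using sol by (auto simp: discrete_solution_def)
    have u0: "0 \<le> u k" for k using u by (rule feasible_nonneg)
    obtain i0 \<mu> where i0: "n0 \<le> i0" "i0 \<le> m" "u i0 = \<mu>" and ule: "\<And>k. u k \<le> \<mu>"
      using u by (auto elim: feasible_max)
    have "\<mu> \<le> M"
    proof (cases "\<mu> \<le> R1")
      case True
      then show ?thesis by (simp add: M_def)
    next
      case False
      have near: "real l * h < 1" if "n0 \<le> l" "R1 < u l" for l
      proof (rule ccontr)
        assume "\<not> real l * h < 1"
        then have "(real l * h) powr (- decay_exp) \<le> 1 powr (- decay_exp)"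
          using decay_exp_pos by (intro powr_mono2') auto
        then have "C * (real l * h) powr (- decay_exp) \<le> C * 1" using C by (intro mult_left_mono) auto
        then show False using decay[OF sol that(1)] that(2) R1(3) by simp
      qed
      \<comment> \<open>Up to \<open>k1\<close> all values exceed \<open>R1 \<ge> C\<close>, so by
        decay these nodes lie at radius below 1; \<open>k1\<close> itself, one node further, is at
        radius at most 2.\<close>
      define k1 where "k1 = (LEAST k. i0 < k \<and> u k \<le> R1)"
      have "i0 < Suc m \<and> u (Suc m) \<le> R1" using i0 u R1 by (auto simp: feasible_def)
      then have k1: "i0 < k1" "u k1 \<le> R1" "k1 \<le> Suc m"
        unfolding k1_def using LeastI[of "\<lambda>k. i0 < k \<and> u k \<le> R1" "Suc m"]
          Least_le[of "\<lambda>k. i0 < k \<and> u k \<le> R1" "Suc m"] by auto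
      have big: "R1 < u l" if "i0 \<le> l" "l < k1" for l
        using not_less_Least[of l "\<lambda>k. i0 < k \<and> u k \<le> R1"] that False i0
        by (cases "l = i0") (auto simp: k1_def)
      have flux_i0: "0 \<le> flux h u i0"
        using ule[of "i0 - 1"] i0(3) h by (auto simp: flux_def slope_def)
      \<comment> \<open>The flux starts nonnegative, because the difference to the left of a maximum
        is. On the way u is positive, so complementarity gives the equation, from which the
        nonnegative terms with j_s and \<open>u powr (p - 1)\<close> are dropped.\<close>
      have flux_ge: "- (h * (\<Sum>l=i0..<k. real l ^ (N - 1) * u l powr (q - 1))) \<le> flux h u k"
        if "i0 \<le> k" "k \<le> k1" for k
        using that
      proof (induction k rule: dec_induct)
        case base
        then show ?case using flux_i0 by simp
      next
        case (step k)
        then have k: "n0 \<le> k" "k \<le> m" "R1 < u k" using i0 k1 big by auto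
        then have uk: "0 < u k" "R \<le> u k" using R1 by auto
        then have "grad h u k = 0" using kkt[OF k(1,2)] by simp
        then have "flux h u (Suc k) = flux h u k + h * (real k ^ (N - 1) * (Js (u k) (slope h u k) + F' (u k)))"
          using h by (simp add: grad_def field_simps)
        moreover have "h * (real k ^ (N - 1) * (- (u k powr (q - 1)))) \<le>
            h * (real k ^ (N - 1) * (Js (u k) (slope h u k) + F' (u k)))"
          using h uk Js_nonneg[OF uk(2), of "slope h u k"] by (intro mult_left_mono) (auto simp: F'_def)
        moreover have "(\<Sum>l=i0..<Suc k. real l ^ (N - 1) * u l powr (q - 1))
            = (\<Sum>l=i0..<k. real l ^ (N - 1) * u l powr (q - 1)) + real k ^ (N - 1) * u k powr (q - 1)"
          using step by simp
        ultimately show ?case using step by (simp add: distrib_left)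
      qed
      have \<mu>: "1 < \<mu>" using False R1 by simp
      have slope_ge: "- slope h u k \<le> K2 * \<mu> powr (1 - \<eta>') * (real k * h) powr (\<theta>2 - 1)"
        if k: "i0 < k" "k \<le> k1" for k
      proof (cases "slope h u k < 0")
        case False
        moreover have "0 \<le> K2 * \<mu> powr (1 - \<eta>') * (real k * h) powr (\<theta>2 - 1)" using K2 by simp
        ultimately show ?thesis by linarith
      next
        case True
        define s where "s = - slope h u k"
        have s: "0 < s" "\<bar>slope h u k\<bar> = s" using True by (auto simp: s_def)
        have kpos: "0 < real k" using k by simp
        have "h * (\<Sum>l=i0..<k. real l ^ (N - 1) * u l powr (q - 1))
            \<le> h * (\<Sum>l=i0..<k. \<mu> powr (p - 1 - \<eta>) * (C powr (q - p + \<eta>) * h powr (- b)) * real l powr (\<theta>1 - 1))"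
        proof (intro mult_left_mono sum_mono)
          fix l assume "l \<in> {i0..<k}"
          then have l: "n0 \<le> l" "1 \<le> l" "R1 < u l" using i0 n0 big k by auto
          then have ul: "0 < u l" using R1 by simp
          \<comment> \<open>The first factor is bounded by the maximum, the second by the
            decay.\<close>
          have "u l powr (q - 1) = u l powr (p - 1 - \<eta>) * u l powr (q - p + \<eta>)"
            by (simp flip: powr_add)
          also have "\<dots> \<le> \<mu> powr (p - 1 - \<eta>) * (C * (real l * h) powr (- a)) powr (q - p + \<eta>)"
            using ule[of l] ul \<eta> pq decay[OF sol l(1)] by (intro mult_mono powr_mono2) (auto simp: a_def)
          also have "(C * (real l * h) powr (- a)) powr (q - p + \<eta>) = C powr (q - p + \<eta>) * h powr (- b) * real l powr (- b)"
            using C h l by (simp add: powr_mult powr_powr b_def)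
          finally have "u l powr (q - 1) \<le> \<mu> powr (p - 1 - \<eta>) * (C powr (q - p + \<eta>) * h powr (- b) * real l powr (- b))" .
          then have "real l powr (real N - 1) * u l powr (q - 1) \<le>
              real l powr (real N - 1) * (\<mu> powr (p - 1 - \<eta>) * (C powr (q - p + \<eta>) * h powr (- b) * real l powr (- b)))"
            by (intro mult_left_mono) auto
          also have "\<dots>
              = \<mu> powr (p - 1 - \<eta>) * (C powr (q - p + \<eta>) * h powr (- b)) * (real l powr (real N - 1) * real l powr (- b))"
            by simp
          also have "real l powr (real N - 1) * real l powr (- b) = real l powr (\<theta>1 - 1)"
            by (simp add: \<theta>1_def algebra_simps flip: powr_add)
          finally have "real l powr (real N - 1) * u l powr (q - 1) \<le>
              \<mu> powr (p - 1 - \<eta>) * (C powr (q - p + \<eta>) * h powr (- b)) * real l powr (\<theta>1 - 1)" .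
          moreover have "real l powr (real N - 1) = real l ^ (N - 1)"
            using l N2 by (simp add: powr_realpow[symmetric] of_nat_diff)
          ultimately show "real l ^ (N - 1) * u l powr (q - 1) \<le>
              \<mu> powr (p - 1 - \<eta>) * (C powr (q - p + \<eta>) * h powr (- b)) * real l powr (\<theta>1 - 1)" by simp
        qed (use h in auto)
        also have "\<dots> = \<mu> powr (p - 1 - \<eta>) * (C powr (q - p + \<eta>) * (h * h powr (- b))) * (\<Sum>l=i0..<k. real l powr (\<theta>1 - 1))"
          by (simp add: sum_distrib_left mult_ac)
        also have "\<dots> \<le> \<mu> powr (p - 1 - \<eta>) * (C powr (q - p + \<eta>) * (h * h powr (- b))) * (max 1 (1 / \<theta>1) * real k powr \<theta>1)"
        proof (intro mult_left_mono)
          have "(\<Sum>l=i0..<k. real l powr (\<theta>1 - 1)) \<le> (\<Sum>l=1..k. real l powr (\<theta>1 - 1))"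
            using i0 n0 by (intro sum_mono2) auto
          also have "\<dots> \<le> max 1 (1 / \<theta>1) * real k powr \<theta>1" by (rule sum_powr_head[OF \<theta>(1)])
          finally show "(\<Sum>l=i0..<k. real l powr (\<theta>1 - 1)) \<le> max 1 (1 / \<theta>1) * real k powr \<theta>1" .
        qed (use h in auto)
        also have "\<dots> = K1 * \<mu> powr (p - 1 - \<eta>) * (h * h powr (- b)) * real k powr \<theta>1"
          by (simp add: K1_def)
        finally have "- flux h u k \<le> K1 * \<mu> powr (p - 1 - \<eta>) * (h * h powr (- b)) * real k powr \<theta>1"
          using flux_ge[of k] k by linarith
        moreover have "real k ^ (N - 1) * (\<alpha>\<^sub>0 * s powr (p - 1)) \<le> - flux h u k"
        proof -
          have "\<alpha>\<^sub>0 * s powr (p - 1) \<le> \<bar>Jt (u k) (slope h u k)\<bar>" using Jt_lower[of "slope h u k" "u k"] s by simp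
          also have "\<dots> = - Jt (u k) (slope h u k)" using True by (simp add: abs_of_neg)
          finally have "real k ^ (N - 1) * (\<alpha>\<^sub>0 * s powr (p - 1)) \<le> real k ^ (N - 1) * (- Jt (u k) (slope h u k))"
            by (intro mult_left_mono) auto
          then show ?thesis by (simp add: flux_def)
        qed
        ultimately have "real k ^ (N - 1) * (\<alpha>\<^sub>0 * s powr (p - 1)) \<le>
            K1 * \<mu> powr (p - 1 - \<eta>) * (h * h powr (- b)) * real k powr \<theta>1" by linarith
        also have "real k powr \<theta>1 = real k ^ (N - 1) * real k powr (1 - b)"
        proof -
          have "real k ^ (N - 1) = real k powr (real N - 1)"
            using kpos N2 by (simp add: powr_realpow[symmetric] of_nat_diff)
          then show ?thesis by (simp add: \<theta>1_def flip: powr_add)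
        qed
        also have "h * h powr (- b) = h powr (1 - b)" using h by (simp add: powr_diff powr_minus field_simps)
        finally have "real k ^ (N - 1) * (\<alpha>\<^sub>0 * s powr (p - 1)) \<le>
            real k ^ (N - 1) * (K1 * \<mu> powr (p - 1 - \<eta>) * (real k * h) powr (1 - b))"
          using h by (simp add: powr_mult mult_ac)
        then have "\<alpha>\<^sub>0 * s powr (p - 1) \<le> K1 * \<mu> powr (p - 1 - \<eta>) * (real k * h) powr (1 - b)"
          using kpos by simp
        then have "s powr (p - 1) \<le> K1 / \<alpha>\<^sub>0 * \<mu> powr (p - 1 - \<eta>) * (real k * h) powr (1 - b)"
          using \<alpha>0 by (simp add: field_simps)
        then have "(s powr (p - 1)) powr (1 / (p - 1)) \<le>
            (K1 / \<alpha>\<^sub>0 * \<mu> powr (p - 1 - \<eta>) * (real k * h) powr (1 - b)) powr (1 / (p - 1))"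
          using p1 by (intro powr_mono2) auto
        also have "(s powr (p - 1)) powr (1 / (p - 1)) = s" using s p1 by (simp add: powr_powr)
        also have "(K1 / \<alpha>\<^sub>0 * \<mu> powr (p - 1 - \<eta>) * (real k * h) powr (1 - b)) powr (1 / (p - 1))
            = K2 * \<mu> powr ((p - 1 - \<eta>) / (p - 1)) * (real k * h) powr ((1 - b) / (p - 1))"
        proof -
          have "(X * A * B) powr c = X powr c * A powr c * B powr c" if "0 < X" "0 < A" "0 < B" for X A B c :: real
            using that by (simp add: powr_mult)
          from this[of "K1 / \<alpha>\<^sub>0" "\<mu> powr (p - 1 - \<eta>)" "(real k * h) powr (1 - b)" "1 / (p - 1)"]
          show ?thesis using K1 \<alpha>0 \<mu> h kpos unfolding K2_def powr_powr by simp
        qed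
        also have "(p - 1 - \<eta>) / (p - 1) = 1 - \<eta>'" using p1 by (simp add: \<eta>'_def diff_divide_distrib)
        also have "(1 - b) / (p - 1) = \<theta>2 - 1" using p1 by (simp add: \<theta>2_def field_simps)
        finally show ?thesis by (simp add: s_def)
      qed
      have "\<mu> - u k1 = (\<Sum>k=Suc i0..k1. u (k - 1) - u k)"
        using sum_increments[of i0 k1 u] k1 i0 by simp
      also have "\<dots> = (\<Sum>k=Suc i0..k1. h * - slope h u k)"
        using h i0 by (intro sum.cong) (auto simp: slope_def)
      also have "\<dots> \<le> (\<Sum>k=Suc i0..k1. h * (K2 * \<mu> powr (1 - \<eta>') * (real k * h) powr (\<theta>2 - 1)))"
        using h slope_ge by (intro sum_mono mult_left_mono) auto
      also have "\<dots> = K2 * \<mu> powr (1 - \<eta>') * h powr \<theta>2 * (\<Sum>k=Suc i0..k1. real k powr (\<theta>2 - 1))"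
        using h by (simp add: sum_distrib_left powr_mult powr_diff mult_ac)
      also have "\<dots> \<le> K2 * \<mu> powr (1 - \<eta>') * h powr \<theta>2 * (max 1 (1 / \<theta>2) * real k1 powr \<theta>2)"
      proof (intro mult_left_mono)
        have "(\<Sum>k=Suc i0..k1. real k powr (\<theta>2 - 1)) \<le> (\<Sum>k=1..k1. real k powr (\<theta>2 - 1))"
          by (intro sum_mono2) auto
        also have "\<dots> \<le> max 1 (1 / \<theta>2) * real k1 powr \<theta>2" by (rule sum_powr_head[OF \<theta>(2)])
        finally show "(\<Sum>k=Suc i0..k1. real k powr (\<theta>2 - 1)) \<le> max 1 (1 / \<theta>2) * real k1 powr \<theta>2" .
      qed (use K2 in auto)
      also have "\<dots> = K2 * max 1 (1 / \<theta>2) * \<mu> powr (1 - \<eta>') * (real k1 * h) powr \<theta>2"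
        using h by (simp add: powr_mult mult_ac)
      also have "\<dots> \<le> K2 * max 1 (1 / \<theta>2) * \<mu> powr (1 - \<eta>') * 2 powr \<theta>2"
      proof (intro mult_left_mono powr_mono2)
        obtain k0 where k0: "k1 = Suc k0" "i0 \<le> k0" using k1(1) by (metis less_eq_Suc_le Suc_le_D Suc_le_mono)
        then have "real k0 * h < 1" using near[of k0] big[of k0] i0 by simp
        then show "real k1 * h \<le> 2" using k0 h by (simp add: distrib_right)
      qed (use \<theta> K2 h in auto)
      \<comment> \<open>The exponent 1 - \<eta>' below 1 closes the estimate: dividing by it leaves
        \<open>\<mu> powr \<eta>' \<le> R1 + K3\<close>, hence the choice of M.\<close>
      finally have "\<mu> \<le> R1 + K3 * \<mu> powr (1 - \<eta>')" using k1(2) by (simp add: K3_def mult_ac)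
      also have "\<dots> \<le> R1 * \<mu> powr (1 - \<eta>') + K3 * \<mu> powr (1 - \<eta>')"
        using R1 \<mu> \<eta>' ge_one_powr_ge_zero[of \<mu> "1 - \<eta>'"] by (intro add_right_mono) (auto simp: mult_le_cancel_left1)
      also have "\<dots> = (R1 + K3) * (\<mu> / \<mu> powr \<eta>')" using \<mu> by (simp add: powr_diff add_divide_distrib distrib_right)
      finally have "\<mu> * \<mu> powr \<eta>' \<le> \<mu> * (R1 + K3)" using \<mu> by (simp add: field_simps)
      then have "\<mu> powr \<eta>' \<le> R1 + K3" using \<mu> by simp
      then have "(\<mu> powr \<eta>') powr (1 / \<eta>') \<le> (R1 + K3) powr (1 / \<eta>')"
        using \<eta>' by (intro powr_mono2) auto
      then have "\<mu> \<le> (R1 + K3) powr (1 / \<eta>')" using \<eta>' \<mu> by (simp add: powr_powr)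
      then show ?thesis by (simp add: M_def)
    qed
    then show "u i \<le> M" using ule[of i] by simp
  qed
  moreover have "1 \<le> M" using R1 by (simp add: M_def)
  ultimately show ?thesis using that by blast
qed

end

lemma sum_power_below:
  assumes "1 \<le> n0" "0 < h" "0 \<le> r" "1 \<le> N"
  shows "h ^ N * (\<Sum>i\<in>{n0..m} \<inter> {i. real i * h < r}. real i ^ (N - 1)) \<le> r ^ N"
proof -
  define I where "I = {n0..m} \<inter> {i. real i * h < r}"
  have "I \<subseteq> {1..nat \<lfloor>r / h\<rfloor>}"
    using assms by (auto simp: I_def le_nat_iff le_floor_iff field_simps)
  then have "card I \<le> card {1..nat \<lfloor>r / h\<rfloor>}" by (intro card_mono) auto
  then have "real (card I) \<le> real (nat \<lfloor>r / h\<rfloor>)" by simp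
  also have "\<dots> \<le> r / h" using assms by (simp add: of_nat_nat)
  finally have card: "real (card I) \<le> r / h" .
  have "(\<Sum>i\<in>I. real i ^ (N - 1)) \<le> (\<Sum>i\<in>I. (r / h) ^ (N - 1))"
    using assms by (intro sum_mono power_mono) (auto simp: I_def field_simps)
  also have "\<dots> = real (card I) * (r / h) ^ (N - 1)" by simp
  also have "\<dots> \<le> r / h * (r / h) ^ (N - 1)" using card assms by (intro mult_right_mono) auto
  also have "\<dots> = (r / h) ^ N" using assms by (simp add: power_eq_if)
  finally have "h ^ N * (\<Sum>i\<in>I. real i ^ (N - 1)) \<le> h ^ N * (r / h) ^ N"
    using assms by (intro mult_left_mono) auto
  also have "\<dots> = r ^ N" using assms by (simp add: power_divide)
  finally show ?thesis by (simp add: I_def)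
qed

section \<open>Consequences of small increments: equations, flux bound, lower bound of the
  maximum\<close>

context mesh
begin

text \<open>Once the increments of \<open>u\<close> are small, the complementarity conditions turn into equations:
  at a zero of \<open>u\<close> the natural growth term is dominated by the flux, which forces
  \<open>grad h u i \<le> 0\<close>.\<close>

context
  fixes h :: real and u :: "nat \<Rightarrow> real" and M :: real
  assumes h: "0 < h" and u: "u \<in> feasible" and uM: "\<And>i. u i \<le> M"
    and jump: "\<And>i. n0 < i \<Longrightarrow> i \<le> Suc m \<Longrightarrow> \<beta> M * \<bar>u i - u (i - 1)\<bar> \<le> \<alpha>\<^sub>0 / 2"
    and kkt: "\<And>i. n0 \<le> i \<Longrightarrow> i \<le> m \<Longrightarrow> 0 \<le> grad h u i \<and> grad h u i * u i = 0"
begin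

text \<open>The p-th power of the slope is the slope times its (p - 1)-th power, and the latter is
  at most the flux over \<open>\<alpha>\<^sub>0\<close>. The remaining slope times h is the jump of
  u, so small jumps make the growth term a small fraction of the flux.\<close>

lemma growth_le_flux:
  assumes "n0 < i"
  shows "h * (real i ^ (N - 1) * \<bar>Js (u i) (slope h u i)\<bar>) \<le> \<beta> M / \<alpha>\<^sub>0 * \<bar>u i - u (i - 1)\<bar> * \<bar>flux h u i\<bar>"
proof -
  define s where "s = \<bar>slope h u i\<bar>"
  have s: "s * h = \<bar>u i - u (i - 1)\<bar>" "0 \<le> s" using assms h by (auto simp: s_def slope_def abs_divide)
  have "\<bar>Js (u i) (slope h u i)\<bar> \<le> \<beta> \<bar>u i\<bar> * s powr p" unfolding s_def by (rule Js_bound)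
  also have "\<dots> \<le> \<beta> M * s powr p"
    using uM[of i] feasible_nonneg[OF u, of i] by (intro mult_right_mono monoD[OF \<beta>_mono]) auto
  also have "s powr p = s powr (p - 1) * s" using s p1 by (cases "s = 0") (auto simp: powr_diff)
  also have "\<beta> M * (s powr (p - 1) * s) = \<beta> M / \<alpha>\<^sub>0 * s * (\<alpha>\<^sub>0 * s powr (p - 1))" using \<alpha>0 by simp
  also have "\<dots> \<le> \<beta> M / \<alpha>\<^sub>0 * s * \<bar>Jt (u i) (slope h u i)\<bar>"
    using Jt_lower[of "slope h u i" "u i"] \<alpha>0 \<beta>_pos[of M] s
    by (intro mult_left_mono) (auto simp: s_def less_imp_le)
  finally have "h * (real i ^ (N - 1) * \<bar>Js (u i) (slope h u i)\<bar>)
      \<le> h * (real i ^ (N - 1) * (\<beta> M / \<alpha>\<^sub>0 * s * \<bar>Jt (u i) (slope h u i)\<bar>))"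
    using h by (intro mult_left_mono) auto
  also have "\<dots> = \<beta> M / \<alpha>\<^sub>0 * (s * h) * \<bar>flux h u i\<bar>" by (simp add: flux_def abs_mult)
  finally show ?thesis by (simp only: s)
qed

lemma growth_le_half_flux:
  assumes "n0 \<le> i" "i \<le> Suc m"
  shows "h * (real i ^ (N - 1) * \<bar>Js (u i) (slope h u i)\<bar>) \<le> \<bar>flux h u i\<bar> / 2"
proof (cases "i = n0")
  case False
  then have i: "n0 < i" using assms by simp
  have "\<beta> M / \<alpha>\<^sub>0 * \<bar>u i - u (i - 1)\<bar> \<le> 1 / 2" using jump[OF i assms(2)] \<alpha>0 by (simp add: field_simps)
  then have "\<beta> M / \<alpha>\<^sub>0 * \<bar>u i - u (i - 1)\<bar> * \<bar>flux h u i\<bar> \<le> 1 / 2 * \<bar>flux h u i\<bar>"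
    by (intro mult_right_mono) auto
  with growth_le_flux[OF i] have "h * (real i ^ (N - 1) * \<bar>Js (u i) (slope h u i)\<bar>) \<le> 1 / 2 * \<bar>flux h u i\<bar>"
    by (rule order_trans)
  then show ?thesis by simp
qed simp

lemma discrete_equation:
  assumes "n0 \<le> i" "i \<le> m"
  shows "flux h u (Suc i) = flux h u i + h * (real i ^ (N - 1) * (Js (u i) (slope h u i) + F' (u i)))"
proof -
  have h_grad: "h * grad h u i = flux h u i - flux h u (Suc i)
      + h * (real i ^ (N - 1) * (Js (u i) (slope h u i) + F' (u i)))"
    using h by (simp add: grad_def field_simps)
  have "grad h u i = 0"
  proof (cases "u i = 0")
    case False
    then show ?thesis using kkt[OF assms] by simp
  next
    case True
    have "0 \<le> flux h u (Suc i)"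
      using True assms feasible_nonneg[OF u, of "Suc i"] h by (auto simp: flux_def slope_def)
    moreover have "flux h u i \<le> 0"
      using True assms feasible_nonneg[OF u, of "i - 1"] h
      by (auto simp: flux_def slope_def mult_le_0_iff divide_le_0_iff)
    moreover have "h * (real i ^ (N - 1) * Js (u i) (slope h u i))
        \<le> h * (real i ^ (N - 1) * \<bar>Js (u i) (slope h u i)\<bar>)"
      using h by (intro mult_left_mono) auto
    moreover have "\<dots> \<le> \<bar>flux h u i\<bar> / 2" using assms by (intro growth_le_half_flux) auto
    ultimately have "h * grad h u i \<le> 0" using True h_grad by simp
    then have "grad h u i \<le> 0" using h by (simp add: mult_le_0_iff)
    then show ?thesis using kkt[OF assms] by simp
  qed
  then show ?thesis using h_grad by simp
qed

lemma abs_F'_le: "\<bar>F' (u i)\<bar> \<le> M powr (p - 1) + M powr (q - 1)"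
proof -
  have "u i powr (p - 1) \<le> M powr (p - 1)" "u i powr (q - 1) \<le> M powr (q - 1)"
    using uM[of i] feasible_nonneg[OF u, of i] p1 pq by (auto intro!: powr_mono2)
  moreover have "\<bar>F' (u i)\<bar> \<le> u i powr (p - 1) + u i powr (q - 1)"
    using feasible_nonneg[OF u, of i] by (auto simp: F'_def sgn_if abs_le_iff add_increasing)
  ultimately show ?thesis by linarith
qed

text \<open>The exponential weight absorbs the natural growth term, because the sign of the flux is the
  sign of the increment of \<open>u\<close>.\<close>

lemma flux_bound:
  assumes "n0 \<le> i" "i \<le> Suc m"
  shows "\<bar>flux h u i\<bar> \<le> exp (\<beta> M / \<alpha>\<^sub>0 * M) * (M powr (p - 1) + M powr (q - 1)) * (h * real i ^ N)"
proof -
  define c where "c = \<beta> M / \<alpha>\<^sub>0"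
  define CF where "CF = M powr (p - 1) + M powr (q - 1)"
  have c: "0 \<le> c" using \<beta>_pos[of M] \<alpha>0 by (simp add: c_def)
  have CF: "0 \<le> CF" by (simp add: CF_def)
  define g where "g = (\<lambda>l. h * (real l ^ (N - 1) * CF))"
  define S where "S = (\<lambda>i. \<Sum>l=n0..<i. g l)"
  \<comment> \<open>\<open>v i\<close> is the value at the left end of the cell to which flux i
    belongs, so \<open>v (Suc i) = u i\<close>; at \<open>n0\<close>, where the slope is 0 by
    convention, it is \<open>u n0\<close> itself.\<close>
  define v where "v = (\<lambda>i. if i \<le> n0 then u n0 else u (i - 1))"
  have g0: "0 \<le> g l" for l using h CF by (simp add: g_def)
  have S0: "0 \<le> S l" for l using g0 by (simp add: S_def sum_nonneg)
  have u0: "0 \<le> u l" for l using u by (rule feasible_nonneg)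
  \<comment> \<open>Positive flux means increasing u, so the weight for the upper bound grows with
    v; the weight for the lower bound grows as v falls. If the flux has the other sign, the growth
    term takes at most half of it and only the zero-order term remains.\<close>
  have "flux h u i \<le> exp (c * v i) * S i \<and> - flux h u i \<le> exp (c * (M - v i)) * S i"
    using assms
  proof (induction i rule: dec_induct)
    case base
    then show ?case by (simp add: S_def)
  next
    case (step i)
    then have i: "n0 \<le> i" "i \<le> m" by auto
    have vS: "v (Suc i) = u i" using i by (simp add: v_def)
    have SS: "S (Suc i) = S i + g i" using i by (simp add: S_def)
    have ex: "g i \<le> exp (c * w) * g i" if "0 \<le> w" for w
      using mult_right_mono[of 1 "exp (c * w)" "g i"] g0 c that by simp
    define \<Delta> where "\<Delta> = u i - v i"
    define G where "G = h * (real i ^ (N - 1) * Js (u i) (slope h u i))"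
    have sgn: "0 \<le> flux h u i \<longleftrightarrow> 0 \<le> \<Delta>" "flux h u i \<le> 0 \<longleftrightarrow> \<Delta> \<le> 0"
    proof -
      obtain P where P: "0 < P" "flux h u i = P * Jt (u i) (slope h u i)"
        using i n0 by (intro that[of "real i ^ (N - 1)"]) (auto simp: flux_def)
      have "slope h u i = (if i \<le> n0 then 0 else \<Delta> / h)" by (simp add: slope_def \<Delta>_def v_def)
      moreover have "i \<le> n0 \<Longrightarrow> \<Delta> = 0" using i by (simp add: \<Delta>_def v_def)
      ultimately show "0 \<le> flux h u i \<longleftrightarrow> 0 \<le> \<Delta>" "flux h u i \<le> 0 \<longleftrightarrow> \<Delta> \<le> 0"
        using P h by (auto simp: zero_le_mult_iff mult_le_0_iff zero_le_divide_iff divide_le_0_iff)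
    qed
    have Gabs: "\<bar>G\<bar> = h * (real i ^ (N - 1) * \<bar>Js (u i) (slope h u i)\<bar>)"
      using h by (simp add: G_def abs_mult)
    have G1: "\<bar>G\<bar> \<le> \<bar>flux h u i\<bar> / 2" unfolding Gabs using i by (intro growth_le_half_flux) auto
    have G2: "\<bar>G\<bar> \<le> c * \<bar>\<Delta>\<bar> * \<bar>flux h u i\<bar>"
    proof (cases "i = n0")
      case True
      then show ?thesis using G1 by simp
    next
      case False
      then show ?thesis unfolding Gabs using growth_le_flux[of i] i by (simp add: c_def \<Delta>_def v_def)
    qed
    have F1: "\<bar>h * (real i ^ (N - 1) * F' (u i))\<bar> \<le> g i"
    proof -
      have "\<bar>h * (real i ^ (N - 1) * F' (u i))\<bar> = h * (real i ^ (N - 1) * \<bar>F' (u i)\<bar>)"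
        using h by (simp add: abs_mult)
      also have "\<dots> \<le> g i" unfolding g_def CF_def using h abs_F'_le by (intro mult_left_mono) auto
      finally show ?thesis .
    qed
    have eq: "flux h u (Suc i) = flux h u i + G + h * (real i ^ (N - 1) * F' (u i))"
      using discrete_equation[OF i] by (simp add: G_def distrib_left)
    have up: "flux h u (Suc i) \<le> exp (c * u i) * S (Suc i)"
    proof (cases "0 \<le> flux h u i")
      case True
      then have \<Delta>: "0 \<le> \<Delta>" using sgn by simp
      have "flux h u (Suc i) \<le> flux h u i * (1 + c * \<Delta>) + g i"
        using eq G2 F1 True \<Delta> by (simp add: algebra_simps)
      also have "\<dots> \<le> flux h u i * exp (c * \<Delta>) + g i"
        using True by (intro add_right_mono mult_left_mono exp_ge_add_one_self)
      also have "\<dots> \<le> (exp (c * v i) * S i) * exp (c * \<Delta>) + g i"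
        using step i by (intro add_right_mono mult_right_mono) auto
      also have "(exp (c * v i) * S i) * exp (c * \<Delta>) = exp (c * u i) * S i"
        by (simp add: \<Delta>_def right_diff_distrib exp_diff)
      also have "exp (c * u i) * S i + g i \<le> exp (c * u i) * S i + exp (c * u i) * g i"
        using ex[OF u0[of i]] by simp
      finally show ?thesis by (simp add: SS distrib_left)
    next
      case False
      then have "flux h u (Suc i) \<le> g i" using eq G1 F1 by linarith
      also have "\<dots> \<le> exp (c * u i) * g i" using ex[OF u0] .
      also have "\<dots> \<le> exp (c * u i) * S (Suc i)" using S0[of i] SS by (intro mult_left_mono) auto
      finally show ?thesis .
    qed
    have Mu: "0 \<le> M - u i" using uM[of i] by simp
    have lo: "- flux h u (Suc i) \<le> exp (c * (M - u i)) * S (Suc i)"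
    proof (cases "flux h u i \<le> 0")
      case True
      then have \<Delta>: "\<Delta> \<le> 0" using sgn by simp
      have "- flux h u (Suc i) \<le> - flux h u i * (1 + c * (- \<Delta>)) + g i"
        using eq G2 F1 True \<Delta> by (simp add: algebra_simps)
      also have "\<dots> \<le> - flux h u i * exp (c * (- \<Delta>)) + g i"
        using True by (intro add_right_mono mult_left_mono exp_ge_add_one_self) auto
      also have "\<dots> \<le> (exp (c * (M - v i)) * S i) * exp (c * (- \<Delta>)) + g i"
        using step i by (intro add_right_mono mult_right_mono) auto
      also have "(exp (c * (M - v i)) * S i) * exp (c * (- \<Delta>)) = exp (c * (M - v i) + c * (- \<Delta>)) * S i"
        by (simp only: exp_add) simp
      also have "c * (M - v i) + c * (- \<Delta>) = c * (M - u i)" by (simp add: \<Delta>_def algebra_simps)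
      also have "exp (c * (M - u i)) * S i + g i \<le> exp (c * (M - u i)) * S i + exp (c * (M - u i)) * g i"
        using ex[OF Mu] by simp
      finally show ?thesis by (simp add: SS distrib_left)
    next
      case False
      then have "- flux h u (Suc i) \<le> g i" using eq G1 F1 by linarith
      also have "\<dots> \<le> exp (c * (M - u i)) * g i" using ex[OF Mu] .
      also have "\<dots> \<le> exp (c * (M - u i)) * S (Suc i)" using S0[of i] SS by (intro mult_left_mono) auto
      finally show ?thesis .
    qed
    show ?case using up lo vS by simp
  qed
  moreover have "exp (c * v i) * S i \<le> exp (c * M) * S i" "exp (c * (M - v i)) * S i \<le> exp (c * M) * S i"
  proof -
    have "0 \<le> v i" "v i \<le> M" using u0 uM by (auto simp: v_def)
    then show "exp (c * v i) * S i \<le> exp (c * M) * S i" "exp (c * (M - v i)) * S i \<le> exp (c * M) * S i"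
      using c S0[of i] by (auto intro!: mult_right_mono mult_left_mono)
  qed
  ultimately have "\<bar>flux h u i\<bar> \<le> exp (c * M) * S i" by linarith
  also have "S i \<le> CF * (h * real i ^ N)"
  proof -
    have "S i \<le> (\<Sum>l=n0..<i. h * (real i ^ (N - 1) * CF))"
      unfolding S_def g_def using h CF by (intro sum_mono mult_left_mono mult_right_mono power_mono) auto
    also have "\<dots> = real (i - n0) * (h * (real i ^ (N - 1) * CF))" by simp
    also have "\<dots> \<le> real i * (h * (real i ^ (N - 1) * CF))" using h CF by (intro mult_right_mono) auto
    also have "\<dots> = CF * (h * (real i * real i ^ (N - 1)))" by simp
    also have "real i * real i ^ (N - 1) = real i ^ N" using N2 by (simp add: power_eq_if)
    finally show ?thesis .
  qed
  finally show ?thesis by (simp add: c_def CF_def mult_ac)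
qed

text \<open>A discrete maximum principle: at a maximum the flux comes in nonnegative and leaves
  nonpositive, and the growth term cannot reverse it, so \<open>F' (u i)\<close> is not positive.
  This lower bound is what makes the limit nontrivial.\<close>

lemma max_ge_1:
  assumes i: "n0 \<le> i" "i \<le> m" and max: "\<And>k. u k \<le> u i" and pos: "0 < u i"
  shows "1 \<le> u i"
proof (rule ccontr)
  assume "\<not> 1 \<le> u i"
  then have "u i powr (q - 1) < u i powr (p - 1)" using pos pq by (intro powr_less_mono') auto
  then have F': "0 < F' (u i)" using pos by (simp add: F'_def)
  have "0 \<le> flux h u i" using max[of "i - 1"] h by (auto simp: flux_def slope_def)
  moreover have "flux h u (Suc i) \<le> 0"
    using max[of "Suc i"] h by (auto simp: flux_def slope_def mult_le_0_iff divide_le_0_iff)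
  moreover have "h * (real i ^ (N - 1) * \<bar>Js (u i) (slope h u i)\<bar>) \<le> \<bar>flux h u i\<bar> / 2"
    using i by (intro growth_le_half_flux) auto
  moreover have "h * (real i ^ (N - 1) * - \<bar>Js (u i) (slope h u i)\<bar>) \<le> h * (real i ^ (N - 1) * Js (u i) (slope h u i))"
    using h by (intro mult_left_mono) auto
  moreover have "0 < h * (real i ^ (N - 1) * F' (u i))" using h i n0 F' by simp
  ultimately show False using discrete_equation[OF i] by (simp add: distrib_left)
qed

end

end

context quasilinear
begin

text \<open>The interface to the limit passage. The complementarity conditions have become
  equations, and the radius \<rho> confines the nodes with value at least 1 to a bounded
  set.\<close>

definition mesh_estimates :: "real \<Rightarrow> real \<Rightarrow> real \<Rightarrow> real \<Rightarrow> real \<Rightarrow> nat \<Rightarrow> nat \<Rightarrow> real \<Rightarrow> (nat \<Rightarrow> real) \<Rightarrow> bool" where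
  "mesh_estimates M K \<rho> CP CA n0 m h u \<longleftrightarrow> 1 \<le> n0 \<and> n0 \<le> m \<and> 0 < h \<and>
     (\<forall>i. 0 \<le> u i \<and> u i \<le> M) \<and> (\<forall>i. m < i \<longrightarrow> u i = 0) \<and>
     (\<forall>i. n0 \<le> i \<longrightarrow> i \<le> m \<longrightarrow> mesh.flux N jt n0 h u (Suc i) = mesh.flux N jt n0 h u i
          + h * (real i ^ (N - 1) * (Js (u i) (mesh.slope n0 h u i) + F' (u i)))) \<and>
     (\<forall>i. n0 \<le> i \<longrightarrow> i \<le> Suc m \<longrightarrow> \<bar>mesh.flux N jt n0 h u i\<bar> \<le> K * (h * real i ^ N)) \<and>
     (\<exists>i. n0 \<le> i \<and> i \<le> m \<and> 1 \<le> u i \<and> real i * h \<le> \<rho>) \<and>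
     h ^ N * (\<Sum>i=n0..m. real i ^ (N - 1) * u i powr p) \<le> CP \<and>
     h ^ N * (\<Sum>i=n0..Suc m. real i ^ (N - 1) * \<bar>mesh.slope n0 h u i\<bar> powr p) \<le> CA"

text \<open>\<open>CE\<close> controls only the sum of F, which may be negative where u is large.
  Beyond a fixed radius decay makes u small and F at least half of its p-part; inside, u is bounded
  and the ball has bounded volume.\<close>

lemma uniform_estimates:
  obtains M K \<rho> CP \<omega> where "0 < \<omega>" "0 \<le> K"
    "\<And>n0 m h u. discrete_solution CA CE n0 m h u \<Longrightarrow>
      \<forall>i. n0 < i \<longrightarrow> i \<le> Suc m \<longrightarrow> \<bar>u i - u (i - 1)\<bar> \<le> \<omega> \<Longrightarrow> mesh_estimates M K \<rho> CP CA n0 m h u"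
proof -
  obtain M where M: "1 \<le> M" "\<And>n0 m h u i. discrete_solution CA CE n0 m h u \<Longrightarrow> u i \<le> M"
    using discrete_bound[of CA CE] by blast
  obtain C where C: "1 \<le> C" "\<And>n0 m h u i. discrete_solution CA CE n0 m h u \<Longrightarrow> n0 \<le> i \<Longrightarrow>
    u i \<le> C * (real i * h) powr (- decay_exp)" using discrete_decay[of CA CE] by blast
  \<comment> \<open>The largest jump for which the growth term takes at most half of the
    flux.\<close>
  define \<omega> where "\<omega> = \<alpha>\<^sub>0 / (2 * \<beta> M)"
  define K where "K = exp (\<beta> M / \<alpha>\<^sub>0 * M) * (M powr (p - 1) + M powr (q - 1))"
  define \<rho> where "\<rho> = C powr (1 / decay_exp)"
  \<comment> \<open>Below \<open>s1\<close> the q-part of F is at most half of the p-part, and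
    beyond the radius \<open>r1\<close> decay forces u below \<open>s1\<close>.\<close>
  define s1 where "s1 = (q / (2 * p)) powr (1 / (q - p))"
  have s1: "0 < s1" using p1 pq by (simp add: s1_def)
  define r1 where "r1 = (C / s1) powr (1 / decay_exp)"
  define CP where "CP = 2 * p * CE + 2 * p * (M powr q / q) * r1 ^ N"
  show ?thesis
  proof (rule that[of \<omega> K M \<rho> CP])
    show "0 < \<omega>" using \<alpha>0 \<beta>_pos[of M] by (simp add: \<omega>_def)
    show "0 \<le> K" by (simp add: K_def)
    fix n0 m h u
    assume sol: "discrete_solution CA CE n0 m h u"
      and jump: "\<forall>i. n0 < i \<longrightarrow> i \<le> Suc m \<longrightarrow> \<bar>u i - u (i - 1)\<bar> \<le> \<omega>"
    interpret mesh N p q \<alpha>\<^sub>0 R j js jt \<alpha> \<beta> n0 m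
      using sol by (intro mesh_axiomsI) (auto simp: discrete_solution_def)
    have h: "0 < h" and u: "u \<in> feasible"
      and kkt: "\<And>i. n0 \<le> i \<Longrightarrow> i \<le> m \<Longrightarrow> 0 \<le> grad h u i \<and> grad h u i * u i = 0"
      and CE: "h ^ N * (\<Sum>i=n0..m. real i ^ (N - 1) * F (u i)) \<le> CE" and pos: "\<exists>i. 0 < u i"
      using sol by (auto simp: discrete_solution_def)
    have u0: "0 \<le> u i" for i using u by (rule feasible_nonneg)
    have uM: "u i \<le> M" for i using M(2)[OF sol] .
    have jump': "\<beta> M * \<bar>u i - u (i - 1)\<bar> \<le> \<alpha>\<^sub>0 / 2" if "n0 < i" "i \<le> Suc m" for i
      using jump that \<beta>_pos[of M] by (simp add: \<omega>_def field_simps)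
    note facts = h u uM jump' kkt
    have 1: "\<forall>i. n0 \<le> i \<longrightarrow> i \<le> m \<longrightarrow> flux h u (Suc i) = flux h u i
          + h * (real i ^ (N - 1) * (Js (u i) (slope h u i) + F' (u i)))"
      using discrete_equation[OF facts] by blast
    have 2: "\<forall>i. n0 \<le> i \<longrightarrow> i \<le> Suc m \<longrightarrow> \<bar>flux h u i\<bar> \<le> K * (h * real i ^ N)"
      using flux_bound[OF facts] unfolding K_def by blast
    have 3: "\<exists>i. n0 \<le> i \<and> i \<le> m \<and> 1 \<le> u i \<and> real i * h \<le> \<rho>"
    proof -
      obtain i \<mu> where i: "n0 \<le> i" "i \<le> m" "u i = \<mu>" and ule: "\<And>k. u k \<le> \<mu>"
        using u by (auto elim: feasible_max)
      obtain k where "0 < u k" using pos by blast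
      then have \<mu>: "0 < u i" using ule[of k] i by simp
      have u1: "1 \<le> u i" using max_ge_1[OF facts i(1,2)] ule i \<mu> by simp
      have r: "0 < real i * h" using i n0 h by simp
      have "1 \<le> C * (real i * h) powr (- decay_exp)" using C(2)[OF sol i(1)] u1 by simp
      moreover have "0 < (real i * h) powr decay_exp" using r unfolding powr_gt_zero by linarith
      ultimately have "(real i * h) powr decay_exp \<le> C" by (simp add: powr_minus pos_le_divide_eq flip: divide_inverse)
      then have "((real i * h) powr decay_exp) powr (1 / decay_exp) \<le> \<rho>"
        unfolding \<rho>_def using decay_exp_pos by (intro powr_mono2) auto
      then have "real i * h \<le> \<rho>" using r decay_exp_pos by (simp add: powr_powr)
      then show ?thesis using i u1 by auto
    qed
    have 4: "h ^ N * (\<Sum>i=n0..m. real i ^ (N - 1) * u i powr p) \<le> CP"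
    proof -
      define I where "I = {n0..m} \<inter> {i. real i * h < r1}"
      have pw: "u i powr p \<le> 2 * p * F (u i) + (if real i * h < r1 then 2 * p * (M powr q / q) else 0)"
        if i: "n0 \<le> i" for i
      proof (cases "real i * h < r1")
        case True
        have "u i powr q \<le> M powr q" using u0 uM p1 pq by (intro powr_mono2) auto
        then have "u i powr q / q \<le> M powr q / q" using p1 pq by (intro divide_right_mono) auto
        then have "2 * p * (u i powr q / q) \<le> 2 * p * (M powr q / q)" using p1 by (intro mult_left_mono) auto
        moreover have "2 * p * F (u i) = 2 * u i powr p - 2 * p * (u i powr q / q)"
          using p1 u0[of i] by (simp add: F_def right_diff_distrib)
        ultimately show ?thesis using True powr_ge_zero[of "u i" p] by simp
      next
        case False
        have r1: "0 < r1" using C s1 by (simp add: r1_def)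
        have "u i \<le> C * (real i * h) powr (- decay_exp)" using C(2)[OF sol i] .
        also have "\<dots> \<le> C * r1 powr (- decay_exp)"
          using False r1 decay_exp_pos C by (intro mult_left_mono powr_mono2') auto
        also have "\<dots> = s1" using C s1 decay_exp_pos by (simp add: r1_def powr_powr powr_minus)
        finally have us: "u i \<le> s1" .
        have "u i powr q / q \<le> u i powr p / (2 * p)"
        proof (cases "u i = 0")
          case False
          then have ui: "0 < u i" using u0[of i] by simp
          have "u i powr (q - p) \<le> s1 powr (q - p)" using us ui pq by (intro powr_mono2) auto
          also have "\<dots> = q / (2 * p)" using p1 pq by (simp add: s1_def powr_powr)
          finally have "u i powr (q - p) * u i powr p \<le> q / (2 * p) * u i powr p" by (intro mult_right_mono) auto
          then have "u i powr q \<le> q / (2 * p) * u i powr p" by (simp flip: powr_add)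
          then show ?thesis using p1 pq by (simp add: field_simps)
        qed simp
        then have "u i powr p / (2 * p) \<le> F (u i)" using u0[of i] p1 by (simp add: F_def field_simps)
        then show ?thesis using False p1 by (simp add: field_simps)
      qed
      have "(\<Sum>i=n0..m. real i ^ (N - 1) * u i powr p)
          \<le> (\<Sum>i=n0..m. 2 * p * (real i ^ (N - 1) * F (u i))
              + (if real i * h < r1 then 2 * p * (M powr q / q) * real i ^ (N - 1) else 0))"
      proof (rule sum_mono)
        fix i assume "i \<in> {n0..m}"
        then have "real i ^ (N - 1) * u i powr p \<le> real i ^ (N - 1) *
           (2 * p * F (u i) + (if real i * h < r1 then 2 * p * (M powr q / q) else 0))"
          using pw[of i] by (intro mult_left_mono) auto
        then show "real i ^ (N - 1) * u i powr p \<le> 2 * p * (real i ^ (N - 1) * F (u i))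
              + (if real i * h < r1 then 2 * p * (M powr q / q) * real i ^ (N - 1) else 0)"
          by (auto simp: algebra_simps)
      qed
      also have "\<dots> = 2 * p * (\<Sum>i=n0..m. real i ^ (N - 1) * F (u i))
          + 2 * p * (M powr q / q) * (\<Sum>i\<in>I. real i ^ (N - 1))"
      proof -
        have "(\<Sum>i=n0..m. if real i * h < r1 then c * real i ^ (N - 1) else 0) = c * (\<Sum>i\<in>I. real i ^ (N - 1))" for c
          unfolding I_def sum.inter_restrict[OF finite_atLeastAtMost] sum_distrib_left by (intro sum.cong) auto
        then show ?thesis unfolding sum.distrib sum_distrib_left[symmetric] by simp
      qed
      finally have "h ^ N * (\<Sum>i=n0..m. real i ^ (N - 1) * u i powr p)
          \<le> h ^ N * (2 * p * (\<Sum>i=n0..m. real i ^ (N - 1) * F (u i))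
          + 2 * p * (M powr q / q) * (\<Sum>i\<in>I. real i ^ (N - 1)))" using h by (intro mult_left_mono) auto
      also have "\<dots> = 2 * p * (h ^ N * (\<Sum>i=n0..m. real i ^ (N - 1) * F (u i)))
          + 2 * p * (M powr q / q) * (h ^ N * (\<Sum>i\<in>I. real i ^ (N - 1)))"
        by (simp add: algebra_simps)
      also have "\<dots> \<le> 2 * p * CE + 2 * p * (M powr q / q) * r1 ^ N"
        unfolding I_def using p1 pq h CE n0 N2
        by (intro add_mono mult_left_mono sum_power_below) (auto simp: r1_def)
      finally show ?thesis by (simp add: CP_def)
    qed
    have 5: "h ^ N * (\<Sum>i=n0..Suc m. real i ^ (N - 1) * \<bar>slope h u i\<bar> powr p) \<le> CA"
      using sol unfolding discrete_solution_def by blast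
    have 6: "\<forall>i. m < i \<longrightarrow> u i = 0" using u by (simp add: feasible_def)
    show "mesh_estimates M K \<rho> CP CA n0 m h u"
      unfolding mesh_estimates_def using n0 nm h u0 uM 1 2 3 4 5 6 by blast
  qed
qed

end

section \<open>Compactness of grid functions\<close>

text \<open>The filter of grid points \<open>i * h n\<close> tending to \<open>r\<close> while the mesh is refined.\<close>

definition grid_filter :: "(nat \<Rightarrow> nat) \<Rightarrow> (nat \<Rightarrow> real) \<Rightarrow> real \<Rightarrow> (nat \<times> nat) filter" where
  "grid_filter n0 h r = inf (filtercomap (\<lambda>(n, i). (n, real i * h n)) (sequentially \<times>\<^sub>F nhds r))
     (principal {(n, i). n0 n \<le> i})"

lemma eventually_grid_filter:
  "eventually P (grid_filter n0 h r) \<longleftrightarrow>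
     (\<exists>\<delta>>0. \<exists>n1. \<forall>n\<ge>n1. \<forall>i\<ge>n0 n. \<bar>real i * h n - r\<bar> < \<delta> \<longrightarrow> P (n, i))"
proof
  assume "eventually P (grid_filter n0 h r)"
  then obtain Q where Q: "eventually Q (sequentially \<times>\<^sub>F nhds r)"
    "\<And>n i. Q (n, real i * h n) \<Longrightarrow> n0 n \<le> i \<Longrightarrow> P (n, i)"
    unfolding grid_filter_def eventually_inf_principal eventually_filtercomap by auto
  obtain Q1 Q2 where Q': "eventually Q1 sequentially" "eventually Q2 (nhds r)"
    "\<And>n x. Q1 n \<Longrightarrow> Q2 x \<Longrightarrow> Q (n, x)"
    using Q(1) unfolding eventually_prod_filter by auto
  obtain n1 where n1: "\<And>n. n1 \<le> n \<Longrightarrow> Q1 n" using Q'(1) by (auto simp: eventually_sequentially)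
  obtain \<delta> where \<delta>: "\<delta> > 0" "\<And>x. \<bar>x - r\<bar> < \<delta> \<Longrightarrow> Q2 x"
    using Q'(2) by (auto simp: eventually_nhds_metric dist_real_def)
  show "\<exists>\<delta>>0. \<exists>n1. \<forall>n\<ge>n1. \<forall>i\<ge>n0 n. \<bar>real i * h n - r\<bar> < \<delta> \<longrightarrow> P (n, i)"
    by (intro exI[of _ \<delta>] conjI \<delta>(1) exI[of _ n1] allI impI Q(2) Q'(3) n1 \<delta>(2))
next
  assume "\<exists>\<delta>>0. \<exists>n1. \<forall>n\<ge>n1. \<forall>i\<ge>n0 n. \<bar>real i * h n - r\<bar> < \<delta> \<longrightarrow> P (n, i)"
  then obtain \<delta> n1 where \<delta>: "\<delta> > 0" "\<And>n i. n1 \<le> n \<Longrightarrow> n0 n \<le> i \<Longrightarrow> \<bar>real i * h n - r\<bar> < \<delta> \<Longrightarrow> P (n, i)"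
    by blast
  have "eventually (\<lambda>(n, x). n1 \<le> n \<and> \<bar>x - r\<bar> < \<delta>) (sequentially \<times>\<^sub>F nhds r)"
    unfolding eventually_prod_filter using \<delta>(1)
    by (intro exI[of _ "\<lambda>n. n1 \<le> n"] exI[of _ "\<lambda>x. \<bar>x - r\<bar> < \<delta>"])
      (auto simp: eventually_sequentially eventually_nhds_metric dist_real_def)
  then show "eventually P (grid_filter n0 h r)"
    unfolding grid_filter_def eventually_inf_principal eventually_filtercomap
    by (intro exI[of _ "\<lambda>(n, x). n1 \<le> n \<and> \<bar>x - r\<bar> < \<delta>"]) (use \<delta>(2) in auto)
qed

lemma tendsto_grid_filter_iff:
  "((\<lambda>(n, i). f n i) \<longlongrightarrow> (c::real)) (grid_filter n0 h r) \<longleftrightarrow>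
     (\<forall>e>0. \<exists>\<delta>>0. \<exists>n1. \<forall>n\<ge>n1. \<forall>i\<ge>n0 n. \<bar>real i * h n - r\<bar> < \<delta> \<longrightarrow> \<bar>f n i - c\<bar> < e)"
  unfolding tendsto_iff eventually_grid_filter by (auto simp: dist_real_def)

lemma tendsto_grid_filterE:
  assumes "((\<lambda>(n, i). f n i) \<longlongrightarrow> (c::real)) (grid_filter n0 h r)" "e > 0"
  obtains \<delta> n1 where "\<delta> > 0"
    "\<And>n i. n1 \<le> n \<Longrightarrow> n0 n \<le> i \<Longrightarrow> \<bar>real i * h n - r\<bar> < \<delta> \<Longrightarrow> \<bar>f n i - c\<bar> < e"
  using assms(1)[unfolded tendsto_grid_filter_iff, rule_format, OF assms(2)]
  by (elim exE conjE) (rule that, auto)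

lemma grid_filter_subseq:
  assumes "((\<lambda>(n, i). f n i) \<longlongrightarrow> (c::real)) (grid_filter n0 h r)" "strict_mono k"
  shows "((\<lambda>(n, i). f (k n) i) \<longlongrightarrow> c) (grid_filter (n0 \<circ> k) (h \<circ> k) r)"
  unfolding tendsto_grid_filter_iff
proof (intro allI impI)
  fix e :: real assume "e > 0"
  then obtain \<delta> n1 where "\<delta> > 0" "\<And>n i. n1 \<le> n \<Longrightarrow> n0 n \<le> i \<Longrightarrow> \<bar>real i * h n - r\<bar> < \<delta> \<Longrightarrow> \<bar>f n i - c\<bar> < e"
    using tendsto_grid_filterE[OF assms(1)] by metis
  then show "\<exists>\<delta>>0. \<exists>n1. \<forall>n\<ge>n1. \<forall>i\<ge>(n0 \<circ> k) n. \<bar>real i * (h \<circ> k) n - r\<bar> < \<delta> \<longrightarrow> \<bar>f (k n) i - c\<bar> < e"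
    using seq_suble[OF assms(2)] by (intro exI[of _ \<delta>]) (auto intro!: exI[of _ n1] dest: order_trans)
qed

locale grid =
  fixes n0 :: "nat \<Rightarrow> nat" and h :: "nat \<Rightarrow> real"
  assumes h_pos: "0 < h n" and h_small: "h n \<le> 1 / Suc n" and n0_small: "real (n0 n) * h n \<le> 1 / Suc n"
begin

lemma h_0: "h \<longlonglongrightarrow> 0" and n0h_0: "(\<lambda>n. real (n0 n) * h n) \<longlonglongrightarrow> 0"
proof -
  have lim: "(\<lambda>n. 1 / real (Suc n)) \<longlonglongrightarrow> 0" using LIMSEQ_Suc[OF lim_1_over_n] by simp
  show "h \<longlonglongrightarrow> 0"
    by (rule tendsto_sandwich[OF _ _ tendsto_const lim]) (intro eventuallyI h_small less_imp_le h_pos)+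
  show "(\<lambda>n. real (n0 n) * h n) \<longlonglongrightarrow> 0"
    by (rule tendsto_sandwich[OF _ _ tendsto_const lim])
      (intro eventuallyI n0_small mult_nonneg_nonneg of_nat_0_le_iff less_imp_le[OF h_pos])+
qed

lemma grid_subseq: "strict_mono k \<Longrightarrow> grid (n0 \<circ> k) (h \<circ> k)"
proof (unfold_locales)
  fix n assume k: "strict_mono k"
  have le: "1 / real (Suc (k n)) \<le> 1 / real (Suc n)"
    using seq_suble[OF k, of n] by (intro divide_left_mono) auto
  show "0 < (h \<circ> k) n" by (simp add: h_pos)
  show "(h \<circ> k) n \<le> 1 / real (Suc n)" using h_small[of "k n"] le by simp
  show "real ((n0 \<circ> k) n) * (h \<circ> k) n \<le> 1 / real (Suc n)" using n0_small[of "k n"] le by simp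
qed

definition idx :: "real \<Rightarrow> nat \<Rightarrow> nat" where
  "idx r n = max (n0 n) (nat \<lfloor>r / h n\<rfloor>)"

lemma idx_ge: "n0 n \<le> idx r n" by (simp add: idx_def)

lemma idx_error:
  assumes "0 \<le> r"
  shows "\<bar>real (idx r n) * h n - r\<bar> \<le> 2 / Suc n"
proof -
  define j where "j = nat \<lfloor>r / h n\<rfloor>"
  have "real j \<le> r / h n" "r / h n < real j + 1"
    using assms h_pos[of n] unfolding j_def by (auto simp: of_nat_nat floor_le_iff)
  then have j: "real j * h n \<le> r" "r < real j * h n + h n"
    using h_pos[of n] by (auto simp: field_simps)
  have "real (idx r n) * h n = max (real (n0 n) * h n) (real j * h n)"
    using h_pos[of n] by (auto simp: idx_def j_def max_def)
  moreover have "0 \<le> real (n0 n) * h n" using h_pos[of n] by simp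
  moreover have "1 / real (Suc n) \<le> 2 / real (Suc n)" by (intro divide_right_mono) auto
  ultimately show ?thesis using j h_small[of n] n0_small[of n] assms by linarith
qed

lemma tendsto_idx: "0 \<le> r \<Longrightarrow> (\<lambda>n. real (idx r n) * h n) \<longlonglongrightarrow> r"
proof -
  assume r: "0 \<le> r"
  have "(\<lambda>n. 2 * (1 / real (Suc n))) \<longlonglongrightarrow> 2 * 0" by (intro tendsto_mult tendsto_const LIMSEQ_Suc[OF lim_1_over_n])
  then have "(\<lambda>n. 2 / real (Suc n)) \<longlonglongrightarrow> 0" by simp
  then have "(\<lambda>n. real (idx r n) * h n - r) \<longlonglongrightarrow> 0"
    by (rule Lim_null_comparison[rotated]) (use idx_error[OF r] in \<open>auto intro!: eventuallyI\<close>)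
  then show ?thesis by (simp add: LIM_zero_iff)
qed

lemma filterlim_grid_filterI:
  assumes "(\<lambda>n. real (i n) * h n) \<longlonglongrightarrow> r" "\<forall>\<^sub>F n in sequentially. n0 n \<le> i n"
  shows "filterlim (\<lambda>n. (n, i n)) (grid_filter n0 h r) sequentially"
  unfolding filterlim_iff eventually_grid_filter
proof (intro allI impI)
  fix P assume "\<exists>\<delta>>0. \<exists>n1. \<forall>n\<ge>n1. \<forall>i\<ge>n0 n. \<bar>real i * h n - r\<bar> < \<delta> \<longrightarrow> P (n, i)"
  then obtain \<delta> n1 where \<delta>: "\<delta> > 0" "\<And>n i. n1 \<le> n \<Longrightarrow> n0 n \<le> i \<Longrightarrow> \<bar>real i * h n - r\<bar> < \<delta> \<Longrightarrow> P (n, i)" by blast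
  have "\<forall>\<^sub>F n in sequentially. \<bar>real (i n) * h n - r\<bar> < \<delta>"
    using tendstoD[OF assms(1) \<delta>(1)] by (simp add: dist_real_def)
  with assms(2) eventually_ge_at_top[of n1] show "\<forall>\<^sub>F n in sequentially. P (n, i n)"
    by eventually_elim (auto intro: \<delta>)
qed

lemma filterlim_idx: "0 \<le> r \<Longrightarrow> filterlim (\<lambda>n. (n, idx r n)) (grid_filter n0 h r) sequentially"
  by (intro filterlim_grid_filterI tendsto_idx eventuallyI idx_ge)

lemma grid_filter_nontrivial: "0 \<le> r \<Longrightarrow> grid_filter n0 h r \<noteq> bot"
  using filterlim_idx[of r] by (metis bot.extremum_uniqueI filterlim_def filtermap_bot_iff sequentially_bot)

lemma tendsto_grid_compose:
  assumes "((\<lambda>(n, i). f n i) \<longlongrightarrow> c) (grid_filter n0 h r)"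
    "(\<lambda>n. real (i n) * h n) \<longlonglongrightarrow> r" "\<forall>\<^sub>F n in sequentially. n0 n \<le> i n"
  shows "(\<lambda>n. f n (i n)) \<longlonglongrightarrow> c"
  using filterlim_compose[OF assms(1) filterlim_grid_filterI[OF assms(2,3)]] by simp

lemma tendsto_grid_point: "((\<lambda>(n, i). real i * h n) \<longlongrightarrow> r) (grid_filter n0 h r)"
  unfolding tendsto_grid_filter_iff by blast

text \<open>Needed because the increment of u from i to \<open>Suc i\<close> involves the slope at
  \<open>Suc i\<close>, whereas the increment of the flux involves data at i.\<close>

lemma tendsto_grid_shift:
  assumes "((\<lambda>(n, i). f n i) \<longlongrightarrow> (c :: real)) (grid_filter n0 h r)"
  shows "((\<lambda>(n, i). f n (Suc i)) \<longlongrightarrow> c) (grid_filter n0 h r)"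
  unfolding tendsto_grid_filter_iff
proof (intro allI impI)
  fix e :: real assume "e > 0"
  then obtain \<delta> n1 where \<delta>: "\<delta> > 0" "\<And>n i. n1 \<le> n \<Longrightarrow> n0 n \<le> i \<Longrightarrow> \<bar>real i * h n - r\<bar> < \<delta> \<Longrightarrow> \<bar>f n i - c\<bar> < e"
    using tendsto_grid_filterE[OF assms] by metis
  obtain n2 where n2: "\<And>n. n2 \<le> n \<Longrightarrow> h n < \<delta> / 2"
    using order_tendstoD(2)[OF h_0, of "\<delta>/2"] \<delta>(1) by (auto simp: eventually_sequentially)
  show "\<exists>\<delta>>0. \<exists>n1. \<forall>n\<ge>n1. \<forall>i\<ge>n0 n. \<bar>real i * h n - r\<bar> < \<delta> \<longrightarrow> \<bar>f n (Suc i) - c\<bar> < e"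
  proof (intro exI[of _ "\<delta>/2"] conjI exI[of _ "max n1 n2"] allI impI)
    fix n i assume n: "max n1 n2 \<le> n" "n0 n \<le> i" "\<bar>real i * h n - r\<bar> < \<delta> / 2"
    have "real (Suc i) * h n = real i * h n + h n" by (simp add: algebra_simps)
    moreover have "h n < \<delta> / 2" using n n2[of n] by simp
    ultimately have "\<bar>real (Suc i) * h n - r\<bar> < \<delta>" using n(3) h_pos[of n] by linarith
    then show "\<bar>f n (Suc i) - c\<bar> < e" using \<delta>(2)[of n "Suc i"] n by (simp del: of_nat_Suc)
  qed (use \<delta> in auto)
qed

lemma lipschitz_chain:
  assumes step: "\<And>i. n0 n \<le> i \<Longrightarrow> real i * h n \<le> L \<Longrightarrow> \<bar>f (Suc i) - f i\<bar> \<le> B * h n"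
    and i: "n0 n \<le> i" "n0 n \<le> k" "real i * h n \<le> L" "real k * h n \<le> L"
  shows "\<bar>f i - f k\<bar> \<le> B * \<bar>real i * h n - real k * h n\<bar>"
proof -
  have *: "\<bar>f k - f i\<bar> \<le> B * (real k * h n - real i * h n)"
    if "n0 n \<le> i" "i \<le> k" "real k * h n \<le> L" for i k
    using that(2,3)
  proof (induction k rule: dec_induct)
    case (step k)
    have k: "real (Suc k) * h n = real k * h n + h n" by (simp add: algebra_simps)
    have "\<bar>f (Suc k) - f k\<bar> \<le> B * h n" using step that(1) h_pos[of n] k by (intro assms(1)) auto
    moreover have "\<bar>f k - f i\<bar> \<le> B * (real k * h n - real i * h n)" using step h_pos[of n] k by auto
    ultimately show ?case unfolding k by (simp add: algebra_simps)
  qed simp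
  show ?thesis
  proof (cases "i \<le> k")
    case True
    then have "real i * h n \<le> real k * h n" using h_pos[of n] by simp
    then show ?thesis using *[OF i(1) True i(4)] by (simp add: abs_minus_commute)
  next
    case False
    then have "real k * h n \<le> real i * h n" using h_pos[of n] by simp
    then show ?thesis using *[of k i] False i by simp
  qed
qed

text \<open>The bounds are required on [0, L] only for n \<ge> L, since only such meshes reach that
  far. Limits exist along a subsequence at nodes near rational radii, and the Lipschitz bound
  carries them to all radii. Convergence along \<open>grid_filter\<close> allows arbitrary nodes
  tending to r.\<close>

theorem grid_arzela_ascoli:
  assumes bound: "\<And>L. \<exists>B. \<forall>n i. L \<le> real n \<longrightarrow> n0 n \<le> i \<longrightarrow> real i * h n \<le> L \<longrightarrow>
      \<bar>f n i\<bar> \<le> B \<and> \<bar>f n (Suc i) - f n i\<bar> \<le> B * h n"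
  obtains k g where "strict_mono (k :: nat \<Rightarrow> nat)"
    "\<And>r. 0 \<le> r \<Longrightarrow> ((\<lambda>(n, i). f (k n) i) \<longlongrightarrow> (g r :: real)) (grid_filter (n0 \<circ> k) (h \<circ> k) r)"
    "\<And>L. \<exists>B. \<forall>r s. 0 \<le> r \<longrightarrow> r \<le> L \<longrightarrow> 0 \<le> s \<longrightarrow> s \<le> L \<longrightarrow> \<bar>g r - g s\<bar> \<le> B * \<bar>r - s\<bar>"
proof -
  have "\<exists>B. \<forall>L. \<forall>n i. L \<le> real n \<longrightarrow> n0 n \<le> i \<longrightarrow> real i * h n \<le> L \<longrightarrow>
      \<bar>f n i\<bar> \<le> B L \<and> \<bar>f n (Suc i) - f n i\<bar> \<le> B L * h n"
    using bound by (intro choice) blast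
  then obtain B where B: "\<And>L n i. L \<le> real n \<Longrightarrow> n0 n \<le> i \<Longrightarrow> real i * h n \<le> L \<Longrightarrow>
      \<bar>f n i\<bar> \<le> B L \<and> \<bar>f n (Suc i) - f n i\<bar> \<le> B L * h n" by blast
  define q :: "nat \<Rightarrow> real" where "q = from_nat_into (\<rat> \<inter> {0..})"
  have range_q: "range q = \<rat> \<inter> {0..}"
    unfolding q_def using countable_rat by (intro range_from_nat_into) (auto intro: countable_Int1)
  then have q0: "0 \<le> q j" for j by (metis IntE atLeast_iff rangeI)
  \<comment> \<open>Values near the j-th rational. The margin 2 is the bound of
    \<open>idx_error\<close>; while the mesh is too coarse for the hypothesis to apply, 0 serves as
    a placeholder.\<close>
  define F where "F = (\<lambda>n j. if q j + 2 \<le> real n then f n (idx (q j) n) else 0)"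
  have F: "\<bar>F n j\<bar> \<le> \<bar>B (q j + 2)\<bar>" for n j
  proof (cases "q j + 2 \<le> real n")
    case True
    have "2 / real (Suc n) \<le> 2 / 1" by (intro divide_left_mono) auto
    then have "real (idx (q j) n) * h n \<le> q j + 2" using idx_error[OF q0, of j n] by linarith
    then show ?thesis using B[OF True idx_ge] True by (force simp: F_def)
  qed (simp add: F_def)
  \<comment> \<open>Each coordinate is rescaled to [0, 1] by its own bound, so that the product box
    is compact.\<close>
  define G where "G = (\<lambda>n j. (F n j / (1 + \<bar>B (q j + 2)\<bar>) + 1) / 2)"
  have G: "0 \<le> G n j \<and> G n j \<le> 1" for n j
  proof -
    have "\<bar>F n j / (1 + \<bar>B (q j + 2)\<bar>)\<bar> \<le> 1" using F[of n j] by (simp add: abs_divide)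
    then have "- 1 \<le> F n j / (1 + \<bar>B (q j + 2)\<bar>)" "F n j / (1 + \<bar>B (q j + 2)\<bar>) \<le> 1"
      unfolding abs_le_iff by linarith+
    then show ?thesis by (simp add: G_def)
  qed
  have "seq_compact {u :: nat \<Rightarrow> real. \<forall>i. 0 \<le> u i \<and> u i \<le> 1}"
    by (intro compact_imp_seq_compact compact_box_fun)
  then obtain g0 k where k: "strict_mono (k :: nat \<Rightarrow> nat)" and g0: "(G \<circ> k) \<longlonglongrightarrow> g0"
    unfolding seq_compact_def using G by (auto dest!: spec[of _ G])
  have Fconv: "\<exists>l. (\<lambda>n. F (k n) j) \<longlonglongrightarrow> l" for j
  proof -
    have "(\<lambda>n. (G \<circ> k) n j) \<longlonglongrightarrow> g0 j"
      by (rule continuous_on_tendsto_compose[OF continuous_on_product_coordinates[of j] g0]) auto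
    then have "(\<lambda>n. (2 * (G \<circ> k) n j - 1) * (1 + \<bar>B (q j + 2)\<bar>)) \<longlonglongrightarrow> (2 * g0 j - 1) * (1 + \<bar>B (q j + 2)\<bar>)"
      by (intro tendsto_intros)
    moreover have "(2 * (G \<circ> k) n j - 1) * (1 + \<bar>B (q j + 2)\<bar>) = F (k n) j" for n
    proof -
      have "1 + \<bar>B (q j + 2)\<bar> \<noteq> 0" by linarith
      then show ?thesis by (simp add: G_def field_simps)
    qed
    ultimately show ?thesis by (intro exI) (simp only:)
  qed
  interpret K: grid "n0 \<circ> k" "h \<circ> k" using k by (rule grid_subseq)
  have kn: "n \<le> k n" for n using k by (rule seq_suble)
  have Kidx: "K.idx r n = idx r (k n)" for r n by (simp add: K.idx_def idx_def)
  have lip: "\<bar>f (k n) i - f (k n) i'\<bar> \<le> B L * \<bar>real i * h (k n) - real i' * h (k n)\<bar>"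
    if "L \<le> real n" "n0 (k n) \<le> i" "n0 (k n) \<le> i'" "real i * h (k n) \<le> L" "real i' * h (k n) \<le> L" for L n i i'
  proof (rule lipschitz_chain[OF _ that(2-5)])
    fix i assume "n0 (k n) \<le> i" "real i * h (k n) \<le> L"
    then show "\<bar>f (k n) (Suc i) - f (k n) i\<bar> \<le> B L * h (k n)"
      using B[of L "k n" i] that(1) kn[of n] by auto
  qed
  \<comment> \<open>c may depend on e: it is the limit at a rational radius just to the right of r.
    The limit that does not depend on e is identified afterwards.\<close>
  have cauchy: "\<exists>c. \<exists>\<delta>>0. \<exists>n1. \<forall>n\<ge>n1. \<forall>i\<ge>n0 (k n). \<bar>real i * h (k n) - r\<bar> < \<delta> \<longrightarrow> \<bar>f (k n) i - c\<bar> < e"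
    if r: "0 \<le> r" and e: "0 < e" for r e
  proof -
    define L where "L = r + 4"
    define b where "b = \<bar>B L\<bar> + 1"
    have b: "0 < b" "B L \<le> b" by (auto simp: b_def)
    define \<delta> where "\<delta> = min 1 (e / (8 * b))"
    have \<delta>: "0 < \<delta>" "\<delta> \<le> 1" "b * \<delta> \<le> e / 8"
    proof -
      show "0 < \<delta>" "\<delta> \<le> 1" using e b by (auto simp: \<delta>_def)
      have "b * \<delta> \<le> b * (e / (8 * b))" using b by (intro mult_left_mono) (auto simp: \<delta>_def)
      then show "b * \<delta> \<le> e / 8" using b by simp
    qed
    obtain x where x: "x \<in> \<rat>" "r < x" "x < r + \<delta>" using Rats_dense_in_real[of r "r + \<delta>"] \<delta> by auto
    then have "x \<in> range q" using r range_q by auto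
    then obtain j where j: "q j = x" by auto
    obtain l where l: "(\<lambda>n. F (k n) j) \<longlonglongrightarrow> l" using Fconv by blast
    obtain n1 where n1: "\<And>n. n1 \<le> n \<Longrightarrow> \<bar>F (k n) j - l\<bar> < e / 4"
      using tendstoD[OF l, of "e/4"] e by (auto simp: dist_real_def eventually_sequentially)
    have "\<forall>\<^sub>F n in sequentially. \<bar>real (K.idx x n) * (h \<circ> k) n - x\<bar> < \<delta>"
      using tendstoD[OF K.tendsto_idx \<delta>(1), of x] x r by (simp add: dist_real_def)
    then obtain n2 where n2: "\<And>n. n2 \<le> n \<Longrightarrow> \<bar>real (idx x (k n)) * h (k n) - x\<bar> < \<delta>"
      by (auto simp: Kidx eventually_sequentially)
    obtain n3 :: nat where n3: "L \<le> real n3" using real_arch_simple by blast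
    show ?thesis
    proof (rule exI[of _ l], rule exI[of _ \<delta>], intro conjI exI[of _ "max n1 (max n2 n3)"] allI impI)
      fix n i assume n: "max n1 (max n2 n3) \<le> n" "n0 (k n) \<le> i" "\<bar>real i * h (k n) - r\<bar> < \<delta>"
      have Ln: "L \<le> real n" using n n3 by (simp add: order_trans[OF n3])
      have i1: "\<bar>real (idx x (k n)) * h (k n) - x\<bar> < \<delta>" using n2 n by simp
      have "\<bar>f (k n) i - f (k n) (idx x (k n))\<bar> \<le> B L * \<bar>real i * h (k n) - real (idx x (k n)) * h (k n)\<bar>"
        by (rule lip[OF Ln n(2) idx_ge]) (use n i1 x \<delta> in \<open>auto simp: L_def abs_less_iff\<close>)
      also have "\<dots> \<le> b * (3 * \<delta>)" using b n i1 x by (intro mult_mono) auto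
      also have "b * (3 * \<delta>) = 3 * (b * \<delta>)" by simp
      also have "\<dots> \<le> 3 * (e / 8)" using \<delta>(3) by linarith
      finally have "\<bar>f (k n) i - f (k n) (idx x (k n))\<bar> \<le> 3 * (e / 8)" .
      moreover have "F (k n) j = f (k n) (idx x (k n))"
      proof -
        have "real n \<le> real (k n)" using kn by simp
        then show ?thesis using Ln x \<delta> by (auto simp: F_def j L_def)
      qed
      moreover have "\<bar>F (k n) j - l\<bar> < e / 4" using n1 n by simp
      ultimately show "\<bar>f (k n) i - l\<bar> < e" using e by linarith
    qed (use \<delta> in auto)
  qed
  have cauchyE: thesis if "0 \<le> r" "0 < e" "\<And>c \<delta> n1. \<delta> > 0 \<Longrightarrow> (\<And>n i. n1 \<le> n \<Longrightarrow> n0 (k n) \<le> i \<Longrightarrow>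
      \<bar>real i * h (k n) - r\<bar> < \<delta> \<Longrightarrow> \<bar>f (k n) i - c\<bar> < e) \<Longrightarrow> thesis" for r e thesis
    using cauchy[OF that(1,2)] by (elim exE conjE) (rule that(3), auto)
  define g where "g = (\<lambda>r. lim (\<lambda>n. f (k n) (K.idx r n)))"
  have seqlim: "(\<lambda>n. f (k n) (K.idx r n)) \<longlonglongrightarrow> g r" if r: "0 \<le> r" for r
  proof -
    have "Cauchy (\<lambda>n. f (k n) (K.idx r n))"
    proof (rule metric_CauchyI)
      fix e :: real assume "0 < e"
      then have e: "0 < e / 2" by simp
      obtain c \<delta> n1 where c: "\<delta> > 0"
        "\<And>n i. n1 \<le> n \<Longrightarrow> n0 (k n) \<le> i \<Longrightarrow> \<bar>real i * h (k n) - r\<bar> < \<delta> \<Longrightarrow> \<bar>f (k n) i - c\<bar> < e / 2"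
        by (rule cauchyE[OF r e]) auto
      obtain n2 where n2: "\<And>n. n2 \<le> n \<Longrightarrow> \<bar>real (K.idx r n) * h (k n) - r\<bar> < \<delta>"
        using tendstoD[OF K.tendsto_idx[OF r] c(1)] by (auto simp: dist_real_def eventually_sequentially)
      have *: "\<bar>f (k n) (K.idx r n) - c\<bar> < e / 2" if "max n1 n2 \<le> n" for n
        using that c(2)[of n "K.idx r n"] n2[of n] K.idx_ge[of n r] by auto
      show "\<exists>M. \<forall>m\<ge>M. \<forall>n\<ge>M. dist (f (k m) (K.idx r m)) (f (k n) (K.idx r n)) < e"
      proof (intro exI[of _ "max n1 n2"] allI impI)
        fix m n assume "max n1 n2 \<le> m" "max n1 n2 \<le> n"
        then show "dist (f (k m) (K.idx r m)) (f (k n) (K.idx r n)) < e"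
          using *[of m] *[of n] unfolding dist_real_def by linarith
      qed
    qed
    then show ?thesis unfolding g_def by (simp add: real_Cauchy_convergent convergent_LIMSEQ_iff[symmetric])
  qed
  have conv: "((\<lambda>(n, i). f (k n) i) \<longlongrightarrow> g r) (grid_filter (n0 \<circ> k) (h \<circ> k) r)" if r: "0 \<le> r" for r
    unfolding tendsto_grid_filter_iff
  proof (intro allI impI)
    fix e :: real assume e: "0 < e"
    obtain c \<delta> n1 where c: "\<delta> > 0"
      "\<And>n i. n1 \<le> n \<Longrightarrow> n0 (k n) \<le> i \<Longrightarrow> \<bar>real i * h (k n) - r\<bar> < \<delta> \<Longrightarrow> \<bar>f (k n) i - c\<bar> < e / 3"
      by (rule cauchyE[OF r, of "e/3"]) (use e in auto)
    have "\<forall>\<^sub>F n in sequentially. \<bar>real (K.idx r n) * h (k n) - r\<bar> < \<delta>"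
      using tendstoD[OF K.tendsto_idx[OF r] c(1)] by (simp add: dist_real_def)
    then have "\<forall>\<^sub>F n in sequentially. norm (f (k n) (K.idx r n) - c) \<le> e / 3"
      using eventually_ge_at_top[of n1]
      by eventually_elim (use c(2) K.idx_ge in \<open>auto intro: less_imp_le\<close>)
    then have "norm (g r - c) \<le> e / 3"
      by (intro Lim_norm_ubound[OF _ tendsto_diff[OF seqlim[OF r] tendsto_const]]) auto
    then have gc: "\<bar>g r - c\<bar> \<le> e / 3" by simp
    show "\<exists>\<delta>>0. \<exists>n1. \<forall>n\<ge>n1. \<forall>i\<ge>(n0 \<circ> k) n. \<bar>real i * (h \<circ> k) n - r\<bar> < \<delta> \<longrightarrow> \<bar>f (k n) i - g r\<bar> < e"
    proof (intro exI[of _ \<delta>] conjI c(1) exI[of _ n1] allI impI)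
      fix n i assume "n1 \<le> n" "(n0 \<circ> k) n \<le> i" "\<bar>real i * (h \<circ> k) n - r\<bar> < \<delta>"
      then have "\<bar>f (k n) i - c\<bar> < e / 3" using c(2)[of n i] by simp
      then show "\<bar>f (k n) i - g r\<bar> < e" using gc e by linarith
    qed
  qed
  have glip: "\<exists>B. \<forall>r s. 0 \<le> r \<longrightarrow> r \<le> L \<longrightarrow> 0 \<le> s \<longrightarrow> s \<le> L \<longrightarrow> \<bar>g r - g s\<bar> \<le> B * \<bar>r - s\<bar>" for L
  proof (intro exI[of _ "B (L + 2)"] allI impI)
    fix r s assume rs: "0 \<le> r" "r \<le> L" "0 \<le> s" "s \<le> L"
    obtain n3 :: nat where n3: "L + 2 \<le> real n3" using real_arch_simple by blast
    have near: "real (K.idx t n) * h (k n) \<le> L + 2" if "0 \<le> t" "t \<le> L" for t n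
    proof -
      have "2 / real (Suc n) \<le> 2 / 1" by (intro divide_left_mono) auto
      then show ?thesis using K.idx_error[OF that(1), of n] that by auto
    qed
    have "\<bar>f (k n) (K.idx r n) - f (k n) (K.idx s n)\<bar>
        \<le> B (L + 2) * \<bar>real (K.idx r n) * (h \<circ> k) n - real (K.idx s n) * (h \<circ> k) n\<bar>" if n: "n3 \<le> n" for n
    proof -
      have "L + 2 \<le> real n" using n n3 by linarith
      from lip[OF this, of "K.idx r n" "K.idx s n"] near[of r n] near[of s n] rs
        K.idx_ge[of n r] K.idx_ge[of n s] show ?thesis by simp
    qed
    then have ev: "\<forall>\<^sub>F n in sequentially. \<bar>f (k n) (K.idx r n) - f (k n) (K.idx s n)\<bar>
        \<le> B (L + 2) * \<bar>real (K.idx r n) * (h \<circ> k) n - real (K.idx s n) * (h \<circ> k) n\<bar>"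
      by (auto simp: eventually_sequentially)
    show "\<bar>g r - g s\<bar> \<le> B (L + 2) * \<bar>r - s\<bar>"
      by (rule tendsto_le[OF _ _ _ ev])
        (use rs K.tendsto_idx in \<open>auto intro!: tendsto_intros seqlim\<close>)
  qed
  show ?thesis by (rule that[OF k conv glip])
qed

text \<open>Near \<open>r0\<close> and for fine meshes all difference quotients lie within e of Y,
  hence so do all secant slopes between nearby nodes, by summation, and those of X in the limit.
  Only the convergence of y at \<open>r0\<close> itself is involved.\<close>

theorem grid_limit_deriv:
  assumes r0: "0 < r0"
    and X: "\<And>r. 0 \<le> r \<Longrightarrow> ((\<lambda>(n, i). x n i) \<longlongrightarrow> (X r :: real)) (grid_filter n0 h r)"
    and Y: "((\<lambda>(n, i). y n i) \<longlongrightarrow> Y) (grid_filter n0 h r0)"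
    and eq: "\<forall>\<^sub>F (n, i) in grid_filter n0 h r0. x n (Suc i) = x n i + h n * y n i"
  shows "(X has_real_derivative Y) (at r0)"
proof -
  have "\<forall>\<^sub>F r in at r0. \<bar>(X r - X r0) / (r - r0) - Y\<bar> \<le> e" if e: "0 < e" for e
  proof -
    have "\<forall>\<^sub>F z in grid_filter n0 h r0. dist ((\<lambda>(n, i). y n i) z) Y < e" using tendstoD[OF Y e] .
    with eq have "\<forall>\<^sub>F z in grid_filter n0 h r0. case z of (n, i) \<Rightarrow> x n (Suc i) = x n i + h n * y n i \<and> \<bar>y n i - Y\<bar> < e"
      by eventually_elim (auto simp: dist_real_def)
    then obtain \<delta> n1 where \<delta>: "\<delta> > 0" and
      step: "\<And>n i. n1 \<le> n \<Longrightarrow> n0 n \<le> i \<Longrightarrow> \<bar>real i * h n - r0\<bar> < \<delta> \<Longrightarrow>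
         x n (Suc i) = x n i + h n * y n i \<and> \<bar>y n i - Y\<bar> < e"
      unfolding eventually_grid_filter by auto
    have chain: "\<bar>x n k - x n i - (real k * h n - real i * h n) * Y\<bar> \<le> e * (real k * h n - real i * h n)"
      if n: "n1 \<le> n" and i: "n0 n \<le> i" "i \<le> k" "\<bar>real i * h n - r0\<bar> < \<delta>" "\<bar>real k * h n - r0\<bar> < \<delta>" for n i k
      using i(2,4)
    proof (induction k rule: dec_induct)
      case (step k)
      have k: "real (Suc k) * h n = real k * h n + h n" by (simp add: algebra_simps)
      have "real i * h n \<le> real k * h n" using step h_pos[of n] by simp
      then have kd: "\<bar>real k * h n - r0\<bar> < \<delta>" using step.prems i(3) k h_pos[of n] by linarith
      then have s: "x n (Suc k) = x n k + h n * y n k" "\<bar>y n k - Y\<bar> < e"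
        using \<open>\<And>n i. n1 \<le> n \<Longrightarrow> n0 n \<le> i \<Longrightarrow> \<bar>real i * h n - r0\<bar> < \<delta> \<Longrightarrow>
         x n (Suc i) = x n i + h n * y n i \<and> \<bar>y n i - Y\<bar> < e\<close>[of n k] n i step by auto
      have IH: "\<bar>x n k - x n i - (real k * h n - real i * h n) * Y\<bar> \<le> e * (real k * h n - real i * h n)"
        using step.IH kd by simp
      have "\<bar>h n * (y n k - Y)\<bar> \<le> h n * e" using s(2) h_pos[of n] by (simp add: abs_mult)
      moreover have "x n (Suc k) - x n i - (real (Suc k) * h n - real i * h n) * Y
          = (x n k - x n i - (real k * h n - real i * h n) * Y) + h n * (y n k - Y)"
        unfolding k s(1) by (simp add: algebra_simps)
      ultimately show ?case using IH unfolding k by (simp add: algebra_simps)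
    qed simp
    have main: "\<bar>X r - X r0 - (r - r0) * Y\<bar> \<le> e * \<bar>r - r0\<bar>" if r: "0 < r" "\<bar>r - r0\<bar> < \<delta>" for r
    proof -
      have ev1: "\<forall>\<^sub>F n in sequentially. \<bar>real (idx t n) * h n - r0\<bar> < \<delta>" if "0 < t" "\<bar>t - r0\<bar> < \<delta>" for t
      proof -
        have "\<forall>\<^sub>F n in sequentially. \<bar>real (idx t n) * h n - t\<bar> < \<delta> - \<bar>t - r0\<bar>"
          using tendstoD[OF tendsto_idx, of t "\<delta> - \<bar>t - r0\<bar>"] that by (simp add: dist_real_def)
        then show ?thesis by eventually_elim linarith
      qed
      have ev1r0: "\<forall>\<^sub>F n in sequentially. \<bar>real (idx r0 n) * h n - r0\<bar> < \<delta>"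
        using ev1[of r0] r0 \<delta> by simp
      have ev: "\<forall>\<^sub>F n in sequentially. \<bar>x n (idx r n) - x n (idx r0 n) - (real (idx r n) * h n - real (idx r0 n) * h n) * Y\<bar>
          \<le> e * \<bar>real (idx r n) * h n - real (idx r0 n) * h n\<bar>"
        using ev1[OF r] ev1r0 eventually_ge_at_top[of n1]
      proof eventually_elim
        case (elim n)
        show ?case
        proof (cases "idx r0 n \<le> idx r n")
          case True
          then have "real (idx r0 n) * h n \<le> real (idx r n) * h n" using h_pos[of n] by simp
          then show ?thesis using chain[of n "idx r0 n" "idx r n"] True elim r0 \<delta> idx_ge[of n r0] by simp
        next
          case False
          then have "real (idx r n) * h n \<le> real (idx r0 n) * h n" using h_pos[of n] by simp
          then show ?thesis using chain[of n "idx r n" "idx r0 n"] False elim r0 \<delta> idx_ge[of n r]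
            by (simp add: algebra_simps abs_le_iff)
        qed
      qed
      show ?thesis
        by (rule tendsto_le[OF _ _ _ ev])
          (use r r0 in \<open>auto intro!: tendsto_intros tendsto_idx tendsto_grid_compose[OF X] eventuallyI idx_ge\<close>)
    qed
    have "\<forall>\<^sub>F r in at r0. \<bar>r - r0\<bar> < min \<delta> r0"
      unfolding eventually_at using \<delta> r0 by (intro exI[of _ "min \<delta> r0"]) (auto simp: dist_real_def)
    moreover have "\<forall>\<^sub>F r in at r0. r \<noteq> r0" by (simp add: eventually_at_filter)
    ultimately show ?thesis
    proof eventually_elim
      case (elim r)
      then have "\<bar>(X r - X r0 - (r - r0) * Y) / (r - r0)\<bar> \<le> e" using main[of r] by (auto simp: abs_divide divide_le_eq)
      then show ?case using elim by (simp add: diff_divide_distrib)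
    qed
  qed
  then have "((\<lambda>r. (X r - X r0) / (r - r0)) \<longlongrightarrow> Y) (at r0)"
  proof (intro tendstoI)
    fix e :: real assume "0 < e"
    then have "\<forall>\<^sub>F r in at r0. \<bar>(X r - X r0) / (r - r0) - Y\<bar> \<le> e / 2"
      using \<open>\<And>e. 0 < e \<Longrightarrow> \<forall>\<^sub>F r in at r0. \<bar>(X r - X r0) / (r - r0) - Y\<bar> \<le> e\<close>[of "e/2"] by simp
    then show "\<forall>\<^sub>F r in at r0. dist ((X r - X r0) / (r - r0)) Y < e"
      by eventually_elim (use \<open>0 < e\<close> in \<open>auto simp: dist_real_def\<close>)
  qed
  then show ?thesis by (simp add: has_field_derivative_iff)
qed

end

section \<open>The limit profile\<close>

context quasilinear
begin

text \<open>The order of choices matters: for each n the inner radius \<epsilon> is fixed before the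
  mesh width, which must be small compared with a power of \<epsilon> to make the jumps small
  outside that radius.\<close>

lemma mesh_estimates_exist:
  obtains M K \<rho> CP CA where "0 \<le> K" "\<And>n. \<exists>n0 m h u. mesh_estimates M K \<rho> CP CA n0 m h u \<and>
    h \<le> 1 / Suc n \<and> real n0 * h \<le> 1 / Suc n \<and> real n + 1 \<le> real m * h"
proof -
  obtain CA CE where ex: "\<And>n0 m h0. 1 \<le> n0 \<Longrightarrow> n0 \<le> m \<Longrightarrow> 0 < h0 \<Longrightarrow> h0 \<le> 1/8 \<Longrightarrow> real n0 * h0 \<le> 1/4 \<Longrightarrow>
    1 \<le> real m * h0 \<Longrightarrow> \<exists>h u. h0 < h \<and> h \<le> 2 * h0 \<and> discrete_solution CA CE n0 m h u"
    using discrete_solution_exists by blast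
  obtain M K \<rho> CP \<omega> where \<omega>: "0 < \<omega>" and K: "0 \<le> K" and
    est: "\<And>n0 m h u. discrete_solution CA CE n0 m h u \<Longrightarrow>
      \<forall>i. n0 < i \<longrightarrow> i \<le> Suc m \<longrightarrow> \<bar>u i - u (i - 1)\<bar> \<le> \<omega> \<Longrightarrow> mesh_estimates M K \<rho> CP CA n0 m h u"
    using uniform_estimates[of CA CE] by metis
  define A where "A = \<bar>CA\<bar> + 1"
  have A: "0 < A" "CA \<le> A" by (auto simp: A_def)
  have "\<exists>n0 m h u. mesh_estimates M K \<rho> CP CA n0 m h u \<and>
    h \<le> 1 / Suc n \<and> real n0 * h \<le> 1 / Suc n \<and> real n + 1 \<le> real m * h" for n
  proof -
    define \<epsilon> where "\<epsilon> = 1 / (4 * real (Suc n))"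
    have \<epsilon>: "0 < \<epsilon>" "\<epsilon> \<le> 1/4" "2 * \<epsilon> \<le> 1 / Suc n" by (auto simp: \<epsilon>_def field_simps)
    \<comment> \<open>The mesh width at which a jump of size \<omega> at radius \<epsilon> would
      exhaust the gradient bound A. The number k of nodes up to \<epsilon> is then chosen so that 2
      \<open>h0\<close>, the upper bound for h, stays below it.\<close>
    define t where "t = (\<omega> powr p * \<epsilon> ^ (N - 1) / A) powr (1 / (p - 1))"
    have t: "0 < t" "A * t powr (p - 1) = \<omega> powr p * \<epsilon> ^ (N - 1)"
      using \<omega> \<epsilon> A p1 by (auto simp: t_def powr_powr)
    obtain k :: nat where k: "max 2 (2 * \<epsilon> / t) \<le> real k" using real_arch_simple by blast
    then have k2: "2 \<le> real k" "2 * \<epsilon> / t \<le> real k" by auto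
    define h0 where "h0 = \<epsilon> / real k"
    have h0: "0 < h0" "real k * h0 = \<epsilon>" "2 * h0 \<le> t" using \<epsilon> k2 t by (auto simp: h0_def field_simps)
    have "2 * h0 \<le> real k * h0" using k2 h0 by (intro mult_right_mono) auto
    then have h0': "2 * h0 \<le> \<epsilon>" using h0 by simp
    define m where "m = nat \<lceil>(real n + 1) / h0\<rceil> + k"
    have "(real n + 1) / h0 \<le> real m" unfolding m_def by linarith
    then have m: "real n + 1 \<le> real m * h0" using h0 by (simp add: pos_divide_le_eq)
    have k1: "1 \<le> k" "k \<le> m" using k2 by (auto simp: m_def)
    obtain h u where hu: "h0 < h" "h \<le> 2 * h0" "discrete_solution CA CE k m h u"
      using ex[of k m h0] k1 h0 h0' \<epsilon> m by auto
    interpret mesh N p q \<alpha>\<^sub>0 R j js jt \<alpha> \<beta> k m using k1 by (rule mesh_axiomsI)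
    have h: "0 < h" using hu h0 by simp
    have CA: "h ^ N * (\<Sum>i=k..Suc m. real i ^ (N - 1) * \<bar>slope h u i\<bar> powr p) \<le> CA"
      using hu(3) by (auto simp: discrete_solution_def)
    \<comment> \<open>A single term of the gradient sum, at radius at least \<epsilon>, already
      bounds the p-th power of the jump.\<close>
    have jump: "\<bar>u i - u (i - 1)\<bar> \<le> \<omega>" if i: "k < i" "i \<le> Suc m" for i
    proof (rule ccontr)
      define s where "s = \<bar>slope h u i\<bar>"
      assume "\<not> \<bar>u i - u (i - 1)\<bar> \<le> \<omega>"
      moreover have "\<bar>u i - u (i - 1)\<bar> = h * s" using i h by (simp add: s_def slope_def abs_divide)
      ultimately have "\<omega> < h * s" by simp
      then have lt: "\<omega> powr p < (h * s) powr p" using \<omega> p1 by (intro powr_less_mono2) auto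
      have "real i ^ (N - 1) * s powr p \<le> (\<Sum>i=k..Suc m. real i ^ (N - 1) * \<bar>slope h u i\<bar> powr p)"
        unfolding s_def using i by (intro member_le_sum) auto
      then have "h ^ N * (real i ^ (N - 1) * s powr p) \<le> h ^ N * (\<Sum>i=k..Suc m. real i ^ (N - 1) * \<bar>slope h u i\<bar> powr p)"
        using h by (intro mult_left_mono) auto
      then have "h ^ N * (real i ^ (N - 1) * s powr p) \<le> A" using CA A by linarith
      moreover have "h ^ N * (real i ^ (N - 1) * s powr p) = (real i * h) ^ (N - 1) * (h * s powr p)"
        using N2 by (simp add: power_mult_distrib power_eq_if[of h N])
      moreover have "\<epsilon> ^ (N - 1) * (h * s powr p) \<le> (real i * h) ^ (N - 1) * (h * s powr p)"
      proof (intro mult_right_mono power_mono)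
        have "real k * h0 \<le> real i * h" using i hu(1) h0 by (intro mult_mono) auto
        then show "\<epsilon> \<le> real i * h" using h0 by simp
      qed (use \<epsilon> h in auto)
      ultimately have "\<epsilon> ^ (N - 1) * (h * s powr p) \<le> A" by linarith
      then have "h powr (p - 1) * (\<epsilon> ^ (N - 1) * (h * s powr p)) \<le> h powr (p - 1) * A"
        by (intro mult_left_mono) auto
      also have "h powr (p - 1) * (\<epsilon> ^ (N - 1) * (h * s powr p)) = \<epsilon> ^ (N - 1) * (h * s) powr p"
        using h by (simp add: powr_mult powr_diff s_def)
      also have "h powr (p - 1) * A \<le> t powr (p - 1) * A"
        using h hu h0 A p1 by (intro mult_right_mono powr_mono2) auto
      also have "\<dots> = \<epsilon> ^ (N - 1) * \<omega> powr p" using t by (simp add: mult.commute)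
      finally have "(h * s) powr p \<le> \<omega> powr p" using \<epsilon> by simp
      then show False using lt by simp
    qed
    have "mesh_estimates M K \<rho> CP CA k m h u"
      using est[OF hu(3)] jump by blast
    moreover have "h \<le> 1 / Suc n" using hu h0' \<epsilon> by linarith
    moreover have "real k * h \<le> real k * (2 * h0)" using hu by (intro mult_left_mono) auto
    then have "real k * h \<le> 1 / Suc n" using h0 \<epsilon> by simp
    moreover have "real m * h0 \<le> real m * h" using hu by (intro mult_left_mono) auto
    then have "real n + 1 \<le> real m * h" using m by linarith
    ultimately show ?thesis by blast
  qed
  then show ?thesis using that K by blast
qed

text \<open>Continuity of the inverse of \<open>Jt\<close>, jointly with its first argument. Strict
  monotonicity locates \<open>d x\<close> between \<open>d0 - e\<close> and \<open>d0 + e\<close>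
  once the fluxes at these two slopes lie on either side.\<close>

lemma Jt_inverse_tendsto:
  assumes s: "(s \<longlongrightarrow> s0) G" and y: "((\<lambda>x. Jt (s x) (d x)) \<longlongrightarrow> Jt s0 d0) G"
  shows "(d \<longlongrightarrow> d0) G"
proof (rule tendstoI)
  fix e :: real assume e: "0 < e"
  have lo: "((\<lambda>x. Jt (s x) (d x) - Jt (s x) (d0 - e)) \<longlongrightarrow> Jt s0 d0 - Jt s0 (d0 - e)) G"
    and hi: "((\<lambda>x. Jt (s x) (d0 + e) - Jt (s x) (d x)) \<longlongrightarrow> Jt s0 (d0 + e) - Jt s0 d0) G"
    by (intro tendsto_intros s y)+
  have "\<forall>\<^sub>F x in G. 0 < Jt (s x) (d x) - Jt (s x) (d0 - e)"
    using e by (intro order_tendstoD(1)[OF lo]) simp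
  moreover have "\<forall>\<^sub>F x in G. 0 < Jt (s x) (d0 + e) - Jt (s x) (d x)"
    using e by (intro order_tendstoD(1)[OF hi]) simp
  ultimately show "\<forall>\<^sub>F x in G. dist (d x) d0 < e"
    by eventually_elim (simp add: dist_real_def abs_less_iff)
qed

lemma F'_le:
  assumes "0 \<le> s" "s \<le> M"
  shows "\<bar>F' s\<bar> \<le> M powr (p - 1) + M powr (q - 1)"
    and "\<bar>F' s\<bar> \<le> (1 + M powr (q - p)) * s powr (p - 1)"
proof -
  have *: "\<bar>F' s\<bar> \<le> s powr (p - 1) + s powr (q - 1)"
    using assms by (auto simp: F'_def sgn_if abs_le_iff add_increasing)
  have "s powr (p - 1) \<le> M powr (p - 1)" "s powr (q - 1) \<le> M powr (q - 1)"
    using assms p1 pq by (auto intro!: powr_mono2)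
  then show "\<bar>F' s\<bar> \<le> M powr (p - 1) + M powr (q - 1)" using * by linarith
  have "s powr (q - 1) = s powr (q - p) * s powr (p - 1)" by (simp flip: powr_add)
  also have "\<dots> \<le> M powr (q - p) * s powr (p - 1)"
    using assms pq by (intro mult_right_mono powr_mono2) auto
  finally show "\<bar>F' s\<bar> \<le> (1 + M powr (q - p)) * s powr (p - 1)" using * by (simp add: distrib_right)
qed

lemma Jt_bound_imp:
  assumes "\<bar>Jt s d\<bar> \<le> y"
  shows "\<bar>d\<bar> \<le> (y / \<alpha>\<^sub>0) powr (1 / (p - 1))"
proof -
  have "\<bar>d\<bar> powr (p - 1) \<le> y / \<alpha>\<^sub>0" using Jt_lower[of d s] assms \<alpha>0 by (simp add: field_simps)
  then have "(\<bar>d\<bar> powr (p - 1)) powr (1 / (p - 1)) \<le> (y / \<alpha>\<^sub>0) powr (1 / (p - 1))"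
    using p1 by (intro powr_mono2) auto
  then show ?thesis using p1 by (simp add: powr_powr)
qed

end

locale approximating_sequence = quasilinear + grid +
  fixes m :: "nat \<Rightarrow> nat" and u :: "nat \<Rightarrow> nat \<Rightarrow> real" and M K \<rho> CP CA :: real
  assumes approx: "\<And>n. mesh_estimates M K \<rho> CP CA (n0 n) (m n) (h n) (u n)"
    and K0: "0 \<le> K" and m_large: "\<And>n. real n + 1 \<le> real (m n) * h n"
begin

definition d :: "nat \<Rightarrow> nat \<Rightarrow> real" where "d n = mesh.slope (n0 n) (h n) (u n)"
text \<open>The scaling replaces the weight by the power N - 1 of the radius, so that the flux has a
  limit as the mesh is refined.\<close>

definition w :: "nat \<Rightarrow> nat \<Rightarrow> real" where "w n i = h n ^ (N - 1) * mesh.flux N jt (n0 n) (h n) (u n) i"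

lemma mesh_n: "mesh N p q \<alpha>\<^sub>0 R j js jt \<alpha> \<beta> (n0 n) (m n)"
  using approx[of n] by (intro mesh_axiomsI) (auto simp: mesh_estimates_def)

lemma u_bounds: "0 \<le> u n i" "u n i \<le> M"
  using approx[of n] by (auto simp: mesh_estimates_def)

lemma u_Suc: "n0 n \<le> i \<Longrightarrow> u n (Suc i) = u n i + h n * d n (Suc i)"
  using h_pos[of n] by (simp add: d_def mesh.slope_def[OF mesh_n])

lemma w_eq: "w n i = (real i * h n) ^ (N - 1) * Jt (u n i) (d n i)"
  by (simp add: w_def d_def mesh.flux_def[OF mesh_n] power_mult_distrib mult_ac)

lemma w_Suc:
  assumes "n0 n \<le> i" "i \<le> m n"
  shows "w n (Suc i) = w n i + h n * ((real i * h n) ^ (N - 1) * (Js (u n i) (d n i) + F' (u n i)))"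
proof -
  have "mesh.flux N jt (n0 n) (h n) (u n) (Suc i) = mesh.flux N jt (n0 n) (h n) (u n) i
      + h n * (real i ^ (N - 1) * (Js (u n i) (d n i) + F' (u n i)))"
    using approx[of n] assms by (auto simp: mesh_estimates_def d_def)
  then show ?thesis by (simp add: w_def power_mult_distrib algebra_simps)
qed

lemma w_bound:
  assumes "n0 n \<le> i" "i \<le> Suc (m n)"
  shows "\<bar>w n i\<bar> \<le> K * (real i * h n) ^ N"
proof -
  have "\<bar>mesh.flux N jt (n0 n) (h n) (u n) i\<bar> \<le> K * (h n * real i ^ N)"
    using approx[of n] assms by (auto simp: mesh_estimates_def)
  then have "h n ^ (N - 1) * \<bar>mesh.flux N jt (n0 n) (h n) (u n) i\<bar> \<le> h n ^ (N - 1) * (K * (h n * real i ^ N))"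
    using h_pos[of n] by (intro mult_left_mono) auto
  also have "\<dots> = K * (real i * h n) ^ N"
    using N2 by (simp add: power_mult_distrib power_eq_if[of "h n" N])
  finally show ?thesis using h_pos[of n] by (simp add: w_def abs_mult)
qed

text \<open>A flux of order r to the power N, divided by its weight, leaves \<open>Jt\<close> of
  order r. The slope therefore vanishes at the origin, uniformly in the mesh.\<close>

lemma d_bound:
  assumes "n0 n \<le> i" "i \<le> Suc (m n)"
  shows "\<bar>d n i\<bar> \<le> (K * (real i * h n) / \<alpha>\<^sub>0) powr (1 / (p - 1))"
proof (rule Jt_bound_imp)
  have i: "1 \<le> i" using approx[of n] assms by (auto simp: mesh_estimates_def)
  then have pos: "0 < real i * h n" using h_pos[of n] by simp
  have "(real i * h n) ^ (N - 1) * \<bar>Jt (u n i) (d n i)\<bar> \<le> K * (real i * h n) ^ N"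
    using w_bound[OF assms] pos by (simp add: w_eq abs_mult)
  also have "\<dots> = (real i * h n) ^ (N - 1) * (K * (real i * h n))" using N2 by (simp add: power_eq_if[of _ N])
  finally show "\<bar>Jt (u n i) (d n i)\<bar> \<le> K * (real i * h n)"
    using pos by (meson mult_le_cancel_left_pos zero_less_power)
qed

lemma le_m: "n0 n \<le> i \<Longrightarrow> L \<le> real n \<Longrightarrow> real i * h n \<le> L \<Longrightarrow> i \<le> m n"
proof (rule ccontr)
  assume "L \<le> real n" "real i * h n \<le> L" "\<not> i \<le> m n"
  then have "real (m n) * h n \<le> real i * h n" using h_pos[of n] by (intro mult_right_mono) auto
  then show False using m_large[of n] \<open>L \<le> real n\<close> \<open>real i * h n \<le> L\<close> by linarith
qed

lemma u_w_lipschitz: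
  obtains B where "\<And>n i. L \<le> real n \<Longrightarrow> n0 n \<le> i \<Longrightarrow> real i * h n \<le> L \<Longrightarrow>
    \<bar>u n i\<bar> \<le> B \<and> \<bar>u n (Suc i) - u n i\<bar> \<le> B * h n \<and> \<bar>w n i\<bar> \<le> B \<and> \<bar>w n (Suc i) - w n i\<bar> \<le> B * h n"
proof -
  define D where "D = (K * (\<bar>L\<bar> + 1) / \<alpha>\<^sub>0) powr (1 / (p - 1))"
  define B1 where "B1 = \<bar>L\<bar> ^ (N - 1) * (\<beta> M * D powr p + (M powr (p - 1) + M powr (q - 1)))"
  define B2 where "B2 = K * \<bar>L\<bar> ^ N"
  have B0: "0 \<le> D" "0 \<le> B1" "0 \<le> B2" "0 \<le> M"
    using K0 \<beta>_pos[of M] u_bounds[of 0 0] by (auto simp: D_def B1_def B2_def less_imp_le)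
  show ?thesis
  proof (rule that[of "M + D + B1 + B2"])
    fix n i assume n: "L \<le> real n" "n0 n \<le> i" "real i * h n \<le> L"
    have im: "i \<le> m n" using le_m n by blast
    have ih0: "0 \<le> real i * h n" using h_pos[of n] by simp
    have ih: "real i * h n \<le> \<bar>L\<bar>" "real (Suc i) * h n \<le> \<bar>L\<bar> + 1"
    proof -
      have "h n \<le> 1" using h_small[of n] by (rule order_trans) (simp add: divide_simps)
      then show "real i * h n \<le> \<bar>L\<bar>" "real (Suc i) * h n \<le> \<bar>L\<bar> + 1" using n(3) by (auto simp: distrib_right)
    qed
    have dD: "\<bar>d n k\<bar> \<le> D" if "n0 n \<le> k" "k \<le> Suc (m n)" "real k * h n \<le> \<bar>L\<bar> + 1" for k
    proof -
      have "(K * (real k * h n) / \<alpha>\<^sub>0) powr (1 / (p - 1)) \<le> D"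
        unfolding D_def using that K0 \<alpha>0 p1 h_pos[of n]
        by (intro powr_mono2 divide_right_mono mult_left_mono) (auto simp: less_imp_le)
      then show ?thesis using d_bound[OF that(1,2)] by linarith
    qed
    have "\<bar>u n (Suc i) - u n i\<bar> = \<bar>d n (Suc i)\<bar> * h n"
      using u_Suc[OF n(2)] h_pos[of n] by (simp add: abs_mult)
    also have "\<dots> \<le> D * h n" using dD[of "Suc i"] n im ih h_pos[of n] by (intro mult_right_mono) auto
    finally have 1: "\<bar>u n (Suc i) - u n i\<bar> \<le> D * h n" .
    have "\<bar>w n i\<bar> \<le> K * (real i * h n) ^ N" using w_bound n im by simp
    also have "\<dots> \<le> B2" unfolding B2_def using ih ih0 K0 by (intro mult_left_mono power_mono) auto
    finally have 2: "\<bar>w n i\<bar> \<le> B2" .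
    have "\<bar>Js (u n i) (d n i)\<bar> \<le> \<beta> \<bar>u n i\<bar> * \<bar>d n i\<bar> powr p" by (rule Js_bound)
    also have "\<dots> \<le> \<beta> M * D powr p"
      using u_bounds[of n i] dD[of i] n im ih p1 \<beta>_pos[of M]
      by (intro mult_mono powr_mono2 monoD[OF \<beta>_mono]) (auto simp: less_imp_le)
    finally have "\<bar>Js (u n i) (d n i) + F' (u n i)\<bar> \<le> \<beta> M * D powr p + (M powr (p - 1) + M powr (q - 1))"
      using F'_le(1)[OF u_bounds[of n i]] by linarith
    then have "(real i * h n) ^ (N - 1) * \<bar>Js (u n i) (d n i) + F' (u n i)\<bar> \<le> B1"
      unfolding B1_def using ih ih0 by (intro mult_mono power_mono) auto
    then have "h n * ((real i * h n) ^ (N - 1) * \<bar>Js (u n i) (d n i) + F' (u n i)\<bar>) \<le> h n * B1"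
      using h_pos[of n] by (intro mult_left_mono) auto
    then have 3: "\<bar>w n (Suc i) - w n i\<bar> \<le> B1 * h n"
      using w_Suc[OF n(2) im] h_pos[of n] ih0 by (simp add: abs_mult mult.commute)
    have 4: "D * h n \<le> (M + D + B1 + B2) * h n" "B1 * h n \<le> (M + D + B1 + B2) * h n"
      using B0 h_pos[of n] by (auto intro!: mult_right_mono)
    show "\<bar>u n i\<bar> \<le> M + D + B1 + B2 \<and> \<bar>u n (Suc i) - u n i\<bar> \<le> (M + D + B1 + B2) * h n \<and>
        \<bar>w n i\<bar> \<le> M + D + B1 + B2 \<and> \<bar>w n (Suc i) - w n i\<bar> \<le> (M + D + B1 + B2) * h n"
      using 1 2 3 4 B0 u_bounds[of n i] by auto
  qed
qed

lemma approximating_subseq: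
  assumes "strict_mono k"
  shows "approximating_sequence N p q \<alpha>\<^sub>0 R j js jt \<alpha> \<beta> (n0 \<circ> k) (h \<circ> k) (m \<circ> k) (u \<circ> k) M K \<rho> CP CA"
proof (intro approximating_sequence.intro approximating_sequence_axioms.intro quasilinear_axioms grid_subseq assms K0)
  fix n
  show "mesh_estimates M K \<rho> CP CA ((n0 \<circ> k) n) ((m \<circ> k) n) ((h \<circ> k) n) ((u \<circ> k) n)" using approx by simp
  have "real n \<le> real (k n)" using seq_suble[OF assms, of n] by simp
  then show "real n + 1 \<le> real ((m \<circ> k) n) * (h \<circ> k) n" using m_large[of "k n"] by simp
qed

end

locale limit_profile = approximating_sequence +
  fixes U W :: "real \<Rightarrow> real"
  assumes u_lim: "\<And>r. 0 \<le> r \<Longrightarrow> ((\<lambda>(n, i). u n i) \<longlongrightarrow> U r) (grid_filter n0 h r)"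
    and w_lim: "\<And>r. 0 \<le> r \<Longrightarrow> ((\<lambda>(n, i). w n i) \<longlongrightarrow> W r) (grid_filter n0 h r)"
    and U_lip: "\<And>L. \<exists>B. \<forall>r s. 0 \<le> r \<longrightarrow> r \<le> L \<longrightarrow> 0 \<le> s \<longrightarrow> s \<le> L \<longrightarrow> \<bar>U r - U s\<bar> \<le> B * \<bar>r - s\<bar>"
begin

text \<open>Defined by inverting the limit flux, not as a derivative: the slopes are not known to
  converge in advance. Strict monotonicity makes the value unique, and \<open>U_deriv\<close>
  identifies it as the derivative of U.\<close>

definition V :: "real \<Rightarrow> real" where
  "V r = (SOME v. Jt (U r) v = W r / r ^ (N - 1))"

lemma Jt_V: "Jt (U r) (V r) = W r / r ^ (N - 1)"
  unfolding V_def by (rule someI_ex) (metis Jt_inverse)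

lemma W_eq: "0 < r \<Longrightarrow> W r = r ^ (N - 1) * Jt (U r) (V r)"
  by (simp add: Jt_V)

lemma eventually_inner:
  assumes "0 < r"
  shows "\<forall>\<^sub>F (n, i) in grid_filter n0 h r. n0 n \<le> i \<and> i \<le> m n \<and> 0 < real i * h n"
proof -
  obtain n1 :: nat where n1: "r + 1 \<le> real n1" using real_arch_simple by blast
  show ?thesis unfolding eventually_grid_filter
  proof (intro exI[of _ "min 1 r"] conjI exI[of _ n1] allI impI)
    fix n i assume n: "n1 \<le> n" "n0 n \<le> i" "\<bar>real i * h n - r\<bar> < min 1 r"
    then have "i \<le> m n" using n1 by (intro le_m[of n i "r + 1"]) auto
    then show "case (n, i) of (n, i) \<Rightarrow> n0 n \<le> i \<and> i \<le> m n \<and> 0 < real i * h n" using n by auto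
  qed (use assms in auto)
qed

lemma d_lim:
  assumes r: "0 < r"
  shows "((\<lambda>(n, i). d n i) \<longlongrightarrow> V r) (grid_filter n0 h r)"
proof (rule Jt_inverse_tendsto)
  show "((\<lambda>(n, i). u n i) \<longlongrightarrow> U r) (grid_filter n0 h r)" using u_lim r by simp
  have "((\<lambda>z. (\<lambda>(n, i). w n i) z / ((\<lambda>(n, i). real i * h n) z) ^ (N - 1)) \<longlongrightarrow> W r / r ^ (N - 1)) (grid_filter n0 h r)"
    using r by (intro tendsto_intros w_lim tendsto_grid_point) auto
  moreover have "\<forall>\<^sub>F z in grid_filter n0 h r. (\<lambda>(n, i). w n i) z / ((\<lambda>(n, i). real i * h n) z) ^ (N - 1)
      = Jt ((\<lambda>(n, i). u n i) z) ((\<lambda>(n, i). d n i) z)"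
    using eventually_inner[OF r] by eventually_elim (auto simp: w_eq)
  ultimately show "((\<lambda>z. Jt ((\<lambda>(n, i). u n i) z) ((\<lambda>(n, i). d n i) z)) \<longlongrightarrow> Jt (U r) (V r)) (grid_filter n0 h r)"
    unfolding Jt_V by (rule Lim_transform_eventually)
qed

lemma U_deriv: "0 < r \<Longrightarrow> (U has_real_derivative V r) (at r)"
proof (rule grid_limit_deriv[OF _ u_lim])
  assume r: "0 < r"
  show "((\<lambda>(n, i). d n (Suc i)) \<longlongrightarrow> V r) (grid_filter n0 h r)" by (rule tendsto_grid_shift[OF d_lim[OF r]])
  show "\<forall>\<^sub>F (n, i) in grid_filter n0 h r. u n (Suc i) = u n i + h n * d n (Suc i)"
    using eventually_inner[OF r] by eventually_elim (auto simp: u_Suc)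
qed

lemma W_deriv: "0 < r \<Longrightarrow> (W has_real_derivative r ^ (N - 1) * (Js (U r) (V r) + F' (U r))) (at r)"
proof (rule grid_limit_deriv[OF _ w_lim])
  assume r: "0 < r"
  have F'c: "isCont F' x" for x
    using continuous_on_F'[of UNIV "\<lambda>x. x"] by (simp add: continuous_on_eq_continuous_at)
  have "((\<lambda>z. ((\<lambda>(n, i). real i * h n) z) ^ (N - 1) * (Js ((\<lambda>(n, i). u n i) z) ((\<lambda>(n, i). d n i) z) + F' ((\<lambda>(n, i). u n i) z)))
     \<longlongrightarrow> r ^ (N - 1) * (Js (U r) (V r) + F' (U r))) (grid_filter n0 h r)"
    using r by (intro tendsto_intros tendsto_grid_point u_lim d_lim isCont_tendsto_compose[OF F'c]) auto
  then show "((\<lambda>(n, i). (real i * h n) ^ (N - 1) * (Js (u n i) (d n i) + F' (u n i)))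
     \<longlongrightarrow> r ^ (N - 1) * (Js (U r) (V r) + F' (U r))) (grid_filter n0 h r)"
    by (simp add: case_prod_unfold)
  show "\<forall>\<^sub>F (n, i) in grid_filter n0 h r. w n (Suc i) = w n i
      + h n * ((real i * h n) ^ (N - 1) * (Js (u n i) (d n i) + F' (u n i)))"
    using eventually_inner[OF r] by eventually_elim (auto simp: w_Suc)
qed

section \<open>Bounds, continuity and positivity of the limit profile\<close>

lemma U_bounds:
  assumes "0 \<le> r"
  shows "0 \<le> U r" "U r \<le> M"
  using tendsto_lowerbound[OF u_lim[OF assms] _ grid_filter_nontrivial[OF assms], of 0]
    tendsto_upperbound[OF u_lim[OF assms] _ grid_filter_nontrivial[OF assms], of M] u_bounds
  by (auto simp: case_prod_unfold)

lemma W_bound: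
  assumes r: "0 < r"
  shows "\<bar>W r\<bar> \<le> K * r ^ N"
proof (rule tendsto_le)
  show "((\<lambda>z. K * ((\<lambda>(n, i). real i * h n) z) ^ N) \<longlongrightarrow> K * r ^ N) (grid_filter n0 h r)"
    by (intro tendsto_intros tendsto_grid_point)
  show "((\<lambda>z. \<bar>(\<lambda>(n, i). w n i) z\<bar>) \<longlongrightarrow> \<bar>W r\<bar>) (grid_filter n0 h r)"
    using r by (intro tendsto_intros w_lim) auto
  show "\<forall>\<^sub>F z in grid_filter n0 h r. \<bar>(\<lambda>(n, i). w n i) z\<bar> \<le> K * ((\<lambda>(n, i). real i * h n) z) ^ N"
    using eventually_inner[OF r] by eventually_elim (auto simp: w_bound)
  show "grid_filter n0 h r \<noteq> bot" using r by (intro grid_filter_nontrivial) auto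
qed

lemma V_bound:
  assumes r: "0 < r"
  shows "\<bar>V r\<bar> \<le> (K * r / \<alpha>\<^sub>0) powr (1 / (p - 1))"
proof (rule Jt_bound_imp[of "U r"])
  have "r ^ N = r * r ^ (N - 1)" using N2 by (simp add: power_eq_if[of r N])
  then show "\<bar>Jt (U r) (V r)\<bar> \<le> K * r"
    using W_bound[OF r] r by (simp add: Jt_V abs_divide divide_le_eq)
qed

lemma isCont_W: "0 < r \<Longrightarrow> isCont W r" and isCont_U: "0 < r \<Longrightarrow> isCont U r"
  using W_deriv U_deriv DERIV_isCont by blast+

lemma isCont_V:
  assumes r: "0 < r"
  shows "isCont V r"
  unfolding isCont_def
proof (rule Jt_inverse_tendsto)
  show "(U \<longlongrightarrow> U r) (at r)" using isCont_U[OF r] by (simp add: isCont_def)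
  show "((\<lambda>x. Jt (U x) (V x)) \<longlongrightarrow> Jt (U r) (V r)) (at r)"
    unfolding Jt_V using isCont_W[OF r] r by (intro tendsto_intros) (auto simp: isCont_def)
qed

lemma U_continuous_on: "continuous_on {0..} U"
  unfolding continuous_on_eq_continuous_within continuous_within_eps_delta
proof (intro ballI allI impI)
  fix x e :: real assume x: "x \<in> {0..}" and e: "0 < e"
  obtain B where B: "\<And>r s. 0 \<le> r \<Longrightarrow> r \<le> x + 1 \<Longrightarrow> 0 \<le> s \<Longrightarrow> s \<le> x + 1 \<Longrightarrow> \<bar>U r - U s\<bar> \<le> B * \<bar>r - s\<bar>"
    using U_lip[of "x + 1"] by blast
  show "\<exists>\<delta>>0. \<forall>x'\<in>{0..}. dist x' x < \<delta> \<longrightarrow> dist (U x') (U x) < e"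
  proof (intro exI[of _ "min 1 (e / (\<bar>B\<bar> + 1))"] conjI ballI impI)
    fix y assume y: "y \<in> {0..}" "dist y x < min 1 (e / (\<bar>B\<bar> + 1))"
    then have "\<bar>U y - U x\<bar> \<le> B * \<bar>y - x\<bar>" using x by (intro B) (auto simp: dist_real_def)
    also have "\<dots> \<le> (\<bar>B\<bar> + 1) * \<bar>y - x\<bar>" by (intro mult_right_mono) auto
    also have "\<dots> < (\<bar>B\<bar> + 1) * (e / (\<bar>B\<bar> + 1))" using y by (intro mult_strict_left_mono) (auto simp: dist_real_def)
    also have "\<dots> = e" by (simp add: add_nonneg_eq_0_iff)
    finally show "dist (U y) (U x) < e" by (simp add: dist_real_def)
  qed (use e in auto)
qed

text \<open>The radii with node value at least 1 stay in [0, \<rho>] and accumulate; convergence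
  along arbitrary nodes applies to the moving ones. The limit radius may be 0.\<close>

lemma U_ge_1:
  obtains r where "0 \<le> r" "1 \<le> U r"
proof -
  have "\<exists>i. n0 n \<le> i \<and> 1 \<le> u n i \<and> real i * h n \<le> \<rho>" for n using approx[of n] by (auto simp: mesh_estimates_def)
  then obtain i where i: "\<And>n. n0 n \<le> i n" "\<And>n. 1 \<le> u n (i n)" "\<And>n. real (i n) * h n \<le> \<rho>" by metis
  have "seq_compact {0..\<rho>}" by (intro compact_imp_seq_compact compact_Icc)
  moreover have "\<forall>n. real (i n) * h n \<in> {0..\<rho>}" using i(3) h_pos by (auto intro!: mult_nonneg_nonneg simp: less_imp_le)
  ultimately obtain r k where r: "r \<in> {0..\<rho>}" "strict_mono (k :: nat \<Rightarrow> nat)" "((\<lambda>n. real (i n) * h n) \<circ> k) \<longlonglongrightarrow> r"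
    by (rule seq_compactE)
  have "1 \<le> U r + e" if e: "0 < e" for e
  proof -
    have r0: "0 \<le> r" using r by simp
    obtain \<delta> n1 where \<delta>: "\<delta> > 0" "\<And>n i. n1 \<le> n \<Longrightarrow> n0 n \<le> i \<Longrightarrow> \<bar>real i * h n - r\<bar> < \<delta> \<Longrightarrow> \<bar>u n i - U r\<bar> < e"
      using tendsto_grid_filterE[OF u_lim[OF r0] e] by metis
    obtain n2 where n2: "\<And>n. n2 \<le> n \<Longrightarrow> \<bar>real (i (k n)) * h (k n) - r\<bar> < \<delta>"
      using tendstoD[OF r(3) \<delta>(1)] by (auto simp: dist_real_def eventually_sequentially)
    define n where "n = max n1 n2"
    have "n \<le> k n" using r(2) by (rule seq_suble)
    then have "\<bar>u (k n) (i (k n)) - U r\<bar> < e"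
      using n2[of n] i(1) by (intro \<delta>(2)) (auto simp: n_def)
    then show ?thesis using i(2)[of "k n"] by linarith
  qed
  then have "1 \<le> U r" by (rule field_le_epsilon)
  then show ?thesis using that[of r] r by simp
qed

text \<open>At a zero the pair \<open>(U, W)\<close> vanishes, and \<open>\<bar>W'\<bar> \<le> C (\<bar>W\<bar> + U powr (p - 1))\<close> together with
  \<open>\<bar>U'\<bar> powr (p - 1) \<le> C \<bar>W\<bar>\<close> gives local uniqueness of the trivial solution.\<close>

lemma U_zero_open:
  assumes r0: "0 < r0" and zero: "U r0 = 0"
  obtains \<delta> where "0 < \<delta>" "\<And>r. \<bar>r - r0\<bar> < \<delta> \<Longrightarrow> U r = 0"
proof -
  define a where "a = r0 / 2"
  define b where "b = 2 * r0"
  have ab: "0 < a" "a < r0" "r0 < b" using r0 by (auto simp: a_def b_def)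
  \<comment> \<open>A zero of the nonnegative U is a minimum, so both U and the flux vanish
    there.\<close>
  have "V r0 = 0"
  proof (rule DERIV_local_min[OF U_deriv[OF r0] r0])
    show "\<forall>y. \<bar>r0 - y\<bar> < r0 \<longrightarrow> U r0 \<le> U y" using zero U_bounds by (auto simp: abs_if split: if_splits)
  qed
  then have W0: "W r0 = 0" using W_eq[OF r0] by simp
  define c2 where "c2 = 1 / (\<alpha>\<^sub>0 * a ^ (N - 1))"
  have c2: "0 < c2" using \<alpha>0 ab by (simp add: c2_def)
  define c3 where "c3 = (K * b / \<alpha>\<^sub>0) powr (1 / (p - 1))"
  define c4 where "c4 = b ^ (N - 1) * (\<beta> M * c3 * c2 + (1 + M powr (q - p)))"
  have "0 < 1 + M powr (q - p)" by (rule add_pos_nonneg) auto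
  moreover have "0 \<le> \<beta> M * c3 * c2" using \<beta>_pos[of M] c2 by (simp add: c3_def less_imp_le)
  ultimately have "0 < \<beta> M * c3 * c2 + (1 + M powr (q - p))" by linarith
  then have c4: "0 < c4" using ab by (simp add: c4_def)
  have V1: "\<bar>V r\<bar> powr (p - 1) \<le> c2 * \<bar>W r\<bar>" if r: "a \<le> r" for r
  proof -
    have "\<alpha>\<^sub>0 * \<bar>V r\<bar> powr (p - 1) \<le> \<bar>Jt (U r) (V r)\<bar>" by (rule Jt_lower)
    then have "a ^ (N - 1) * (\<alpha>\<^sub>0 * \<bar>V r\<bar> powr (p - 1)) \<le> r ^ (N - 1) * \<bar>Jt (U r) (V r)\<bar>"
      using r ab \<alpha>0 by (intro mult_mono power_mono) auto
    also have "\<dots> = \<bar>W r\<bar>" using W_eq[of r] r ab by (simp add: abs_mult)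
    finally show ?thesis using \<alpha>0 ab by (simp add: c2_def field_simps)
  qed
  have W1: "\<bar>r ^ (N - 1) * (Js (U r) (V r) + F' (U r))\<bar> \<le> c4 * (\<bar>W r\<bar> + U r powr (p - 1))"
    if r: "a \<le> r" "r \<le> b" for r
  proof -
    have "\<bar>V r\<bar> \<le> (K * r / \<alpha>\<^sub>0) powr (1 / (p - 1))" using V_bound[of r] r ab by simp
    also have "\<dots> \<le> c3" unfolding c3_def using r ab K0 \<alpha>0 p1
      by (intro powr_mono2 divide_right_mono mult_left_mono) auto
    finally have V3: "\<bar>V r\<bar> \<le> c3" .
    have "\<bar>Js (U r) (V r)\<bar> \<le> \<beta> \<bar>U r\<bar> * \<bar>V r\<bar> powr p" by (rule Js_bound)
    also have "\<dots> \<le> \<beta> M * \<bar>V r\<bar> powr p"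
      using U_bounds[of r] r ab by (intro mult_right_mono monoD[OF \<beta>_mono]) auto
    also have "\<bar>V r\<bar> powr p = \<bar>V r\<bar> * \<bar>V r\<bar> powr (p - 1)" using p1 by (cases "V r = 0") (auto simp: powr_diff)
    also have "\<beta> M * (\<bar>V r\<bar> * \<bar>V r\<bar> powr (p - 1)) \<le> \<beta> M * (c3 * (c2 * \<bar>W r\<bar>))"
      using V3 V1[OF r(1)] \<beta>_pos[of M] by (intro mult_left_mono mult_mono) (auto simp: less_imp_le c3_def)
    finally have J: "\<bar>Js (U r) (V r)\<bar> \<le> \<beta> M * c3 * c2 * \<bar>W r\<bar>" by simp
    have "\<bar>Js (U r) (V r) + F' (U r)\<bar> \<le> \<beta> M * c3 * c2 * \<bar>W r\<bar> + (1 + M powr (q - p)) * U r powr (p - 1)"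
      using J F'_le(2)[of "U r" M] U_bounds[of r] r ab by auto
    also have "\<dots> \<le> (\<beta> M * c3 * c2 + (1 + M powr (q - p))) * (\<bar>W r\<bar> + U r powr (p - 1))"
    proof -
      have "0 \<le> \<beta> M * c3 * c2 * U r powr (p - 1)" "0 \<le> (1 + M powr (q - p)) * \<bar>W r\<bar>"
        using \<beta>_pos[of M] c2 by (auto simp: c3_def less_imp_le)
      then show ?thesis by (simp add: algebra_simps)
    qed
    finally have "r ^ (N - 1) * \<bar>Js (U r) (V r) + F' (U r)\<bar>
        \<le> b ^ (N - 1) * ((\<beta> M * c3 * c2 + (1 + M powr (q - p))) * (\<bar>W r\<bar> + U r powr (p - 1)))"
      using r ab by (intro mult_mono power_mono) auto
    then show ?thesis using r ab by (simp add: c4_def abs_mult)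
  qed
  \<comment> \<open>The bound r0/2 keeps the interval away from the origin, 1 discards a power of
    the distance, and the last one makes the maximum A of the absolute flux at most A/2.\<close>
  define \<delta> where "\<delta> = Min {1, r0 / 2, 1 / (2 * (c4 * (1 + c2)))}"
  have \<delta>: "0 < \<delta>" "\<delta> \<le> 1" "\<delta> \<le> r0 / 2" "\<delta> * (c4 * (1 + c2)) \<le> 1/2"
  proof -
    have pos: "0 < c4 * (1 + c2)" using c4 c2 by simp
    then have "0 < 1 / (2 * (c4 * (1 + c2)))" by simp
    then show "0 < \<delta>" using r0 by (simp add: \<delta>_def)
    show "\<delta> \<le> 1" "\<delta> \<le> r0 / 2" by (auto simp: \<delta>_def)
    have "\<delta> \<le> 1 / (2 * (c4 * (1 + c2)))" by (simp add: \<delta>_def)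
    then show "\<delta> * (c4 * (1 + c2)) \<le> 1/2" using pos by (simp add: field_simps)
  qed
  define I where "I = {r0 - \<delta>..r0 + \<delta>}"
  have I: "a \<le> r" "r \<le> b" "0 < r" "\<bar>r - r0\<bar> \<le> \<delta>" if "r \<in> I" for r
    using that \<delta> r0 by (auto simp: I_def a_def b_def)
  have conv: "convex I" "r0 \<in> I" using \<delta> by (auto simp: I_def)
  have "continuous_on I (\<lambda>r. \<bar>W r\<bar>)"
    using isCont_W I by (intro continuous_intros continuous_at_imp_continuous_on) auto
  moreover have "compact I" "I \<noteq> {}" using conv by (auto simp: I_def)
  ultimately obtain r1 where r1: "r1 \<in> I" "\<And>r. r \<in> I \<Longrightarrow> \<bar>W r\<bar> \<le> \<bar>W r1\<bar>"
    using continuous_attains_sup[of I "\<lambda>r. \<bar>W r\<bar>"] by blast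
  define A where "A = \<bar>W r1\<bar>"
  have A: "0 \<le> A" "\<And>r. r \<in> I \<Longrightarrow> \<bar>W r\<bar> \<le> A" using r1 by (auto simp: A_def)
  \<comment> \<open>Integrating the slope bound and raising to the power p - 1 restores linearity in
    A. The p-homogeneous structure thus replaces a Lipschitz condition on the powers.\<close>
  have U1: "U r powr (p - 1) \<le> c2 * A" if r: "r \<in> I" for r
  proof -
    have "norm (U r - U r0) \<le> (c2 * A) powr (1 / (p - 1)) * norm (r - r0)"
    proof (rule field_differentiable_bound[OF conv(1)])
      fix z assume z: "z \<in> I"
      show "(U has_real_derivative V z) (at z within I)"
        using U_deriv[OF I(3)[OF z]] by (rule has_field_derivative_at_within)
      have "\<bar>V z\<bar> powr (p - 1) \<le> c2 * A"
        using V1[OF I(1)[OF z]] mult_left_mono[OF A(2)[OF z], of c2] c2 by linarith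
      then have "(\<bar>V z\<bar> powr (p - 1)) powr (1 / (p - 1)) \<le> (c2 * A) powr (1 / (p - 1))"
        using p1 by (intro powr_mono2) auto
      then show "norm (V z) \<le> (c2 * A) powr (1 / (p - 1))" using p1 by (simp add: powr_powr)
    qed (use r conv in auto)
    also have "\<dots> \<le> (c2 * A) powr (1 / (p - 1)) * 1"
      using I(4)[OF r] \<delta> by (intro mult_left_mono) auto
    finally have "U r \<le> (c2 * A) powr (1 / (p - 1))" using zero by simp
    then have "U r powr (p - 1) \<le> ((c2 * A) powr (1 / (p - 1))) powr (p - 1)"
      using U_bounds[of r] I(3)[OF r] p1 by (intro powr_mono2) auto
    then show ?thesis using p1 c2 A by (simp add: powr_powr)
  qed
  have "norm (W r1 - W r0) \<le> c4 * (1 + c2) * A * norm (r1 - r0)"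
  proof (rule field_differentiable_bound[OF conv(1)])
    fix z assume z: "z \<in> I"
    show "(W has_real_derivative z ^ (N - 1) * (Js (U z) (V z) + F' (U z))) (at z within I)"
      using W_deriv[OF I(3)[OF z]] by (rule has_field_derivative_at_within)
    have "\<bar>z ^ (N - 1) * (Js (U z) (V z) + F' (U z))\<bar> \<le> c4 * (\<bar>W z\<bar> + U z powr (p - 1))"
      using W1 I[OF z] by blast
    also have "\<dots> \<le> c4 * (A + c2 * A)" using A(2)[OF z] U1[OF z] c4 by (intro mult_left_mono) auto
    finally show "norm (z ^ (N - 1) * (Js (U z) (V z) + F' (U z))) \<le> c4 * (1 + c2) * A"
      by (simp add: algebra_simps)
  qed (use r1 conv in auto)
  also have "\<dots> \<le> c4 * (1 + c2) * A * \<delta>"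
    using I(4)[OF r1(1)] c4 c2 A by (intro mult_left_mono) auto
  also have "\<dots> = A * (\<delta> * (c4 * (1 + c2)))" by simp
  also have "\<dots> \<le> A * (1/2)" using \<delta> A by (intro mult_left_mono) auto
  finally have "A = 0" using W0 A by (simp add: A_def)
  show ?thesis
  proof (rule that[OF \<delta>(1)])
    fix r assume "\<bar>r - r0\<bar> < \<delta>"
    then have r: "r \<in> I" by (auto simp: I_def abs_less_iff)
    have "U r powr (p - 1) \<le> 0" using U1[OF r] \<open>A = 0\<close> by simp
    then have "U r powr (p - 1) = 0" using powr_ge_zero[of "U r" "p - 1"] by linarith
    then show "U r = 0" by simp
  qed
qed

text \<open>The zeros in (0, \<infinity>) form an open and closed set. If it is everything,
  continuity at the origin gives \<open>U 0 = 0\<close> as well, so that the radius of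
  \<open>U_ge_1\<close> cannot be 0 either.\<close>

lemma U_pos:
  assumes r: "0 < r"
  shows "0 < U r"
proof (rule ccontr)
  assume "\<not> 0 < U r"
  then have Ur: "U r = 0" using U_bounds[of r] r by auto
  define Z where "Z = {x \<in> {0<..}. U x = 0}"
  have op: "open Z"
    unfolding open_dist
  proof
    fix x assume "x \<in> Z"
    then have x: "0 < x" "U x = 0" by (auto simp: Z_def)
    obtain \<delta> where \<delta>: "0 < \<delta>" "\<And>y. \<bar>y - x\<bar> < \<delta> \<Longrightarrow> U y = 0" using U_zero_open[OF x] by blast
    show "\<exists>e>0. \<forall>y. dist y x < e \<longrightarrow> y \<in> Z"
      using \<delta> x by (intro exI[of _ "min \<delta> x"]) (auto simp: Z_def dist_real_def)
  qed
  have "open {x \<in> {0<..}. U x \<noteq> 0}"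
  proof -
    have "continuous_on {0<..} U" by (rule continuous_on_subset[OF U_continuous_on]) auto
    from continuous_open_preimage[OF this open_greaterThan, of "- {0}"]
    have "open ({0<..} \<inter> U -` (- {0}))" by auto
    moreover have "{0<..} \<inter> U -` (- {0}) = {x \<in> {0<..}. U x \<noteq> 0}" by auto
    ultimately show ?thesis by simp
  qed
  moreover have "connected {0::real<..}" by (simp add: convex_connected)
  moreover have "{0<..} \<subseteq> Z \<union> {x \<in> {0<..}. U x \<noteq> 0}" "Z \<inter> {x \<in> {0<..}. U x \<noteq> 0} \<inter> {0<..} = {}" "Z \<inter> {0<..} \<noteq> {}"
    using r Ur by (auto simp: Z_def)
  ultimately have "{x \<in> {0<..}. U x \<noteq> 0} \<inter> {0<..} = {}" using op unfolding connected_def by blast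
  then have zero: "U x = 0" if "0 < x" for x using that by auto
  obtain r1 where r1: "0 \<le> r1" "1 \<le> U r1" using U_ge_1 .
  then have "r1 = 0" using zero[of r1] by (cases "r1 = 0") auto
  have "(U \<longlongrightarrow> U 0) (at_right 0)"
    using U_continuous_on by (auto simp: continuous_on_def intro: tendsto_within_subset)
  moreover have "\<forall>\<^sub>F x in at_right 0. U x = 0" by (auto simp: eventually_at_filter zero)
  then have "(U \<longlongrightarrow> 0) (at_right 0)" by (rule tendsto_eventually)
  ultimately have "U 0 = 0" by (intro tendsto_unique[OF trivial_limit_at_right_real])
  then show False using r1 \<open>r1 = 0\<close> by simp
qed

end

text \<open>Two successive extractions, for the node values and for the fluxes. The second does not
  disturb the first because limits along \<open>grid_filter\<close> pass to subsequences.\<close>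

theorem (in quasilinear) limit_profile_exists:
  obtains n0 h m u M K \<rho> CP CA U W
  where "limit_profile N p q \<alpha>\<^sub>0 R j js jt \<alpha> \<beta> n0 h m u M K \<rho> CP CA U W"
proof -
  obtain M K \<rho> CP CA where K: "0 \<le> K" and ex: "\<And>n. \<exists>n0 m h u. mesh_estimates M K \<rho> CP CA n0 m h u \<and>
    h \<le> 1 / Suc n \<and> real n0 * h \<le> 1 / Suc n \<and> real n + 1 \<le> real m * h"
    using mesh_estimates_exist by metis
  define Q where "Q = (\<lambda>n (n0, m, h, u). mesh_estimates M K \<rho> CP CA n0 m h u \<and>
    h \<le> 1 / Suc n \<and> real n0 * h \<le> 1 / Suc n \<and> real n + 1 \<le> real m * h)"
  have "\<exists>x. Q n x" for n
  proof -
    from ex[of n] obtain n0 m h u where "Q n (n0, m, h, u)" unfolding Q_def by auto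
    then show ?thesis by blast
  qed
  then obtain f where "\<And>n. Q n (f n)" by metis
  then have f: "mesh_estimates M K \<rho> CP CA (fst (f n)) (fst (snd (f n))) (fst (snd (snd (f n)))) (snd (snd (snd (f n)))) \<and>
    fst (snd (snd (f n))) \<le> 1 / Suc n \<and> real (fst (f n)) * fst (snd (snd (f n))) \<le> 1 / Suc n \<and>
    real n + 1 \<le> real (fst (snd (f n))) * fst (snd (snd (f n)))" for n
    unfolding Q_def case_prod_unfold by blast
  define n0 m h u where "n0 = (\<lambda>n. fst (f n))" and "m = (\<lambda>n. fst (snd (f n)))"
    and "h = (\<lambda>n. fst (snd (snd (f n))))" and "u = (\<lambda>n. snd (snd (snd (f n))))"
  have seq: "\<And>n. mesh_estimates M K \<rho> CP CA (n0 n) (m n) (h n) (u n)"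
    "\<And>n. h n \<le> 1 / Suc n" "\<And>n. real (n0 n) * h n \<le> 1 / Suc n" "\<And>n. real n + 1 \<le> real (m n) * h n"
    using f unfolding n0_def m_def h_def u_def by blast+
  interpret A: approximating_sequence N p q \<alpha>\<^sub>0 R j js jt \<alpha> \<beta> n0 h m u M K \<rho> CP CA
    using seq K by unfold_locales (auto simp: mesh_estimates_def)
  obtain k1 U where k1: "strict_mono (k1 :: nat \<Rightarrow> nat)"
    "\<And>r. 0 \<le> r \<Longrightarrow> ((\<lambda>(n, i). u (k1 n) i) \<longlongrightarrow> U r) (grid_filter (n0 \<circ> k1) (h \<circ> k1) r)"
    "\<And>L. \<exists>B. \<forall>r s. 0 \<le> r \<longrightarrow> r \<le> L \<longrightarrow> 0 \<le> s \<longrightarrow> s \<le> L \<longrightarrow> \<bar>U r - U s\<bar> \<le> B * \<bar>r - s\<bar>"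
  proof (rule A.grid_arzela_ascoli[of u])
    fix L
    obtain B where "\<And>n i. L \<le> real n \<Longrightarrow> n0 n \<le> i \<Longrightarrow> real i * h n \<le> L \<Longrightarrow>
      \<bar>u n i\<bar> \<le> B \<and> \<bar>u n (Suc i) - u n i\<bar> \<le> B * h n \<and> \<bar>A.w n i\<bar> \<le> B \<and> \<bar>A.w n (Suc i) - A.w n i\<bar> \<le> B * h n"
      using A.u_w_lipschitz[of L] by blast
    then show "\<exists>B. \<forall>n i. L \<le> real n \<longrightarrow> n0 n \<le> i \<longrightarrow> real i * h n \<le> L \<longrightarrow>
      \<bar>u n i\<bar> \<le> B \<and> \<bar>u n (Suc i) - u n i\<bar> \<le> B * h n" by blast
  qed blast
  interpret B: approximating_sequence N p q \<alpha>\<^sub>0 R j js jt \<alpha> \<beta> "n0 \<circ> k1" "h \<circ> k1" "m \<circ> k1" "u \<circ> k1" M K \<rho> CP CA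
    using k1(1) by (rule A.approximating_subseq)
  obtain k2 W where k2: "strict_mono (k2 :: nat \<Rightarrow> nat)"
    "\<And>r. 0 \<le> r \<Longrightarrow> ((\<lambda>(n, i). B.w (k2 n) i) \<longlongrightarrow> W r) (grid_filter (n0 \<circ> k1 \<circ> k2) (h \<circ> k1 \<circ> k2) r)"
  proof (rule B.grid_arzela_ascoli[of B.w])
    fix L
    obtain B where "\<And>n i. L \<le> real n \<Longrightarrow> (n0 \<circ> k1) n \<le> i \<Longrightarrow> real i * (h \<circ> k1) n \<le> L \<Longrightarrow>
      \<bar>(u \<circ> k1) n i\<bar> \<le> B \<and> \<bar>(u \<circ> k1) n (Suc i) - (u \<circ> k1) n i\<bar> \<le> B * (h \<circ> k1) n \<and>
      \<bar>B.w n i\<bar> \<le> B \<and> \<bar>B.w n (Suc i) - B.w n i\<bar> \<le> B * (h \<circ> k1) n"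
      using B.u_w_lipschitz[of L] by blast
    then show "\<exists>B. \<forall>n i. L \<le> real n \<longrightarrow> (n0 \<circ> k1) n \<le> i \<longrightarrow> real i * (h \<circ> k1) n \<le> L \<longrightarrow>
      \<bar>B.w n i\<bar> \<le> B \<and> \<bar>B.w n (Suc i) - B.w n i\<bar> \<le> B * (h \<circ> k1) n" by blast
  qed blast
  interpret C: approximating_sequence N p q \<alpha>\<^sub>0 R j js jt \<alpha> \<beta> "n0 \<circ> k1 \<circ> k2" "h \<circ> k1 \<circ> k2" "m \<circ> k1 \<circ> k2" "u \<circ> k1 \<circ> k2" M K \<rho> CP CA
    using k2(1) by (rule B.approximating_subseq)
  have "limit_profile N p q \<alpha>\<^sub>0 R j js jt \<alpha> \<beta> (n0 \<circ> k1 \<circ> k2) (h \<circ> k1 \<circ> k2) (m \<circ> k1 \<circ> k2) (u \<circ> k1 \<circ> k2) M K \<rho> CP CA U W"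
  proof unfold_locales
    fix r :: real assume r: "0 \<le> r"
    have "((\<lambda>(n, i). (u \<circ> k1) n i) \<longlongrightarrow> U r) (grid_filter (n0 \<circ> k1) (h \<circ> k1) r)" using k1(2)[OF r] by simp
    from grid_filter_subseq[OF this k2(1)]
    show "((\<lambda>(n, i). (u \<circ> k1 \<circ> k2) n i) \<longlongrightarrow> U r) (grid_filter (n0 \<circ> k1 \<circ> k2) (h \<circ> k1 \<circ> k2) r)" by simp
    have "C.w n i = B.w (k2 n) i" for n i by (simp add: C.w_def B.w_def)
    then show "((\<lambda>(n, i). C.w n i) \<longlongrightarrow> W r) (grid_filter (n0 \<circ> k1 \<circ> k2) (h \<circ> k1 \<circ> k2) r)"
      using k2(2)[OF r] by simp
  qed (use k1(3) in blast)
  then show ?thesis using that by blast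
qed

section \<open>Test functions and integration on shells\<close>

lemma test_function_has_derivative:
  assumes "test_function v"
  shows "(v has_derivative (\<lambda>y. gradient v x \<bullet> y)) (at x)"
proof -
  have "times_differentiable (Suc 0) v" using assms by (simp add: test_function_def)
  then have d: "(v has_derivative frechet_derivative v (at x)) (at x)"
    by (simp add: frechet_derivative_works)
  interpret D: bounded_linear "frechet_derivative v (at x)" using d by (rule has_derivative_bounded_linear)
  have "frechet_derivative v (at x) y = gradient v x \<bullet> y" for y
  proof -
    have "frechet_derivative v (at x) y = frechet_derivative v (at x) (\<Sum>b\<in>Basis. (y \<bullet> b) *\<^sub>R b)"
      by (simp add: euclidean_representation)
    also have "\<dots> = (\<Sum>b\<in>Basis. (y \<bullet> b) * frechet_derivative v (at x) b)" by (simp add: D.sum D.scaleR)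
    also have "\<dots> = gradient v x \<bullet> y"
      by (simp add: gradient_def inner_sum_left inner_commute[of y] mult.commute)
    finally show ?thesis .
  qed
  then show ?thesis using d by presburger
qed

lemma continuous_on_gradient:
  assumes "test_function v"
  shows "continuous_on UNIV (gradient v)"
proof -
  have "times_differentiable (Suc 0) v" using assms by (simp add: test_function_def)
  then have "continuous_on UNIV (\<lambda>x. frechet_derivative v (at x) b)" if "b \<in> Basis" for b
    using that by simp
  then show ?thesis unfolding gradient_def by (intro continuous_intros)
qed

lemma continuous_on_test_function: "test_function v \<Longrightarrow> continuous_on UNIV v"
  using test_function_has_derivative has_derivative_continuous_on[of UNIV v "\<lambda>x y. gradient v x \<bullet> y"]
  by (metis has_derivative_at_withinI)

lemma test_function_support:
  assumes "test_function v"
  obtains R where "0 < R" "\<And>x. R < norm x \<Longrightarrow> v x = 0" "\<And>x. R < norm x \<Longrightarrow> gradient v x = 0"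
proof -
  have "bounded (closure {x. v x \<noteq> 0})" using assms by (simp add: test_function_def compact_imp_bounded)
  then obtain R where R: "0 < R" "\<And>x. x \<in> closure {x. v x \<noteq> 0} \<Longrightarrow> norm x \<le> R"
    by (auto simp: bounded_pos)
  have v0: "v x = 0" if "R < norm x" for x
    using R(2)[of x] closure_subset[of "{x. v x \<noteq> 0}"] that by force
  have "gradient v x = 0" if x: "R < norm x" for x
  proof -
    have op: "open {y. R < norm y}" by (intro open_Collect_less continuous_intros)
    have "(v has_derivative (\<lambda>y. 0)) (at x)"
      by (rule has_derivative_transform_within_open[OF _ op, of "\<lambda>x. 0"]) (use x v0 in auto)
    then have "(\<lambda>y. gradient v x \<bullet> y) = (\<lambda>y. 0)"
      by (rule has_derivative_unique[OF test_function_has_derivative[OF assms]])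
    then show ?thesis by (metis inner_eq_zero_iff)
  qed
  then show ?thesis using that[OF R(1)] v0 by blast
qed

definition locally_lipschitz :: "('a::euclidean_space \<Rightarrow> real) \<Rightarrow> bool" where
  "locally_lipschitz f \<longleftrightarrow> (\<forall>R. \<exists>L. \<forall>x y. norm x \<le> R \<longrightarrow> norm y \<le> R \<longrightarrow> \<bar>f x - f y\<bar> \<le> L * norm (x - y))"

lemma locally_lipschitz_continuous:
  fixes f :: "'a::euclidean_space \<Rightarrow> real"
  assumes "locally_lipschitz f"
  shows "continuous_on UNIV f"
  unfolding continuous_on_eq_continuous_at[OF open_UNIV] continuous_at_eps_delta
proof (intro ballI allI impI)
  fix x :: 'a and e :: real assume e: "0 < e"
  obtain L where L: "\<And>y z. norm y \<le> norm x + 1 \<Longrightarrow> norm z \<le> norm x + 1 \<Longrightarrow> \<bar>f y - f z\<bar> \<le> L * norm (y - z)"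
    using assms unfolding locally_lipschitz_def by meson
  show "\<exists>d>0. \<forall>x'. dist x' x < d \<longrightarrow> dist (f x') (f x) < e"
  proof (intro exI[of _ "min 1 (e / (\<bar>L\<bar> + 1))"] conjI allI impI)
    fix y :: 'a assume y: "dist y x < min 1 (e / (\<bar>L\<bar> + 1))"
    have "norm y \<le> norm x + norm (y - x)" by (metis norm_triangle_sub)
    then have "\<bar>f y - f x\<bar> \<le> L * norm (y - x)" using y by (intro L) (auto simp: dist_norm)
    also have "\<dots> \<le> (\<bar>L\<bar> + 1) * norm (y - x)" by (intro mult_right_mono) auto
    also have "\<dots> < (\<bar>L\<bar> + 1) * (e / (\<bar>L\<bar> + 1))" using y by (intro mult_strict_left_mono) (auto simp: dist_norm)
    also have "\<dots> = e" by (simp add: add_nonneg_eq_0_iff)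
    finally show "dist (f y) (f x) < e" by (simp add: dist_real_def)
  qed (use e in auto)
qed

lemma locally_lipschitz_test_function:
  fixes v :: "'a::euclidean_space \<Rightarrow> real"
  assumes "test_function v"
  shows "locally_lipschitz v"
  unfolding locally_lipschitz_def
proof
  fix R
  have "compact (gradient v ` cball (0 :: 'a) R)"
    by (intro compact_continuous_image continuous_on_subset[OF continuous_on_gradient[OF assms]]) auto
  then obtain B where B: "\<And>x. x \<in> cball 0 R \<Longrightarrow> norm (gradient v x) \<le> B"
    using compact_imp_bounded bounded_iff by (metis imageI)
  have "norm (v x - v y) \<le> B * norm (x - y)" if "norm x \<le> R" "norm y \<le> R" for x y :: 'a
  proof (rule differentiable_bound[of "cball 0 R" v "\<lambda>x y. gradient v x \<bullet> y"])
    fix z :: 'a assume z: "z \<in> cball 0 R"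
    show "(v has_derivative (\<lambda>y. gradient v z \<bullet> y)) (at z within cball 0 R)"
      by (rule has_derivative_at_withinI[OF test_function_has_derivative[OF assms]])
    show "onorm (\<lambda>y. gradient v z \<bullet> y) \<le> B"
    proof (rule onorm_le)
      fix y
      have "norm (gradient v z \<bullet> y) \<le> norm (gradient v z) * norm y" using Cauchy_Schwarz_ineq2 by simp
      also have "\<dots> \<le> B * norm y" using B[OF z] by (intro mult_right_mono) auto
      finally show "norm (gradient v z \<bullet> y) \<le> B * norm y" .
    qed
  qed (use that in auto)
  then show "\<exists>L. \<forall>x y. norm x \<le> R \<longrightarrow> norm y \<le> R \<longrightarrow> \<bar>v x - v y\<bar> \<le> L * norm (x - y)" by auto
qed

lemma integrable_continuous_compact_support:
  fixes f :: "'a::euclidean_space \<Rightarrow> real"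
  assumes f: "continuous_on UNIV f" and R: "\<And>x. R < norm x \<Longrightarrow> f x = 0"
  shows "integrable lborel f" "integrable lebesgue f"
proof -
  have "integrable lborel (\<lambda>x. indicator (cball 0 R) x *\<^sub>R f x)"
    by (rule borel_integrable_compact) (use f in \<open>auto intro: continuous_on_subset\<close>)
  moreover have "(\<lambda>x. indicator (cball 0 R) x *\<^sub>R f x) = f"
    using R by (auto simp: fun_eq_iff indicator_def)
  ultimately show "integrable lborel f" by simp
  then show "integrable lebesgue f"
    by (subst integrable_completion) (auto intro!: borel_measurable_continuous_onI f)
qed

text \<open>The derivative of a compactly supported Lipschitz function integrates to zero because the
  difference quotients do, by translation invariance.\<close>

lemma integration_by_parts:
  fixes f f' v :: "'a::euclidean_space \<Rightarrow> real"
  assumes v: "test_function v" and b: "b \<in> Basis" and lip: "locally_lipschitz f"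
    and der: "\<And>x. x \<noteq> 0 \<Longrightarrow> ((\<lambda>t. f (x + t *\<^sub>R b)) has_real_derivative f' x) (at 0)"
    and f': "continuous_on (- {0}) f'"
  shows "integrable lebesgue (\<lambda>x. f x * (gradient v x \<bullet> b))"
    and "integrable lebesgue (\<lambda>x. f' x * v x)"
    and "(\<integral>x. f x * (gradient v x \<bullet> b) \<partial>lebesgue) = - (\<integral>x. f' x * v x \<partial>lebesgue)"
proof -
  obtain R where R: "0 < R" "\<And>x. R < norm x \<Longrightarrow> v x = 0" "\<And>x. R < norm x \<Longrightarrow> gradient v x = 0"
    using test_function_support[OF v] by blast
  have fc: "continuous_on UNIV f" using lip by (rule locally_lipschitz_continuous)
  have vc: "continuous_on UNIV v" using v by (rule continuous_on_test_function)
  have gc: "continuous_on UNIV (gradient v)" using v by (rule continuous_on_gradient)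
  have i1: "integrable lborel (\<lambda>x. f x * (gradient v x \<bullet> b))" "integrable lebesgue (\<lambda>x. f x * (gradient v x \<bullet> b))"
    using R(3) by (auto intro!: integrable_continuous_compact_support[of _ R] continuous_intros fc gc)
  show "integrable lebesgue (\<lambda>x. f x * (gradient v x \<bullet> b))" by fact
  define g where "g = (\<lambda>x. f x * v x)"
  have gcont: "continuous_on UNIV g" unfolding g_def by (intro continuous_intros fc vc)
  have gint: "integrable lborel g"
    using R(2) by (intro integrable_continuous_compact_support(1)[of _ R] gcont) (simp add: g_def)
  define s where "s = (\<lambda>n x. real (Suc n) * (g ((1 / real (Suc n)) *\<^sub>R b + x) - g x))"
  define g' where "g' = (\<lambda>x. f' x * v x + f x * (gradient v x \<bullet> b))"
  have gm: "g \<in> borel_measurable borel" using gcont by (rule borel_measurable_continuous_onI)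
  have f'm: "f' \<in> borel_measurable borel"
    by (rule borel_measurable_continuous_countable_exceptions[of "{0}"]) (use f' in auto)
  have vm: "v \<in> borel_measurable borel" using vc by (rule borel_measurable_continuous_onI)
  have fgm: "(\<lambda>x. f x * (gradient v x \<bullet> b)) \<in> borel_measurable borel"
    by (intro borel_measurable_continuous_onI continuous_intros fc gc)
  have g'm: "g' \<in> borel_measurable borel" unfolding g'_def
    by (intro borel_measurable_add borel_measurable_times f'm vm fgm)
  have trans: "integrable lborel (\<lambda>x. g (c + x))" "(\<integral>x. g (c + x) \<partial>lborel) = (\<integral>x. g x \<partial>lborel)" for c
  proof -
    have "integrable (distr lborel borel ((+) c)) g" using gint by (simp add: lborel_distr_plus)
    then show "integrable lborel (\<lambda>x. g (c + x))"
      using gm by (subst (asm) integrable_distr_eq) auto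
    have "(\<integral>x. g x \<partial>lborel) = (\<integral>x. g x \<partial>(distr lborel borel ((+) c)))" by (simp add: lborel_distr_plus)
    also have "\<dots> = (\<integral>x. g (c + x) \<partial>lborel)" using gm by (intro integral_distr) auto
    finally show "(\<integral>x. g (c + x) \<partial>lborel) = (\<integral>x. g x \<partial>lborel)" by simp
  qed
  have s0: "(\<integral>x. s n x \<partial>lborel) = 0" for n
    unfolding s_def using trans gint by simp
  \<comment> \<open>The difference quotients live on the ball of radius R + 1, and the shifted point
    is at distance at most 1 from the original one.\<close>
  obtain Lf where Lf: "\<And>x y. norm x \<le> R + 2 \<Longrightarrow> norm y \<le> R + 2 \<Longrightarrow> \<bar>f x - f y\<bar> \<le> Lf * norm (x - y)"
    using lip unfolding locally_lipschitz_def by meson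
  obtain Lv where Lv: "\<And>x y. norm x \<le> R + 2 \<Longrightarrow> norm y \<le> R + 2 \<Longrightarrow> \<bar>v x - v y\<bar> \<le> Lv * norm (x - y)"
    using locally_lipschitz_test_function[OF v] unfolding locally_lipschitz_def by meson
  have bd: "\<exists>B. \<forall>x. norm x \<le> R + 2 \<longrightarrow> \<bar>k x\<bar> \<le> B" if "continuous_on UNIV k" for k :: "'a \<Rightarrow> real"
  proof -
    have "compact (k ` cball 0 (R + 2))"
      using that by (intro compact_continuous_image) (auto intro: continuous_on_subset)
    then obtain B where "\<And>x. x \<in> cball 0 (R + 2) \<Longrightarrow> norm (k x) \<le> B"
      using compact_imp_bounded bounded_iff by (metis imageI)
    then show ?thesis by (intro exI[of _ B]) simp
  qed
  obtain Bf where Bf: "\<And>x. norm x \<le> R + 2 \<Longrightarrow> \<bar>f x\<bar> \<le> Bf" using bd[OF fc] by blast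
  obtain Bv where Bv: "\<And>x. norm x \<le> R + 2 \<Longrightarrow> \<bar>v x\<bar> \<le> Bv" using bd[OF vc] by blast
  define L where "L = Bf * \<bar>Lv\<bar> + Bv * \<bar>Lf\<bar>"
  have B0: "0 \<le> Bf" "0 \<le> Bv" using Bf[of 0] Bv[of 0] R by auto
  have s_bound: "norm (s n x) \<le> L * indicator (cball 0 (R + 1)) x" for n x
  proof -
    define y where "y = (1 / real (Suc n)) *\<^sub>R b + x"
    have nb: "norm (y - x) = 1 / real (Suc n)" using b by (simp add: y_def)
    have le1: "1 / real (Suc n) \<le> 1" by simp
    have ny: "norm y \<le> norm x + 1" "norm x \<le> norm y + 1"
      using norm_triangle_sub[of y x] norm_triangle_sub[of x y] nb le1 norm_minus_commute[of x y] by linarith+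
    show ?thesis
    proof (cases "norm x \<le> R + 1")
      case True
      then have xy: "norm x \<le> R + 2" "norm y \<le> R + 2" using ny by auto
      have "g y - g x = f y * (v y - v x) + v x * (f y - f x)" by (simp add: g_def algebra_simps)
      then have "\<bar>g y - g x\<bar> \<le> \<bar>f y\<bar> * \<bar>v y - v x\<bar> + \<bar>v x\<bar> * \<bar>f y - f x\<bar>"
        by (metis abs_mult abs_triangle_ineq)
      also have "\<dots> \<le> Bf * (\<bar>Lv\<bar> * norm (y - x)) + Bv * (\<bar>Lf\<bar> * norm (y - x))"
      proof (intro add_mono mult_mono)
        have "Lv * norm (y - x) \<le> \<bar>Lv\<bar> * norm (y - x)" "Lf * norm (y - x) \<le> \<bar>Lf\<bar> * norm (y - x)"
          by (intro mult_right_mono; simp)+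
        then show "\<bar>v y - v x\<bar> \<le> \<bar>Lv\<bar> * norm (y - x)" "\<bar>f y - f x\<bar> \<le> \<bar>Lf\<bar> * norm (y - x)"
          using Lv[OF xy(2,1)] Lf[OF xy(2,1)] by linarith+
      qed (use Bf Bv xy B0 in auto)
      also have "\<dots> = L / real (Suc n)" by (simp add: L_def nb add_divide_distrib)
      finally have "real (Suc n) * \<bar>g y - g x\<bar> \<le> L" by (simp add: field_simps)
      then show ?thesis using True by (simp add: s_def y_def abs_mult)
    next
      case False
      then have "R < norm x" "R < norm y" using ny by linarith+
      then have "g y = 0" "g x = 0" using R(2) by (auto simp: g_def)
      then show ?thesis using False by (simp add: s_def y_def)
    qed
  qed
  have s_lim: "(\<lambda>n. s n x) \<longlonglongrightarrow> g' x" if x: "x \<noteq> 0" for x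
  proof -
    have dv: "((\<lambda>t. v (x + t *\<^sub>R b)) has_real_derivative gradient v x \<bullet> b) (at 0)"
    proof -
      have 1: "((\<lambda>t. x + t *\<^sub>R b) has_derivative (\<lambda>t. t *\<^sub>R b)) (at 0)"
        by (auto intro!: derivative_eq_intros)
      have "((\<lambda>t. v (x + t *\<^sub>R b)) has_derivative (\<lambda>t. gradient v x \<bullet> (t *\<^sub>R b))) (at 0)"
        using has_derivative_compose[OF 1, of v "\<lambda>y. gradient v x \<bullet> y"] test_function_has_derivative[OF v, of x]
        by simp
      then show ?thesis by (simp add: has_field_derivative_def mult.commute[of _ "gradient v x \<bullet> b"])
    qed
    have "((\<lambda>t. g (x + t *\<^sub>R b)) has_real_derivative g' x) (at 0)"
      unfolding g_def by (rule DERIV_cong[OF DERIV_mult[OF der[OF x] dv]]) (simp add: g'_def)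
    then have lim: "((\<lambda>t. (g (x + t *\<^sub>R b) - g x) / t) \<longlongrightarrow> g' x) (at 0)"
      by (simp add: has_field_derivative_iff)
    have "filterlim (\<lambda>n. 1 / real (Suc n)) (at 0) sequentially"
      unfolding filterlim_at using LIMSEQ_Suc[OF lim_1_over_n] by (simp add: eventually_sequentially)
    from filterlim_compose[OF lim this]
    show ?thesis by (simp add: s_def add.commute mult.commute)
  qed
  \<comment> \<open>The origin, where no derivative is assumed, is a null set.\<close>
  have AE0: "AE x in lborel. (\<lambda>n. s n x) \<longlonglongrightarrow> g' x"
    using AE_lborel_singleton[of "0::'a"] by eventually_elim (rule s_lim)
  have dom: "integrable lborel (\<lambda>x::'a. L * indicator (cball 0 (R + 1)) x)"
    using borel_integrable_compact[of "cball (0::'a) (R + 1)" "\<lambda>x. L"] by (simp add: mult.commute)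
  have sm: "s n \<in> borel_measurable lborel" for n
    unfolding s_def using gm by measurable
  have g'int: "integrable lborel g'"
    by (rule integrable_dominated_convergence[OF _ sm dom AE0]) (use g'm s_bound in auto)
  have "(\<lambda>n. \<integral>x. s n x \<partial>lborel) \<longlonglongrightarrow> (\<integral>x. g' x \<partial>lborel)"
    by (rule integral_dominated_convergence[OF _ sm dom AE0]) (use g'm s_bound in auto)
  then have g'0: "(\<integral>x. g' x \<partial>lborel) = 0" unfolding s0 using LIMSEQ_unique tendsto_const by blast
  have eq: "(\<lambda>x. f' x * v x) = (\<lambda>x. g' x - f x * (gradient v x \<bullet> b))" by (simp add: g'_def)
  have i2: "integrable lborel (\<lambda>x. f' x * v x)" unfolding eq using g'int i1(1) by (rule Bochner_Integration.integrable_diff)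
  have m2: "(\<lambda>x. f' x * v x) \<in> borel_measurable lborel"
    using f'm vm by measurable
  show "integrable lebesgue (\<lambda>x. f' x * v x)" using i2 m2 by (simp add: integrable_completion)
  have m1: "(\<lambda>x. f x * (gradient v x \<bullet> b)) \<in> borel_measurable lborel"
    using i1(1) by (rule borel_measurable_integrable)
  have "(\<integral>x. f' x * v x \<partial>lborel) = (\<integral>x. g' x \<partial>lborel) - (\<integral>x. f x * (gradient v x \<bullet> b) \<partial>lborel)"
    unfolding eq by (rule Bochner_Integration.integral_diff[OF g'int i1(1)])
  then show "(\<integral>x. f x * (gradient v x \<bullet> b) \<partial>lebesgue) = - (\<integral>x. f' x * v x \<partial>lebesgue)"
    using g'0 m1 m2 by (simp add: integral_completion)
qed

definition shell :: "real \<Rightarrow> nat \<Rightarrow> 'a::euclidean_space set" where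
  "shell h i = ball 0 (real i * h) - ball 0 (real (i - 1) * h)"

lemma mem_shell_iff:
  assumes "0 < h" "1 \<le> i"
  shows "x \<in> shell h i \<longleftrightarrow> i = Suc (nat \<lfloor>norm x / h\<rfloor>)"
proof -
  obtain k where i: "i = Suc k" using assms(2) by (cases i) auto
  have "x \<in> shell h i \<longleftrightarrow> real k \<le> norm x / h \<and> norm x / h < real k + 1"
    using assms(1) by (auto simp: shell_def i field_simps not_less)
  also have "\<dots> \<longleftrightarrow> \<lfloor>norm x / h\<rfloor> = int k" by (simp add: floor_eq_iff)
  also have "\<dots> \<longleftrightarrow> nat \<lfloor>norm x / h\<rfloor> = k" using assms(1) by (auto simp: zero_le_divide_iff)
  finally show ?thesis by (auto simp: i)
qed

text \<open>The difference of the n-th powers of i and i - 1 is at most n times the (n - 1)-th power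
  of i. This ties the weights of the discrete sums to Lebesgue measure, with a constant free of
  h.\<close>

lemma emeasure_shell_le:
  assumes h: "0 < h" and i: "1 \<le> i"
  shows "emeasure lborel (shell h i :: 'a::euclidean_space set)
    \<le> ennreal (unit_ball_vol DIM('a) * real DIM('a) * (h ^ DIM('a) * real i ^ (DIM('a) - 1)))"
proof -
  define n where "n = DIM('a)"
  define c where "c = unit_ball_vol (real n)"
  have n: "1 \<le> n" by (simp add: n_def DIM_positive Suc_leI)
  have c: "0 \<le> c" by (simp add: c_def)
  have sub: "ball (0::'a) (real (i - 1) * h) \<subseteq> ball 0 (real i * h)"
    using h by (intro subset_ball mult_right_mono) auto
  have "emeasure lborel (shell h i :: 'a set)
      = emeasure lborel (ball (0::'a) (real i * h)) - emeasure lborel (ball (0::'a) (real (i - 1) * h))"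
    unfolding shell_def using sub h by (intro emeasure_Diff) (auto simp: emeasure_ball)
  also have "\<dots> = ennreal (c * (real i * h) ^ n - c * (real (i - 1) * h) ^ n)"
    using h c by (simp add: emeasure_ball n_def c_def ennreal_minus)
  also have "\<dots> \<le> ennreal (c * real n * (h ^ n * real i ^ (n - 1)))"
  proof (rule ennreal_leI)
    define k where "k = i - 1"
    have ik: "real i = real k + 1" using i by (simp add: k_def)
    have "real i ^ n - real k ^ n = (real i - real k) * (\<Sum>j<n. real k ^ (n - Suc j) * real i ^ j)"
      by (rule power_diff_sumr2)
    also have "\<dots> = (\<Sum>j<n. real k ^ (n - Suc j) * real i ^ j)" by (simp add: ik)
    also have "\<dots> \<le> (\<Sum>j<n. real i ^ (n - 1))"
    proof (rule sum_mono)
      fix j assume "j \<in> {..<n}"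
      then have "real i ^ (n - Suc j) * real i ^ j = real i ^ (n - 1)" by (simp flip: power_add)
      moreover have "real k ^ (n - Suc j) * real i ^ j \<le> real i ^ (n - Suc j) * real i ^ j"
        using ik by (intro mult_right_mono power_mono) auto
      ultimately show "real k ^ (n - Suc j) * real i ^ j \<le> real i ^ (n - 1)" by simp
    qed
    finally have "real i ^ n - real k ^ n \<le> real n * real i ^ (n - 1)" by simp
    then have "c * h ^ n * (real i ^ n - real k ^ n) \<le> c * h ^ n * (real n * real i ^ (n - 1))"
      using c h by (intro mult_left_mono) auto
    then show "c * (real i * h) ^ n - c * (real (i - 1) * h) ^ n \<le> c * real n * (h ^ n * real i ^ (n - 1))"
      unfolding k_def[symmetric] by (simp add: power_mult_distrib algebra_simps)
  qed
  finally show ?thesis by (simp add: n_def c_def)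
qed

text \<open>The node values, spread as constants over the shells, have bounded integrals and
  converge pointwise off the origin; Fatou's lemma then gives finiteness of the integral of the
  limit.\<close>

lemma (in grid) radial_fatou:
  fixes f :: "nat \<Rightarrow> nat \<Rightarrow> real" and g :: "real \<Rightarrow> real" and m :: "nat \<Rightarrow> nat" and N :: nat
  assumes N: "N = DIM('a::euclidean_space)" and f0: "\<And>n i. 0 \<le> f n i" and n0: "\<And>n. 1 \<le> n0 n"
    and C: "\<And>n. h n ^ N * (\<Sum>i=n0 n..m n. real i ^ (N - 1) * f n i) \<le> C"
    and lim: "\<And>r. 0 < r \<Longrightarrow> ((\<lambda>(n, i). f n i) \<longlongrightarrow> g r) (grid_filter n0 h r)"
    and inner: "\<And>r. 0 < r \<Longrightarrow> \<forall>\<^sub>F (n, i) in grid_filter n0 h r. i \<le> m n"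
  shows "(\<integral>\<^sup>+ x. ennreal (g (norm x)) \<partial>(lborel :: 'a measure)) < \<infinity>"
proof -
  define c where "c = unit_ball_vol (real N) * real N"
  have c: "0 \<le> c" by (simp add: c_def)
  define S where "S = (\<lambda>n (x :: 'a). \<Sum>i=n0 n..m n. ennreal (f n i) * indicator (shell (h n) i) x)"
  have shell_m: "shell (h n) i \<in> sets (borel :: 'a measure)" for n i
    unfolding shell_def by auto
  have Sm: "S n \<in> borel_measurable lborel" for n
    unfolding S_def using shell_m by (intro borel_measurable_sum) auto
  have Sint: "(\<integral>\<^sup>+ x. S n x \<partial>lborel) \<le> ennreal (c * C)" for n
  proof -
    have "(\<integral>\<^sup>+ x. S n x \<partial>lborel) = (\<Sum>i=n0 n..m n. ennreal (f n i) * emeasure lborel (shell (h n) i :: 'a set))"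
      unfolding S_def using shell_m by (subst nn_integral_sum) (auto simp: nn_integral_cmult_indicator)
    also have "\<dots> \<le> (\<Sum>i=n0 n..m n. ennreal (f n i * (c * (h n ^ N * real i ^ (N - 1)))))"
    proof (rule sum_mono)
      fix i assume "i \<in> {n0 n..m n}"
      then have "1 \<le> i" using n0[of n] by auto
      then have "emeasure lborel (shell (h n) i :: 'a set) \<le> ennreal (c * (h n ^ N * real i ^ (N - 1)))"
        using emeasure_shell_le[OF h_pos] by (simp add: c_def N)
      then have "ennreal (f n i) * emeasure lborel (shell (h n) i :: 'a set)
          \<le> ennreal (f n i) * ennreal (c * (h n ^ N * real i ^ (N - 1)))" by (intro mult_left_mono) auto
      then show "ennreal (f n i) * emeasure lborel (shell (h n) i :: 'a set)
          \<le> ennreal (f n i * (c * (h n ^ N * real i ^ (N - 1))))"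
        using f0 c h_pos[of n] by (simp add: ennreal_mult')
    qed
    also have "\<dots> = ennreal (\<Sum>i=n0 n..m n. f n i * (c * (h n ^ N * real i ^ (N - 1))))"
      using f0 c h_pos[of n] by (intro sum_ennreal) (auto simp: less_imp_le)
    also have "(\<Sum>i=n0 n..m n. f n i * (c * (h n ^ N * real i ^ (N - 1))))
        = c * (h n ^ N * (\<Sum>i=n0 n..m n. real i ^ (N - 1) * f n i))"
      by (simp add: sum_distrib_left mult_ac)
    also have "ennreal \<dots> \<le> ennreal (c * C)" using C c by (intro ennreal_leI mult_left_mono) auto
    finally show ?thesis .
  qed
  have Slim: "(\<lambda>n. S n x) \<longlonglongrightarrow> ennreal (g (norm x))" if x: "x \<noteq> 0" for x
  proof -
    \<comment> \<open>The index of the shell containing x; its outer radius exceeds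
      \<open>norm x\<close> by at most the mesh width.\<close>
    define k where "k = (\<lambda>n. Suc (nat \<lfloor>norm x / h n\<rfloor>))"
    have r: "0 < norm x" using x by simp
    have kh: "norm x \<le> real (k n) * h n" "real (k n) * h n \<le> norm x + h n" for n
    proof -
      have "0 \<le> \<lfloor>norm x / h n\<rfloor>" using h_pos[of n] by simp
      then have "norm x / h n \<le> real (k n)" "real (k n) \<le> norm x / h n + 1" unfolding k_def by linarith+
      then show "norm x \<le> real (k n) * h n" "real (k n) * h n \<le> norm x + h n"
        using h_pos[of n] by (auto simp: field_simps)
    qed
    have klim: "(\<lambda>n. real (k n) * h n) \<longlonglongrightarrow> norm x"
    proof (rule tendsto_sandwich[OF _ _ tendsto_const])
      show "(\<lambda>n. norm x + h n) \<longlonglongrightarrow> norm x" using tendsto_add[OF tendsto_const h_0] by simp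
    qed (use kh in auto)
    have kn0: "\<forall>\<^sub>F n in sequentially. n0 n \<le> k n"
      using order_tendstoD(2)[OF n0h_0 r]
    proof eventually_elim
      case (elim n)
      then have "real (n0 n) * h n \<le> real (k n) * h n" using kh(1)[of n] by linarith
      then show ?case using h_pos[of n] by simp
    qed
    have fl: "filterlim (\<lambda>n. (n, k n)) (grid_filter n0 h (norm x)) sequentially"
      by (rule filterlim_grid_filterI[OF klim kn0])
    have "\<forall>\<^sub>F n in sequentially. case (n, k n) of (n, i) \<Rightarrow> i \<le> m n"
      using inner[OF r] fl unfolding filterlim_iff by blast
    with kn0 have "\<forall>\<^sub>F n in sequentially. ennreal (f n (k n)) = S n x"
    proof eventually_elim
      case (elim n)
      have "S n x = (\<Sum>i\<in>{n0 n..m n}. if i = k n then ennreal (f n i) else 0)"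
        unfolding S_def
      proof (rule sum.cong[OF refl])
        fix i assume "i \<in> {n0 n..m n}"
        then have "1 \<le> i" using n0[of n] by auto
        then show "ennreal (f n i) * indicator (shell (h n) i) x = (if i = k n then ennreal (f n i) else 0)"
          using mem_shell_iff[OF h_pos, of i x n] by (auto simp: k_def)
      qed
      also have "\<dots> = ennreal (f n (k n))" using elim by (simp add: sum.delta)
      finally show ?case by simp
    qed
    moreover have "(\<lambda>n. ennreal (f n (k n))) \<longlonglongrightarrow> ennreal (g (norm x))"
      using filterlim_compose[OF lim[OF r] fl] by (intro tendsto_ennrealI) simp
    ultimately show ?thesis by (rule Lim_transform_eventually[rotated])
  qed
  have "(\<integral>\<^sup>+ x. ennreal (g (norm x)) \<partial>(lborel :: 'a measure)) = (\<integral>\<^sup>+ x. liminf (\<lambda>n. S n x) \<partial>lborel)"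
  proof (rule nn_integral_cong_AE)
    show "AE x in lborel. ennreal (g (norm (x :: 'a))) = liminf (\<lambda>n. S n x)"
      using AE_lborel_singleton[of "0::'a"]
      by eventually_elim (simp add: lim_imp_Liminf[OF _ Slim])
  qed
  also have "\<dots> \<le> liminf (\<lambda>n. \<integral>\<^sup>+ x. S n x \<partial>lborel)" using Sm by (rule nn_integral_liminf)
  also have "\<dots> \<le> liminf (\<lambda>n. ennreal (c * C))" using Sint by (intro Liminf_mono eventuallyI) auto
  also have "\<dots> = ennreal (c * C)" by (simp add: Liminf_const)
  also have "\<dots> < \<infinity>" by simp
  finally show ?thesis .
qed

section \<open>The radial solution\<close>

context limit_profile
begin

text \<open>The flux vector field on the whole space is \<open>\<Phi> (norm x) *\<^sub>R x\<close>.
  The factor \<Phi> is bounded because the flux W is of order r to the power N.\<close>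

definition \<Phi> :: "real \<Rightarrow> real" where "\<Phi> r = W r / r ^ N"

definition \<Phi>' :: "real \<Rightarrow> real" where
  "\<Phi>' r = (Js (U r) (V r) + F' (U r)) / r - real N * \<Phi> r / r"

lemma \<Phi>_bound: "0 < r \<Longrightarrow> \<bar>\<Phi> r\<bar> \<le> K"
  using W_bound[of r] by (simp add: \<Phi>_def abs_divide divide_le_eq)

lemma \<Phi>_deriv:
  assumes r: "0 < r"
  shows "(\<Phi> has_real_derivative \<Phi>' r) (at r)"
proof -
  define E where "E = Js (U r) (V r) + F' (U r)"
  have rN: "r ^ N = r * r ^ (N - 1)" using N2 by (simp add: power_eq_if[of r N])
  have "((\<lambda>r. W r / r ^ N) has_real_derivative
      ((r ^ (N - 1) * E) * r ^ N - W r * (real N * r ^ (N - 1))) / (r ^ N * r ^ N)) (at r)"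
    using r by (intro DERIV_divide W_deriv[OF r, folded E_def] DERIV_pow) auto
  moreover have "((r ^ (N - 1) * E) * r ^ N - W r * (real N * r ^ (N - 1))) / (r ^ N * r ^ N) = E / r - real N * (W r / r ^ N) / r"
    using r unfolding rN by (simp add: field_simps)
  ultimately show ?thesis by (simp add: \<Phi>_def[abs_def] \<Phi>'_def E_def)
qed

lemma \<Phi>'_bound:
  obtains C where "0 \<le> C" "\<And>r. 0 < r \<Longrightarrow> r \<le> L \<Longrightarrow> \<bar>\<Phi>' r\<bar> \<le> C / r"
proof -
  define D where "D = (K * \<bar>L\<bar> / \<alpha>\<^sub>0) powr (1 / (p - 1))"
  define C where "C = \<beta> M * D powr p + (M powr (p - 1) + M powr (q - 1)) + real N * K"
  have "\<bar>\<Phi>' r\<bar> \<le> C / r" if r: "0 < r" "r \<le> L" for r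
  proof -
    have "\<bar>V r\<bar> \<le> (K * r / \<alpha>\<^sub>0) powr (1 / (p - 1))" using V_bound r by simp
    also have "\<dots> \<le> D" unfolding D_def using r K0 \<alpha>0 p1
      by (intro powr_mono2 divide_right_mono mult_left_mono) auto
    finally have VD: "\<bar>V r\<bar> \<le> D" .
    have "\<bar>Js (U r) (V r)\<bar> \<le> \<beta> \<bar>U r\<bar> * \<bar>V r\<bar> powr p" by (rule Js_bound)
    also have "\<dots> \<le> \<beta> M * D powr p"
      using U_bounds[of r] VD r p1 \<beta>_pos[of M]
      by (intro mult_mono powr_mono2 monoD[OF \<beta>_mono]) (auto simp: less_imp_le)
    finally have J: "\<bar>Js (U r) (V r)\<bar> \<le> \<beta> M * D powr p" .
    have F: "\<bar>F' (U r)\<bar> \<le> M powr (p - 1) + M powr (q - 1)"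
      using F'_le(1)[of "U r" M] U_bounds[of r] r by simp
    have P: "\<bar>real N * \<Phi> r\<bar> \<le> real N * K" using \<Phi>_bound[OF r(1)] by (simp add: abs_mult mult_left_mono)
    have "\<bar>Js (U r) (V r) + F' (U r) - real N * \<Phi> r\<bar> \<le> C" using J F P unfolding C_def by linarith
    moreover have "\<Phi>' r = (Js (U r) (V r) + F' (U r) - real N * \<Phi> r) / r" by (simp add: \<Phi>'_def diff_divide_distrib)
    ultimately show ?thesis using r by (simp add: abs_divide divide_right_mono)
  qed
  moreover have "0 \<le> C" using K0 \<beta>_pos[of M] by (simp add: C_def less_imp_le)
  ultimately show ?thesis using that by blast
qed

definition sol :: "'a::euclidean_space \<Rightarrow> real" where "sol x = U (norm x)"
definition dsol :: "'a::euclidean_space \<Rightarrow> 'a" where "dsol x = V (norm x) *\<^sub>R sgn x"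
definition field :: "'a::euclidean_space \<Rightarrow> 'a \<Rightarrow> real" where "field b x = \<Phi> (norm x) * (x \<bullet> b)"
text \<open>The derivative along b of the b-component of the flux field, off the origin; summed over
  the basis it is the divergence.\<close>

definition dfield :: "'a::euclidean_space \<Rightarrow> 'a \<Rightarrow> real" where
  "dfield b x = \<Phi>' (norm x) * (sgn x \<bullet> b) * (x \<bullet> b) + \<Phi> (norm x)"

lemma sol_bounds: "0 \<le> sol x" "sol x \<le> M"
  using U_bounds[of "norm x"] by (auto simp: sol_def)

lemma sol_lipschitz: "locally_lipschitz sol"
  unfolding locally_lipschitz_def
proof
  fix R
  obtain B where B: "\<And>r s. 0 \<le> r \<Longrightarrow> r \<le> R \<Longrightarrow> 0 \<le> s \<Longrightarrow> s \<le> R \<Longrightarrow> \<bar>U r - U s\<bar> \<le> B * \<bar>r - s\<bar>"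
    using U_lip[of R] by blast
  have "\<bar>sol x - sol y\<bar> \<le> \<bar>B\<bar> * norm (x - y)" if "norm x \<le> R" "norm y \<le> R" for x y :: 'a
  proof -
    have "\<bar>sol x - sol y\<bar> \<le> B * \<bar>norm x - norm y\<bar>" using B that by (simp add: sol_def)
    also have "\<dots> \<le> \<bar>B\<bar> * norm (x - y)" using norm_triangle_ineq3[of x y] by (intro mult_mono) auto
    finally show ?thesis .
  qed
  then show "\<exists>L. \<forall>x y. norm x \<le> R \<longrightarrow> norm y \<le> R \<longrightarrow> \<bar>sol x - sol (y::'a)\<bar> \<le> L * norm (x - y)" by blast
qed

lemma norm_line_deriv:
  fixes x b :: "'a::euclidean_space"
  assumes "x \<noteq> 0"
  shows "((\<lambda>t. norm (x + t *\<^sub>R b)) has_real_derivative sgn x \<bullet> b) (at 0)"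
proof -
  have 1: "((\<lambda>t. x + t *\<^sub>R b) has_derivative (\<lambda>t. t *\<^sub>R b)) (at 0)"
    by (auto intro!: derivative_eq_intros)
  have "(norm has_derivative (\<lambda>h. sgn x \<bullet> h)) (at (x + 0 *\<^sub>R b))" using has_derivative_norm[OF assms] by (simp add: inner_commute)
  from has_derivative_compose[OF 1 this]
  have "((\<lambda>t. norm (x + t *\<^sub>R b)) has_derivative (\<lambda>t. sgn x \<bullet> (t *\<^sub>R b))) (at 0)" .
  then show ?thesis by (rule has_derivative_imp_has_field_derivative) simp
qed

lemma sol_line_deriv:
  assumes "x \<noteq> 0"
  shows "((\<lambda>t. sol (x + t *\<^sub>R b)) has_real_derivative dsol x \<bullet> b) (at 0)"
proof -
  have "((\<lambda>t. U (norm (x + t *\<^sub>R b))) has_real_derivative V (norm x) * (sgn x \<bullet> b)) (at 0)"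
    by (rule DERIV_chain2[OF _ norm_line_deriv[OF assms]]) (use assms in \<open>simp add: U_deriv\<close>)
  then show ?thesis by (simp add: sol_def dsol_def)
qed

lemma field_line_deriv:
  fixes x b :: "'a::euclidean_space"
  assumes x: "x \<noteq> 0" and b: "b \<in> Basis"
  shows "((\<lambda>t. field b (x + t *\<^sub>R b)) has_real_derivative dfield b x) (at 0)"
proof -
  have 1: "((\<lambda>t. \<Phi> (norm (x + t *\<^sub>R b))) has_real_derivative \<Phi>' (norm x) * (sgn x \<bullet> b)) (at 0)"
    by (rule DERIV_chain2[OF _ norm_line_deriv[OF x]]) (use x in \<open>simp add: \<Phi>_deriv\<close>)
  have 2: "((\<lambda>t. (x + t *\<^sub>R b) \<bullet> b) has_real_derivative 1) (at 0)"
    using b by (auto simp: inner_add_left intro!: derivative_eq_intros)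
  from DERIV_mult[OF 1 2] show ?thesis by (simp add: field_def dfield_def add.commute)
qed

text \<open>The derivative of \<Phi> may blow up like 1 / r. Taking y with the smaller norm s, the
  difference of \<Phi> is at most C / s times the difference of the norms and is multiplied by a
  component of y, of size at most s. The singularity cancels, so the field is Lipschitz across the
  origin.\<close>

lemma field_lipschitz:
  fixes b :: "'a::euclidean_space"
  assumes b: "b \<in> Basis"
  shows "locally_lipschitz (field b)"
  unfolding locally_lipschitz_def
proof
  fix R
  obtain C where C: "0 \<le> C" "\<And>r. 0 < r \<Longrightarrow> r \<le> R \<Longrightarrow> \<bar>\<Phi>' r\<bar> \<le> C / r" using \<Phi>'_bound[of R] by blast
  have inner: "\<bar>z \<bullet> b\<bar> \<le> norm z" for z using b by (rule Basis_le_norm)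
  have main: "\<bar>field b x - field b y\<bar> \<le> (K + C) * norm (x - y)"
    if "norm x \<le> R" "norm y \<le> norm x" for x y :: 'a
  proof (cases "y = 0")
    case True
    show ?thesis
    proof (cases "x = 0")
      case False
      have "\<bar>field b x - field b y\<bar> = \<bar>\<Phi> (norm x)\<bar> * \<bar>x \<bullet> b\<bar>" using True by (simp add: field_def abs_mult)
      also have "\<dots> \<le> (K + C) * norm x"
        using \<Phi>_bound[of "norm x"] False inner[of x] C K0 by (intro mult_mono) auto
      finally show ?thesis using True by simp
    qed (use True in simp)
  next
    case False
    define r s where "r = norm x" and "s = norm y"
    have rs: "0 < s" "s \<le> r" "r \<le> R" using that False by (auto simp: r_def s_def)
    have "\<bar>\<Phi> r - \<Phi> s\<bar> \<le> C / s * (r - s)"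
    proof -
      have "norm (\<Phi> r - \<Phi> s) \<le> C / s * norm (r - s)"
      proof (rule field_differentiable_bound[of "{s..r}" \<Phi> \<Phi>'])
        fix z assume z: "z \<in> {s..r}"
        then show "(\<Phi> has_real_derivative \<Phi>' z) (at z within {s..r})"
          using \<Phi>_deriv[of z, THEN has_field_derivative_at_within] rs by auto
        have "\<bar>\<Phi>' z\<bar> \<le> C / z" using C(2)[of z] z rs by auto
        also have "\<dots> \<le> C / s" using z rs C(1) by (intro divide_left_mono) auto
        finally show "norm (\<Phi>' z) \<le> C / s" by simp
      qed (use rs in auto)
      then show ?thesis using rs by simp
    qed
    then have "\<bar>\<Phi> r - \<Phi> s\<bar> * \<bar>y \<bullet> b\<bar> \<le> C / s * (r - s) * s"
      using inner[of y] rs C(1) by (intro mult_mono) (auto simp: s_def)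
    also have "\<dots> = C * (r - s)" using rs by simp
    also have "\<dots> \<le> C * norm (x - y)" using C(1) norm_triangle_ineq2[of x y]
      by (intro mult_left_mono) (auto simp: r_def s_def)
    finally have 1: "\<bar>\<Phi> r - \<Phi> s\<bar> * \<bar>y \<bullet> b\<bar> \<le> C * norm (x - y)" .
    have "field b x - field b y = \<Phi> r * ((x - y) \<bullet> b) + (\<Phi> r - \<Phi> s) * (y \<bullet> b)"
      by (simp add: field_def r_def s_def algebra_simps)
    then have "\<bar>field b x - field b y\<bar> \<le> \<bar>\<Phi> r\<bar> * \<bar>(x - y) \<bullet> b\<bar> + \<bar>\<Phi> r - \<Phi> s\<bar> * \<bar>y \<bullet> b\<bar>"
      by (metis abs_mult abs_triangle_ineq)
    moreover have "\<bar>\<Phi> r\<bar> * \<bar>(x - y) \<bullet> b\<bar> \<le> K * norm (x - y)"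
      using \<Phi>_bound[of r] rs inner[of "x - y"] K0 by (intro mult_mono) auto
    ultimately show ?thesis using 1 by (simp add: distrib_right)
  qed
  have "\<bar>field b x - field b y\<bar> \<le> (K + C) * norm (x - y)" if "norm x \<le> R" "norm y \<le> R" for x y :: 'a
  proof (cases "norm y \<le> norm x")
    case False
    then show ?thesis using main[of y x] that by (simp add: abs_minus_commute norm_minus_commute)
  qed (use main that in auto)
  then show "\<exists>L. \<forall>x y. norm x \<le> R \<longrightarrow> norm y \<le> R \<longrightarrow> \<bar>field b x - field b y\<bar> \<le> L * norm (x - y)" by blast
qed

lemma isCont_norm_compose:
  fixes x :: "'a::euclidean_space"
  assumes "x \<noteq> 0" "isCont f (norm x)"
  shows "isCont (\<lambda>x. f (norm x)) x"
  using assms by (intro isCont_o2[where g = f and f = norm] continuous_intros) auto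

lemma continuous_on_off_0:
  assumes "\<And>r. 0 < r \<Longrightarrow> isCont f r"
  shows "continuous_on (- {0 :: 'a::euclidean_space}) (\<lambda>x. f (norm x))"
  by (intro continuous_at_imp_continuous_on ballI isCont_norm_compose assms) auto

lemma isCont_\<Phi>: "0 < r \<Longrightarrow> isCont \<Phi> r"
  using \<Phi>_deriv DERIV_isCont by blast

lemma isCont_\<Phi>': "0 < r \<Longrightarrow> isCont \<Phi>' r"
proof -
  assume r: "0 < r"
  have F'c: "isCont F' x" for x
    using continuous_on_F'[of UNIV "\<lambda>x. x"] by (simp add: continuous_on_eq_continuous_at)
  show ?thesis unfolding isCont_def \<Phi>'_def[abs_def]
    using r isCont_U[OF r] isCont_V[OF r] isCont_\<Phi>[OF r]
    by (intro tendsto_intros isCont_tendsto_compose[OF F'c]) (auto simp: isCont_def)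
qed

lemma continuous_on_dfield: "continuous_on (- {0}) (dfield (b :: 'a::euclidean_space))"
  unfolding dfield_def
  by (intro continuous_intros continuous_on_off_0 isCont_\<Phi> isCont_\<Phi>' continuous_on_sgn) auto

lemma norm_dsol: "x \<noteq> 0 \<Longrightarrow> norm (dsol x) = \<bar>V (norm x)\<bar>"
  by (simp add: dsol_def norm_sgn)

lemma dsol_0 [simp]: "dsol 0 = 0"
  by (simp add: dsol_def)

text \<open>At the origin the unit vector is discontinuous, but its factor V tends to 0 there by
  \<open>V_bound\<close>.\<close>

lemma continuous_on_dsol: "continuous_on UNIV (dsol :: 'a::euclidean_space \<Rightarrow> 'a)"
proof (rule continuous_at_imp_continuous_on, rule ballI)
  fix x :: 'a
  show "isCont dsol x"
  proof (cases "x = 0")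
    case False
    then have "isCont (\<lambda>x. V (norm x) *\<^sub>R sgn x) x"
      by (intro continuous_scaleR isCont_norm_compose isCont_V isCont_sgn continuous_ident) auto
    then show ?thesis by (simp add: dsol_def[abs_def])
  next
    case True
    have "((\<lambda>x::'a. (K * norm x / \<alpha>\<^sub>0) powr (1 / (p - 1))) \<longlongrightarrow> (K * norm (0::'a) / \<alpha>\<^sub>0) powr (1 / (p - 1))) (at 0)"
      using p1 \<alpha>0 K0 by (intro tendsto_powr2 tendsto_intros) auto
    then have lim: "((\<lambda>x::'a. (K * norm x / \<alpha>\<^sub>0) powr (1 / (p - 1))) \<longlongrightarrow> 0) (at 0)" using p1 by simp
    have "(dsol \<longlongrightarrow> 0) (at (0::'a))"
      by (rule Lim_null_comparison[OF _ lim])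
        (auto simp: eventually_at_filter norm_dsol V_bound intro!: eventuallyI)
    then show ?thesis using True by (simp add: isCont_def)
  qed
qed

lemma continuous_on_sol: "continuous_on UNIV (sol :: 'a::euclidean_space \<Rightarrow> real)"
  using sol_lipschitz by (rule locally_lipschitz_continuous)

lemma flux_eq_field:
  fixes x y :: "'a::euclidean_space"
  shows "(jt (sol x) (norm (dsol x)) *\<^sub>R sgn (dsol x)) \<bullet> y = (\<Sum>b\<in>Basis. field b x * (y \<bullet> b))"
proof (cases "x = 0")
  case False
  define r where "r = norm x"
  have r: "0 < r" using False by (simp add: r_def)
  have rN: "r ^ N = r ^ (N - 1) * r" using N2 by (simp add: power_eq_if[of r N])
  have sx: "sgn (sgn x) = sgn x" using False by (simp add: sgn_div_norm)
  have "jt (sol x) (norm (dsol x)) *\<^sub>R sgn (dsol x) = Jt (U r) (V r) *\<^sub>R sgn x"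
    unfolding norm_dsol[OF False] by (simp add: dsol_def sol_def r_def Jt_def sgn_scaleR sx)
  also have "sgn x = (1 / r) *\<^sub>R x" by (simp add: sgn_div_norm r_def divide_inverse)
  also have "Jt (U r) (V r) *\<^sub>R ((1 / r) *\<^sub>R x) = \<Phi> r *\<^sub>R x"
    unfolding Jt_V \<Phi>_def rN by simp
  finally have "(jt (sol x) (norm (dsol x)) *\<^sub>R sgn (dsol x)) \<bullet> y = \<Phi> r * (x \<bullet> y)" by simp
  also have "\<dots> = (\<Sum>b\<in>Basis. field b x * (y \<bullet> b))"
    unfolding euclidean_inner[of x y] by (simp add: field_def r_def sum_distrib_left mult_ac)
  finally show ?thesis .
qed (simp add: field_def)

text \<open>The divergence of \<open>\<Phi> (norm x) *\<^sub>R x\<close> is r times \<Phi>' plus N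
  times \<Phi>, and the definition of \<Phi>' is the radial equation solved for it.\<close>

lemma sum_dfield:
  fixes x :: "'a::euclidean_space"
  assumes x: "x \<noteq> 0" and N: "N = DIM('a)"
  shows "(\<Sum>b\<in>Basis. dfield b x) = js (sol x) (norm (dsol x)) + F' (sol x)"
proof -
  define r where "r = norm x"
  have r: "0 < r" using x by (simp add: r_def)
  have "(\<Sum>b\<in>Basis. dfield b x) = \<Phi>' r * (\<Sum>b\<in>Basis. (sgn x \<bullet> b) * (x \<bullet> b)) + real N * \<Phi> r"
    by (simp add: dfield_def sum.distrib sum_distrib_left r_def mult_ac flip: N)
  also have "(\<Sum>b\<in>Basis. (sgn x \<bullet> b) * (x \<bullet> b)) = sgn x \<bullet> x" by (simp add: euclidean_inner[of "sgn x" x])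
  also have "\<dots> = r" using x by (simp add: sgn_div_norm r_def dot_square_norm power2_eq_square)
  also have "\<Phi>' r * r + real N * \<Phi> r = Js (U r) (V r) + F' (U r)" using r by (simp add: \<Phi>'_def field_simps)
  also have "Js (U r) (V r) = js (sol x) (norm (dsol x))" using norm_dsol[OF x] by (simp add: Js_def sol_def r_def)
  finally show ?thesis by (simp add: sol_def r_def)
qed

text \<open>The Lipschitz components of the flux are integrated by parts one coordinate at a time.
  The divergence is identified with the remaining terms off the origin, which suffices almost
  everywhere.\<close>

lemma radial_solution:
  assumes N: "N = DIM('a::euclidean_space)"
  shows "solves_quasilinear p q js jt (sol :: 'a \<Rightarrow> real) dsol"
  unfolding solves_quasilinear_def
proof (intro allI impI)
  fix v :: "'a \<Rightarrow> real" assume v: "test_function v"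
  obtain R where R: "0 < R" "\<And>x. R < norm x \<Longrightarrow> v x = 0" "\<And>x. R < norm x \<Longrightarrow> gradient v x = 0"
    using test_function_support[OF v] by blast
  have vc: "continuous_on UNIV v" using v by (rule continuous_on_test_function)
  have uc: "continuous_on UNIV (sol :: 'a \<Rightarrow> real)" by (rule continuous_on_sol)
  have int: "integrable lebesgue (\<lambda>x. k x * v x)" if "continuous_on UNIV k" for k :: "'a \<Rightarrow> real"
    using R(2) by (intro integrable_continuous_compact_support(2)[of _ R] continuous_intros that vc) auto
  have pw: "\<bar>sol x\<bar> powr (s - 2) * sol x = sol x powr (s - 1)" for x :: 'a and s
    using powr_mult_base[of "sol x" "s - 2"] sol_bounds[of x] by (simp add: mult.commute)
  have pwc: "continuous_on UNIV (\<lambda>x :: 'a. \<bar>sol x\<bar> powr (s - 2) * sol x)" if "1 < s" for s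
    unfolding pw by (rule continuous_on_powr'[OF uc continuous_on_const]) (use that sol_bounds in auto)
  have jsc: "continuous_on UNIV (\<lambda>x :: 'a. js (sol x) (norm (dsol x)))"
  proof -
    have "continuous_on UNIV (\<lambda>x :: 'a. Js (sol x) (norm (dsol x)))"
      by (intro continuous_intros uc continuous_on_dsol)
    then show ?thesis by (simp add: Js_def)
  qed
  have ibp: "integrable lebesgue (\<lambda>x. field b x * (gradient v x \<bullet> b))" "integrable lebesgue (\<lambda>x. dfield b x * v x)"
    "(\<integral>x. field b x * (gradient v x \<bullet> b) \<partial>lebesgue) = - (\<integral>x. dfield b x * v x \<partial>lebesgue)"
    if "b \<in> Basis" for b
    using integration_by_parts[OF v that field_lipschitz[OF that] field_line_deriv[OF _ that] continuous_on_dfield] by blast+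
  have i1: "integrable lebesgue (\<lambda>x. (jt (sol x) (norm (dsol x)) *\<^sub>R sgn (dsol x)) \<bullet> gradient v x)"
    unfolding flux_eq_field using ibp by (intro Bochner_Integration.integrable_sum) auto
  have i2: "integrable lebesgue (\<lambda>x. js (sol x) (norm (dsol x)) * v x)" by (rule int[OF jsc])
  have i3: "integrable lebesgue (\<lambda>x. \<bar>sol x\<bar> powr (p - 2) * sol x * v x)" by (rule int[OF pwc[OF p1]])
  have i4: "integrable lebesgue (\<lambda>x. \<bar>sol x\<bar> powr (q - 2) * sol x * v x)"
    using p1 pq by (intro int pwc) auto
  have "(\<integral>x. (jt (sol x) (norm (dsol x)) *\<^sub>R sgn (dsol x)) \<bullet> gradient v x \<partial>lebesgue)
      = (\<Sum>b\<in>Basis. \<integral>x. field b x * (gradient v x \<bullet> b) \<partial>lebesgue)"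
    unfolding flux_eq_field using ibp by (intro Bochner_Integration.integral_sum) auto
  also have "\<dots> = - (\<Sum>b\<in>Basis. \<integral>x. dfield b x * v x \<partial>lebesgue)"
    using ibp(3) by (simp add: sum_negf)
  also have "(\<Sum>b\<in>Basis. \<integral>x. dfield b x * v x \<partial>lebesgue) = (\<integral>x. (\<Sum>b\<in>Basis. dfield b x * v x) \<partial>lebesgue)"
    using ibp by (intro Bochner_Integration.integral_sum[symmetric]) auto
  also have "\<dots> = (\<integral>x. js (sol x) (norm (dsol x)) * v x + \<bar>sol x\<bar> powr (p - 2) * sol x * v x
      - \<bar>sol x\<bar> powr (q - 2) * sol x * v x \<partial>lebesgue)"
  proof (rule integral_cong_AE)
    show "(\<lambda>x. \<Sum>b\<in>Basis. dfield b x * v x) \<in> borel_measurable lebesgue"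
      using ibp(2) by (intro borel_measurable_sum) auto
    show "(\<lambda>x. js (sol x) (norm (dsol x)) * v x + \<bar>sol x\<bar> powr (p - 2) * sol x * v x
      - \<bar>sol x\<bar> powr (q - 2) * sol x * v x) \<in> borel_measurable lebesgue"
      by (intro borel_measurable_diff borel_measurable_add borel_measurable_integrable i2 i3 i4)
    have "AE x in lebesgue. x \<noteq> (0::'a)" by (rule AE_completion[OF AE_lborel_singleton])
    then show "AE x in lebesgue. (\<Sum>b\<in>Basis. dfield b x * v x)
       = js (sol x) (norm (dsol x)) * v x + \<bar>sol x\<bar> powr (p - 2) * sol x * v x
      - \<bar>sol x\<bar> powr (q - 2) * sol x * v x"
    proof eventually_elim
      case (elim x)
      have "(\<Sum>b\<in>Basis. dfield b x * v x) = (js (sol x) (norm (dsol x)) + F' (sol x)) * v x"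
        using sum_dfield[OF elim N] by (simp flip: sum_distrib_right)
      moreover have "F' (sol x) = sol x powr (p - 1) - sol x powr (q - 1)"
        using sol_bounds[of x] p1 pq by (cases "sol x = 0") (auto simp: F'_def)
      ultimately show ?case unfolding pw by (simp add: algebra_simps)
    qed
  qed
  also have "\<dots> = (\<integral>x. js (sol x) (norm (dsol x)) * v x \<partial>lebesgue) + (\<integral>x. \<bar>sol x\<bar> powr (p - 2) * sol x * v x \<partial>lebesgue)
      - (\<integral>x. \<bar>sol x\<bar> powr (q - 2) * sol x * v x \<partial>lebesgue)"
    using i2 i3 i4 by simp
  finally show "integrable lebesgue (\<lambda>x. (jt (sol x) (norm (dsol x)) *\<^sub>R sgn (dsol x)) \<bullet> gradient v x) \<and>
     integrable lebesgue (\<lambda>x. js (sol x) (norm (dsol x)) * v x) \<and>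
     integrable lebesgue (\<lambda>x. \<bar>sol x\<bar> powr (p - 2) * sol x * v x) \<and>
     integrable lebesgue (\<lambda>x. \<bar>sol x\<bar> powr (q - 2) * sol x * v x) \<and>
     (\<integral>x. (jt (sol x) (norm (dsol x)) *\<^sub>R sgn (dsol x)) \<bullet> gradient v x \<partial>lebesgue)
       + (\<integral>x. js (sol x) (norm (dsol x)) * v x \<partial>lebesgue)
       + (\<integral>x. \<bar>sol x\<bar> powr (p - 2) * sol x * v x \<partial>lebesgue)
     = (\<integral>x. \<bar>sol x\<bar> powr (q - 2) * sol x * v x \<partial>lebesgue)"
    using i1 i2 i3 i4 by simp
qed

section \<open>Weak gradient and membership in the Sobolev space\<close>

lemma locally_integrable_continuous:
  fixes f :: "'a::euclidean_space \<Rightarrow> 'b::euclidean_space"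
  assumes f: "continuous_on UNIV f"
  shows "locally_integrable f"
  unfolding locally_integrable_def set_integrable_def
proof (intro allI impI)
  fix S :: "'a set" assume S: "compact S"
  have "integrable lborel (\<lambda>x. indicator S x *\<^sub>R f x)"
    by (rule borel_integrable_compact[OF S]) (use f in \<open>auto intro: continuous_on_subset\<close>)
  moreover have "(\<lambda>x. indicator S x *\<^sub>R f x) \<in> borel_measurable lborel"
    using calculation by (rule borel_measurable_integrable)
  ultimately show "integrable lebesgue (\<lambda>x. indicator S x *\<^sub>R f x)" by (simp add: integrable_completion)
qed

lemma sol_weak_gradient: "has_weak_gradient (sol :: 'a::euclidean_space \<Rightarrow> real) dsol"
  unfolding has_weak_gradient_def
proof (intro conjI allI impI ballI)
  show "locally_integrable (sol :: 'a \<Rightarrow> real)" "locally_integrable (dsol :: 'a \<Rightarrow> 'a)"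
    by (intro locally_integrable_continuous continuous_on_sol continuous_on_dsol)+
  fix v :: "'a \<Rightarrow> real" and b :: 'a assume v: "test_function v" and b: "b \<in> Basis"
  have "continuous_on (- {0}) (\<lambda>x::'a. dsol x \<bullet> b)"
    by (intro continuous_intros continuous_on_subset[OF continuous_on_dsol]) auto
  then show "(\<integral>x. sol x * (gradient v x \<bullet> b) \<partial>lebesgue) = - (\<integral>x. (dsol x \<bullet> b) * v x \<partial>lebesgue)"
    by (intro integration_by_parts(3)[OF v b sol_lipschitz sol_line_deriv])
qed

lemma in_LpI:
  fixes f :: "'a::euclidean_space \<Rightarrow> 'b::euclidean_space"
  assumes f: "continuous_on UNIV f" and r: "\<And>x. x \<noteq> 0 \<Longrightarrow> norm (f x) powr s = g (norm x)"
    and fin: "(\<integral>\<^sup>+ x. ennreal (g (norm x)) \<partial>(lborel :: 'a measure)) < \<infinity>"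
  shows "in_Lp s f"
proof -
  have m: "f \<in> borel_measurable lborel" using borel_measurable_continuous_onI[OF f] by simp
  have m': "(\<lambda>x. norm (f x) powr s) \<in> borel_measurable lborel" using m by measurable
  have "(\<integral>\<^sup>+ x. ennreal (norm (norm (f x) powr s)) \<partial>lborel) = (\<integral>\<^sup>+ x. ennreal (g (norm x)) \<partial>(lborel :: 'a measure))"
  proof (rule nn_integral_cong_AE)
    show "AE x in lborel. ennreal (norm (norm (f x) powr s)) = ennreal (g (norm (x :: 'a)))"
      using AE_lborel_singleton[of "0::'a"] by eventually_elim (simp flip: r)
  qed
  then have "integrable lborel (\<lambda>x. norm (f x) powr s)" using m' fin by (intro integrableI_bounded) auto
  then have "integrable lebesgue (\<lambda>x. norm (f x) powr s)" using m' by (simp add: integrable_completion)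
  moreover have "f \<in> borel_measurable lebesgue" using m by (rule measurable_completion)
  ultimately show ?thesis by (simp add: in_Lp_def)
qed

lemma n0_ge_1: "1 \<le> n0 n"
  using approx[of n] by (simp add: mesh_estimates_def)

lemma sol_in_Lp:
  assumes N: "N = DIM('a::euclidean_space)"
  shows "in_Lp p (sol :: 'a \<Rightarrow> real)"
proof (rule in_LpI[OF continuous_on_sol, where g = "\<lambda>r. U r powr p"])
  show "(\<integral>\<^sup>+ x. ennreal (U (norm x) powr p) \<partial>(lborel :: 'a measure)) < \<infinity>"
  proof (rule radial_fatou[OF N, where f = "\<lambda>n i. u n i powr p" and m = m and C = CP])
    show "h n ^ N * (\<Sum>i=n0 n..m n. real i ^ (N - 1) * u n i powr p) \<le> CP" for n
      using approx[of n] by (simp add: mesh_estimates_def)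
    show "1 \<le> n0 n" for n by (rule n0_ge_1)
    fix r :: real assume r: "0 < r"
    have "((\<lambda>z. (\<lambda>(n, i). u n i) z powr p) \<longlongrightarrow> U r powr p) (grid_filter n0 h r)"
      using r u_lim[of r] p1 u_bounds by (intro tendsto_powr2 tendsto_const) (auto simp: case_prod_unfold intro!: eventuallyI)
    then show "((\<lambda>(n, i). u n i powr p) \<longlongrightarrow> U r powr p) (grid_filter n0 h r)" by (simp add: case_prod_unfold)
    show "\<forall>\<^sub>F (n, i) in grid_filter n0 h r. i \<le> m n" using eventually_inner[OF r] by eventually_elim auto
  qed simp
qed (simp add: sol_def U_bounds(1))

lemma dsol_in_Lp:
  assumes N: "N = DIM('a::euclidean_space)"
  shows "in_Lp p (dsol :: 'a \<Rightarrow> 'a)"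
proof (rule in_LpI[OF continuous_on_dsol, where g = "\<lambda>r. \<bar>V r\<bar> powr p"])
  show "(\<integral>\<^sup>+ x. ennreal (\<bar>V (norm x)\<bar> powr p) \<partial>(lborel :: 'a measure)) < \<infinity>"
  proof (rule radial_fatou[OF N, where f = "\<lambda>n i. \<bar>d n i\<bar> powr p" and m = "\<lambda>n. Suc (m n)" and C = CA])
    \<comment> \<open>The gradient sum runs one node beyond \<open>m n\<close>, to include the final
      drop to 0.\<close>
    show "h n ^ N * (\<Sum>i=n0 n..Suc (m n). real i ^ (N - 1) * \<bar>d n i\<bar> powr p) \<le> CA" for n
      using approx[of n] unfolding mesh_estimates_def d_def by blast
    show "1 \<le> n0 n" for n by (rule n0_ge_1)
    fix r :: real assume r: "0 < r"
    have "((\<lambda>z. \<bar>(\<lambda>(n, i). d n i) z\<bar> powr p) \<longlongrightarrow> \<bar>V r\<bar> powr p) (grid_filter n0 h r)"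
      using p1 by (intro tendsto_powr2 tendsto_const tendsto_rabs d_lim r) auto
    then show "((\<lambda>(n, i). \<bar>d n i\<bar> powr p) \<longlongrightarrow> \<bar>V r\<bar> powr p) (grid_filter n0 h r)" by (simp add: case_prod_unfold)
    show "\<forall>\<^sub>F (n, i) in grid_filter n0 h r. i \<le> Suc (m n)" using eventually_inner[OF r] by eventually_elim auto
  qed simp
qed (auto simp: norm_dsol)

lemma radial_sol: "radial (sol :: 'a::euclidean_space \<Rightarrow> real)"
  unfolding radial_def sol_def by (auto simp: orthogonal_transformation_norm)

lemma sol_pos: "AE x in lebesgue. 0 < sol (x :: 'a::euclidean_space)"
proof -
  have "AE x in lebesgue. x \<noteq> (0::'a)" by (rule AE_completion[OF AE_lborel_singleton])
  then show ?thesis by eventually_elim (simp add: sol_def U_pos)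
qed

end

theorem (in quasilinear) radial_solution_exists:
  assumes N: "N = DIM('a::euclidean_space)"
  shows "\<exists>(u :: 'a \<Rightarrow> real) Du. u \<in> W1p p \<and> has_weak_gradient u Du \<and> solves_quasilinear p q js jt u Du \<and>
    radial u \<and> \<not> (AE x in lebesgue. u x = 0) \<and> (AE x in lebesgue. u x > 0)"
proof -
  obtain n0 h m u M K \<rho> CP CA U W
    where "limit_profile N p q \<alpha>\<^sub>0 R j js jt \<alpha> \<beta> n0 h m u M K \<rho> CP CA U W"
    using limit_profile_exists by blast
  then interpret L: limit_profile N p q \<alpha>\<^sub>0 R j js jt \<alpha> \<beta> n0 h m u M K \<rho> CP CA U W .
  have "\<not> (AE x in lebesgue. L.sol (x :: 'a) = 0)"
  proof
    assume "AE x in lebesgue. L.sol (x :: 'a) = 0"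
    with L.sol_pos have "AE x in (lebesgue :: 'a measure). False" by eventually_elim simp
    then show False by (simp add: eventually_False trivial_limit_def[symmetric] ae_filter_eq_bot_iff)
  qed
  then show ?thesis
    using L.sol_in_Lp[OF N] L.dsol_in_Lp[OF N] L.sol_weak_gradient L.radial_solution[OF N] L.radial_sol L.sol_pos
    unfolding W1p_def by blast
qed

theorem corollary6p5:
  fixes p q \<alpha>\<^sub>0 R R' \<delta> :: real
    and j js jt :: "real \<Rightarrow> real \<Rightarrow> real"
    and \<alpha> \<beta> \<gamma> :: "real \<Rightarrow> real"
  assumes N: "CARD('n::finite) \<ge> 2"
    and p: "1 < p" "p < real CARD('n)"
    and q: "p < q" "q < real CARD('n) * p / (real CARD('n) - p)"
    and C1: "C1_half_plane j js jt"
    and J1: "\<And>s. strictly_convex_on {0..} (j s)" "\<And>s. mono_on {0..} (j s)"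
    and J2: "\<alpha>\<^sub>0 > 0" "continuous_on UNIV \<alpha>" "mono \<alpha>" "\<And>x. \<alpha> x > 0"
      "\<And>s t. t \<ge> 0 \<Longrightarrow> \<alpha>\<^sub>0 * t powr p \<le> j s t \<and> j s t \<le> \<alpha> \<bar>s\<bar> * t powr p"
    and J3: "continuous_on UNIV \<beta>" "mono \<beta>" "\<And>x. \<beta> x > 0"
      "\<And>s t. t \<ge> 0 \<Longrightarrow> \<bar>js s t\<bar> \<le> \<beta> \<bar>s\<bar> * t powr p"
    and J4: "continuous_on UNIV \<gamma>" "mono \<gamma>" "\<And>x. \<gamma> x > 0"
      "\<And>s t. t \<ge> 0 \<Longrightarrow> \<bar>jt s t\<bar> \<le> \<gamma> \<bar>s\<bar> * t powr (p - 1)"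
    and J5: "R > 0" "\<And>s t. t \<ge> 0 \<Longrightarrow> \<bar>s\<bar> \<ge> R \<Longrightarrow> js s t * s \<ge> 0"
    and J6: "R' > 0" "\<delta> > 0"
      "\<And>s t. t \<ge> 0 \<Longrightarrow> \<bar>s\<bar> \<ge> R' \<Longrightarrow> q * j s t - js s t * s - (1 + \<delta>) * jt s t * t \<ge> 0"
    and J7: "((\<lambda>s. \<alpha> \<bar>s\<bar> / \<bar>s\<bar> powr (q - p)) \<longlongrightarrow> 0) at_infinity"
  shows "\<exists>(u :: real^'n \<Rightarrow> real) Du.
           u \<in> W1p p \<and> has_weak_gradient u Du \<and>
           solves_quasilinear p q js jt u Du \<and>
           radial u \<and> \<not> (AE x in lebesgue. u x = 0) \<and> (AE x in lebesgue. u x > 0)"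
proof -
  have jt_0: "jt s 0 = 0" for s using J4(4)[of 0 s] p(1) by simp
  interpret quasilinear "CARD('n)" p q \<alpha>\<^sub>0 R j js jt \<alpha> \<beta>
    using assms jt_0 by unfold_locales auto
  show ?thesis by (rule radial_solution_exists) simp
qed

end
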